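(* Let $k\geq t\geq 14$ and $n\geq (t+1)k$ be integers. If $\mathcal{A}\subset\binom{[n]}{k}$ and $\mathcal{B}\subset\binom{[n]}{k}$ are cross $t$-intersecting, then $$|\mathcal{A}||\mathcal{B}|\leq\binom{n-t}{k-t}^2,$$ with equality if and only if $\mathcal{A}=\mathcal{B}\cong\mathcal{F}_0^t(n,k)$.
   Context: $[n]=\{1,\dots,n\}$ and $\binom{[n]}{k}$ is the set of all $k$-element subsets of $[n]$. Two families $\mathcal{A},\mathcal{B}$ of subsets of $[n]$ are cross $t$-intersecting if $|A\cap B|\geq t$ for all $A\in\mathcal{A}$, $B\in\mathcal{B}$. For $0\le i\le k-t$, $\mathcal{F}_i^t(n,k)=\{F\in\binom{[n]}{k}: |F\cap[t+2i]|\geq t+i\}$; in particular $\mathcal{F}_0^t(n,k)=\{F\in\binom{[n]}{k}:[t]\subset F\}$. Two families $\mathcal{A},\mathcal{B}\subset 2^{[n]}$ are isomorphic, written $\mathcal{A}\cong\mathcal{B}$, if there is a permutation $f$ of $[n]$ with $\mathcal{A}=\{\{f(b):b\in B\}:B\in\mathcal{B}\}$. *)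

theory Defs
  imports "HOL-Library.Ramsey" "HOL-Combinatorics.Permutations"
begin

text \<open>
  The ground set is \<open>{1..n} :: nat set\<close>, and the family of its \<open>k\<close>-element subsets is
  \<^term>\<open>nsets {1..n} k\<close>.
\<close>

definition cross_intersecting :: "nat \<Rightarrow> 'a set set \<Rightarrow> 'a set set \<Rightarrow> bool" where
  "cross_intersecting t \<A> \<B> \<longleftrightarrow> (\<forall>A\<in>\<A>. \<forall>B\<in>\<B>. t \<le> card (A \<inter> B))"

text \<open>The family \<open>\<F>\<^sub>i\<^sup>t(n,k)\<close>, intended for \<open>i \<le> k - t\<close>.\<close>

definition frankl_family :: "nat \<Rightarrow> nat \<Rightarrow> nat \<Rightarrow> nat \<Rightarrow> nat set set" where
  "frankl_family i t n k = {F \<in> nsets {1..n} k. t + i \<le> card (F \<inter> {1..t + 2 * i})}"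

lemma frankl_family_0: "frankl_family 0 t n k = {F \<in> nsets {1..n} k. {1..t} \<subseteq> F}"
proof -
  have "t \<le> card (F \<inter> {1..t}) \<longleftrightarrow> {1..t} \<subseteq> F" for F :: "nat set"
  proof
    assume "t \<le> card (F \<inter> {1..t})"
    then have "F \<inter> {1..t} = {1..t}"
      by (intro card_seteq) auto
    then show "{1..t} \<subseteq> F" by blast
  next
    assume "{1..t} \<subseteq> F"
    then have "F \<inter> {1..t} = {1..t}" by blast
    then show "t \<le> card (F \<inter> {1..t})" by simp
  qed
  then show ?thesis
    by (simp add: frankl_family_def)
qed

definition isomorphic_families :: "nat \<Rightarrow> nat set set \<Rightarrow> nat set set \<Rightarrow> bool" where
  "isomorphic_families n \<A> \<B> \<longleftrightarrow> (\<exists>f. f permutes {1..n} \<and> \<A> = (\<lambda>B. f ` B) ` \<B>)"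

end

theory Submission
  imports Defs "HOL-Analysis.Complex_Transcendental"
begin

text \<open>
  Compressing both families towards small elements keeps them cross \<open>t\<close>-intersecting, and a
  compressed pair that gives the full star can only come from a pair of equal full stars. A
  \<open>k\<close>-set is read as a lattice walk (up at its elements, down elsewhere). For compressed families
  any two walks \<open>A\<close> and \<open>B\<close> have heights with sum at least \<open>2 t\<close> at some common time. Choose
  \<open>u + v = 2 t\<close> such that all \<open>A\<close> reach \<open>u\<close> and all \<open>B\<close> reach \<open>v\<close>. At most
  \<open>n choose (k - u)\<close> walks reach \<open>u\<close>, and at most \<open>2 * ((n - 1) choose (k - u - 1))\<close> reach it
  twice, which is too few since \<open>2 * exp 2 < t + 1\<close> for \<open>t \<ge> 14\<close>. So each family has a walk that
  reaches its level exactly once; then it does so at the same time \<open>J = u + 2 s = v + 2 s'\<close> in both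
  families, and every other walk is at its level at time \<open>J\<close> or exceeds the level somewhere. If
  \<open>max s s' \<ge> 2\<close>, counting with ballot numbers suffices. Otherwise, let the core be the walks at
  or above their level at time \<open>J\<close>: a walk of one family outside its core, by its failure to meet
  many core walks of the other family, costs more than it contributes. Hence the product is at most
  that of the two core sizes, which is the square of the size of a star when \<open>s = s' = 0\<close> and
  smaller otherwise.
\<close>

section \<open>Compression\<close>

text \<open>The hypothesis \<open>(t + 1) * k \<le> n\<close> acts through ratios of binomials: a
  diagonal step in Pascal's triangle gains a factor of at least \<open>t + 1\<close>, raising the
  lower index alone gains at least \<open>t\<close>, and enlarging the ground set of a star by its
  \<open>t\<close> fixed points costs at most (1 + 1/t)^t < exp 1. Two families pay this last price,
  whence exp 2 above. The obstacle is the range max s s' \<le> 1. There the product of the two core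
  sizes is the square of a star or can be close to it, so a bound of the form "core plus all walks
  that exceed the level", too large by a fraction of order exp 1 / t, proves nothing; for s = s' = 0
  any additional term is fatal. Walks outside one core therefore have to be charged against missing
  walks of the other core, and the inequality of arithmetic and geometric means turns the two
  charges into a bound for the product. Compression also blurs the equality case. It is recovered by
  undoing one compression at a time, which needs the families to be full stars at every
  stage.\<close>

lemma in_transpose_image_iff: "x \<in> Transposition.transpose i j ` F \<longleftrightarrow> Transposition.transpose i j x \<in> F"
  by (metis image_iff transpose_involutory)

lemma transpose_image_involutory [simp]: "Transposition.transpose i j ` Transposition.transpose i j ` F = F"
  by (simp add: image_image)

lemma transpose_image_same:
  assumes "i \<in> F \<longleftrightarrow> j \<in> F"
  shows "Transposition.transpose i j ` F = F"
  using assms by (auto simp: in_transpose_image_iff Transposition.transpose_def split: if_splits)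

lemma transpose_image_eq_insert:
  assumes "j \<in> F" "i \<notin> F"
  shows "Transposition.transpose i j ` F = insert i (F - {j})"
  using assms by (auto simp: in_transpose_image_iff Transposition.transpose_def split: if_splits)

lemma card_transpose_image [simp]: "card (Transposition.transpose i j ` F) = card F"
  by (rule card_image) (rule inj_on_subset[OF inj_transpose], simp)

lemma card_transpose_Int: "card (Transposition.transpose i j ` F \<inter> Transposition.transpose i j ` G) = card (F \<inter> G)"
proof -
  have "Transposition.transpose i j ` F \<inter> Transposition.transpose i j ` G = Transposition.transpose i j ` (F \<inter> G)"
    by (simp add: image_Int inj_transpose)
  then show ?thesis by simp
qed

text \<open>A set whose image is already a member stays put; this makes the map injective on
  \<open>\<A>\<close>, so compression preserves the size of a family.\<close>

definition down_shift :: "'a \<Rightarrow> 'a \<Rightarrow> 'a set set \<Rightarrow> 'a set \<Rightarrow> 'a set" where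
  "down_shift i j \<A> F =
    (if j \<in> F \<and> i \<notin> F \<and> Transposition.transpose i j ` F \<notin> \<A> then Transposition.transpose i j ` F else F)"

definition compress :: "'a \<Rightarrow> 'a \<Rightarrow> 'a set set \<Rightarrow> 'a set set" where
  "compress i j \<A> = down_shift i j \<A> ` \<A>"

lemma compress_iff:
  assumes "i \<noteq> j"
  shows "F \<in> compress i j \<A> \<longleftrightarrow>
    (if i \<in> F \<and> j \<notin> F then F \<in> \<A> \<or> Transposition.transpose i j ` F \<in> \<A>
     else if j \<in> F \<and> i \<notin> F then F \<in> \<A> \<and> Transposition.transpose i j ` F \<in> \<A>
     else F \<in> \<A>)" (is "?L \<longleftrightarrow> ?R")
proof
  assume ?L
  then obtain G where "G \<in> \<A>" "F = down_shift i j \<A> G"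
    by (auto simp: compress_def)
  then show ?R
    using assms by (auto simp: down_shift_def in_transpose_image_iff split: if_splits)
next
  assume R: ?R
  show ?L
  proof (cases "F \<in> \<A> \<and> (j \<in> F \<and> i \<notin> F \<longrightarrow> Transposition.transpose i j ` F \<in> \<A>)")
    case True
    then have "down_shift i j \<A> F = F" by (auto simp: down_shift_def)
    then show ?thesis using True unfolding compress_def by (metis imageI)
  next
    case False
    then have "i \<in> F" "j \<notin> F" "Transposition.transpose i j ` F \<in> \<A>" "F \<notin> \<A>"
      using R by (auto split: if_splits)
    then have "down_shift i j \<A> (Transposition.transpose i j ` F) = F"
      by (simp add: down_shift_def in_transpose_image_iff)
    then show ?thesis using \<open>Transposition.transpose i j ` F \<in> \<A>\<close> unfolding compress_def by (metis imageI)
  qed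
qed

lemma inj_on_down_shift: "inj_on (down_shift i j \<A>) \<A>"
proof (rule inj_onI)
  fix F G assume "F \<in> \<A>" "G \<in> \<A>" "down_shift i j \<A> F = down_shift i j \<A> G"
  then show "F = G"
    unfolding down_shift_def by (metis transpose_image_involutory)
qed

lemma card_compress: "card (compress i j \<A>) = card \<A>"
  unfolding compress_def by (rule card_image[OF inj_on_down_shift])

lemma nsets_transpose_image:
  assumes "F \<in> nsets S k" "i \<in> S" "j \<in> S"
  shows "Transposition.transpose i j ` F \<in> nsets S k"
proof -
  have "Transposition.transpose i j ` F \<subseteq> S"
    using assms by (auto simp: nsets_def Transposition.transpose_def)
  then show ?thesis using assms by (simp add: nsets_def)
qed

lemma compress_nsets:
  assumes "\<A> \<subseteq> nsets S k" "i \<in> S" "j \<in> S"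
  shows "compress i j \<A> \<subseteq> nsets S k"
  using assms nsets_transpose_image unfolding compress_def down_shift_def by fastforce

lemma cross_intersecting_commute: "cross_intersecting t \<A> \<B> \<Longrightarrow> cross_intersecting t \<B> \<A>"
  unfolding cross_intersecting_def by (metis Int_commute)

text \<open>Transposing both sets preserves the size of their intersection, so only a pair of an
  original member and a moved set is at stake. If the original member contains \<open>j\<close> but
  not \<open>i\<close>, it stayed because its image is a member too, and the two images can be
  compared. If it contains \<open>i\<close> but not \<open>j\<close>, undoing the move of the other
  set only removes \<open>i\<close> from the intersection.\<close>

lemma cross_intersecting_compress:
  assumes cr: "cross_intersecting t \<A> \<B>" and ij: "i \<noteq> j"
    and fin: "\<And>F. F \<in> \<A> \<Longrightarrow> finite F" 
  shows "cross_intersecting t (compress i j \<A>) (compress i j \<B>)"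
  unfolding cross_intersecting_def
proof (intro ballI)
  fix F G assume F: "F \<in> compress i j \<A>" and G: "G \<in> compress i j \<B>"
  let ?\<tau> = "\<lambda>F. Transposition.transpose i j ` F"
  have le: "t \<le> card (F \<inter> G)" if "F \<in> \<A>" "G \<in> \<B>"
    using cr that by (simp add: cross_intersecting_def)
  have le\<tau>: "t \<le> card (F \<inter> G)" if "?\<tau> F \<in> \<A>" "?\<tau> G \<in> \<B>"
    using cr that by (metis cross_intersecting_def card_transpose_Int)
  have finF: "finite F"
    using F fin ij by (auto simp: compress_def down_shift_def)
  have mixed: "t \<le> card (F \<inter> G)"
    if "i \<in> F" "j \<notin> F" "i \<in> G" "j \<notin> G" "F \<in> \<A> \<and> ?\<tau> G \<in> \<B> \<or> ?\<tau> F \<in> \<A> \<and> G \<in> \<B>"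
  proof -
    have "t \<le> card (F \<inter> ?\<tau> G) \<or> t \<le> card (?\<tau> F \<inter> G)"
      using cr that(5) by (auto simp: cross_intersecting_def)
    moreover have "F \<inter> ?\<tau> G \<subseteq> F \<inter> G" "?\<tau> F \<inter> G \<subseteq> F \<inter> G"
      using that ij by (auto simp: in_transpose_image_iff Transposition.transpose_def split: if_splits)
    ultimately show ?thesis
      using finF by (meson card_mono finite_Int order_trans)
  qed
  have sameF: "?\<tau> F = F" if "i \<in> F \<longleftrightarrow> j \<in> F"
    using that by (rule transpose_image_same)
  have sameG: "?\<tau> G = G" if "i \<in> G \<longleftrightarrow> j \<in> G"
    using that by (rule transpose_image_same)
  note F' = F[unfolded compress_iff[OF ij]] and G' = G[unfolded compress_iff[OF ij]]
  show "t \<le> card (F \<inter> G)"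
  proof (cases "F \<in> \<A>")
    case True
    show ?thesis
    proof (cases "G \<in> \<B>")
      case True
      then show ?thesis using \<open>F \<in> \<A>\<close> le by blast
    next
      case False
      then have G1: "i \<in> G" "j \<notin> G" "?\<tau> G \<in> \<B>" using G' by (auto split: if_splits)
      consider "i \<in> F \<and> j \<notin> F" | "j \<in> F \<and> i \<notin> F" | "i \<in> F \<longleftrightarrow> j \<in> F" by blast
      then show ?thesis
      proof cases
        case 1
        then show ?thesis using mixed G1 \<open>F \<in> \<A>\<close> by blast
      next
        case 2
        then have "?\<tau> F \<in> \<A>" using F' by (auto split: if_splits)
        then show ?thesis using le\<tau> G1 by blast
      next
        case 3
        then show ?thesis using sameF le\<tau> G1 \<open>F \<in> \<A>\<close> by simp
      qed
    qed
  next
    case False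
    then have F1: "i \<in> F" "j \<notin> F" "?\<tau> F \<in> \<A>" using F' by (auto split: if_splits)
    consider "i \<in> G \<and> j \<notin> G" | "j \<in> G \<and> i \<notin> G" | "i \<in> G \<longleftrightarrow> j \<in> G" by blast
    then show ?thesis
    proof cases
      case 1
      then have "G \<in> \<B> \<or> ?\<tau> G \<in> \<B>" using G' by auto
      then show ?thesis using mixed le\<tau> F1 1 by blast
    next
      case 2
      then have "?\<tau> G \<in> \<B>" using G' by (auto split: if_splits)
      then show ?thesis using le\<tau> F1 by blast
    next
      case 3
      then have "G \<in> \<B>" using G' by (auto split: if_splits)
      then show ?thesis using sameG[OF 3] le\<tau> F1 by simp
    qed
  qed
qed

lemma sum_down_shift_le:
  fixes F :: "nat set"
  assumes "i < j" "finite F"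
  shows "\<Sum>(down_shift i j \<A> F) \<le> \<Sum>F"
    and "down_shift i j \<A> F \<noteq> F \<Longrightarrow> \<Sum>(down_shift i j \<A> F) < \<Sum>F"
proof -
  have "\<Sum>(insert i (F - {j})) < \<Sum>F" if "j \<in> F" "i \<notin> F"
  proof -
    have "\<Sum>F = j + \<Sum>(F - {j})"
      using that assms by (simp add: sum.remove)
    then show ?thesis using that assms by simp
  qed
  then show "\<Sum>(down_shift i j \<A> F) \<le> \<Sum>F"
    and "down_shift i j \<A> F \<noteq> F \<Longrightarrow> \<Sum>(down_shift i j \<A> F) < \<Sum>F"
    by (simp_all add: down_shift_def transpose_image_eq_insert less_imp_le split: if_splits)
qed

text \<open>A termination measure: a compression that changes the family replaces some element by a
  smaller one and none by a larger one.\<close>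

definition weight_sum :: "nat set set \<Rightarrow> nat" where
  "weight_sum \<A> = (\<Sum>F\<in>\<A>. \<Sum>F)"

lemma weight_sum_compress:
  assumes "i < j" "finite \<A>" "\<And>F. F \<in> \<A> \<Longrightarrow> finite F"
  shows "weight_sum (compress i j \<A>) \<le> weight_sum \<A>"
    and "compress i j \<A> \<noteq> \<A> \<Longrightarrow> weight_sum (compress i j \<A>) < weight_sum \<A>"
proof -
  have eq: "weight_sum (compress i j \<A>) = (\<Sum>F\<in>\<A>. \<Sum>(down_shift i j \<A> F))"
    unfolding weight_sum_def compress_def
    by (subst sum.reindex[OF inj_on_down_shift]) simp
  show "weight_sum (compress i j \<A>) \<le> weight_sum \<A>"
    unfolding eq unfolding weight_sum_def using assms sum_down_shift_le(1) by (intro sum_mono) auto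
  assume "compress i j \<A> \<noteq> \<A>"
  then obtain F where "F \<in> \<A>" "down_shift i j \<A> F \<noteq> F"
    unfolding compress_def by (metis image_cong image_ident)
  then show "weight_sum (compress i j \<A>) < weight_sum \<A>"
    unfolding eq unfolding weight_sum_def using assms sum_down_shift_le
    by (intro sum_strict_mono_ex1 bexI[of _ F]) simp_all
qed

definition compressed :: "nat set set \<Rightarrow> bool" where
  "compressed \<A> \<longleftrightarrow> (\<forall>F\<in>\<A>. \<forall>j\<in>F. \<forall>i. 1 \<le> i \<and> i < j \<and> i \<notin> F \<longrightarrow> insert i (F - {j}) \<in> \<A>)"

lemma compressed_if_compress_id:
  assumes "\<A> \<subseteq> nsets {1..n} k" and "\<And>i j. 1 \<le> i \<Longrightarrow> i < j \<Longrightarrow> j \<le> n \<Longrightarrow> compress i j \<A> = \<A>"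
  shows "compressed \<A>"
  unfolding compressed_def
proof (intro ballI allI impI)
  fix F j i assume F: "F \<in> \<A>" "j \<in> F" and i: "1 \<le> i \<and> i < j \<and> i \<notin> F"
  then have "j \<in> {1..n}" using assms(1) unfolding nsets_def by blast
  then have "j \<le> n" by simp
  then have "compress i j \<A> = \<A>" using assms(2) i by blast
  then have "F \<in> compress i j \<A>" using F by simp
  then show "insert i (F - {j}) \<in> \<A>"
    using F i by (subst (asm) compress_iff) (auto simp: transpose_image_eq_insert)
qed

text \<open>Moving the least element of \<open>B - C\<close> to the least element of \<open>C - B\<close> keeps
  \<open>B\<close> dominated by \<open>C\<close>.\<close>

lemma compressed_dominating:
  assumes "compressed \<A>" "B \<in> \<A>" "finite B" "finite C" "card C = card B" "0 \<notin> C"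
    and "\<And>m. card (B \<inter> {1..m}) \<le> card (C \<inter> {1..m})"
    and "0 \<notin> B"
  shows "C \<in> \<A>"
  using assms(2,3,5,7,8)
proof (induction "\<Sum>B" arbitrary: B rule: less_induct)
  case less
  show ?case
  proof (cases "B = C")
    case True
    then show ?thesis using less(2) by simp
  next
    case False
    have "\<not> B \<subseteq> C"
      using False card_subset_eq[OF assms(4), of B] less(4) by metis
    moreover have "\<not> C \<subseteq> B"
      using False card_subset_eq[OF less(3), of C] less(4) by metis
    ultimately have ne: "\<exists>x. x \<in> B - C" "\<exists>x. x \<in> C - B" by blast+
    define i where "i = (LEAST x. x \<in> C - B)"
    define j where "j = (LEAST x. x \<in> B - C)"
    have i: "i \<in> C - B" unfolding i_def by (rule LeastI_ex) (rule ne)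
    have j: "j \<in> B - C" unfolding j_def by (rule LeastI_ex) (rule ne)
    have jmin: "j \<le> x" if "x \<in> B - C" for x
      unfolding j_def using that by (rule Least_le)
    have imin: "i \<le> x" if "x \<in> C - B" for x
      unfolding i_def using that by (rule Least_le)
    have "i \<ge> 1" using i assms(6) by (cases "i = 0") auto
    \<comment> \<open>If the first difference were \<open>j \<in> B\<close>, then \<open>B\<close>
      would have more elements than \<open>C\<close> up to \<open>j\<close>, against
      domination.\<close>
    have "i < j"
    proof (rule ccontr)
      assume "\<not> i < j"
      moreover have "i \<noteq> j" using i j by blast
      ultimately have "j < i" by simp
      have "x \<in> B" if "x \<in> C" "x \<le> j" for x
        using imin[of x] that \<open>j < i\<close> by (cases "x \<in> B") auto
      then have "C \<inter> {1..j} \<subseteq> B \<inter> {1..j}" by auto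
      moreover have "j \<in> B \<inter> {1..j}" using j less(6) by (cases "j = 0") auto
      moreover have "j \<notin> C \<inter> {1..j}" using j by simp
      ultimately have "C \<inter> {1..j} \<subset> B \<inter> {1..j}" by blast
      then have "card (C \<inter> {1..j}) < card (B \<inter> {1..j})"
        by (intro psubset_card_mono) auto
      then show False using less(5)[of j] by simp
    qed
    let ?B = "insert i (B - {j})"
    have "?B \<in> \<A>"
      using assms(1)[unfolded compressed_def, rule_format, of B j i] less(2) i j \<open>i \<ge> 1\<close> \<open>i < j\<close>
      by simp
    moreover have "\<Sum>?B < \<Sum>B"
    proof -
      have "\<Sum>B = j + \<Sum>(B - {j})" using j less(3) by (intro sum.remove) auto
      then show ?thesis using i j less(3) \<open>i < j\<close> by simp
    qed
    moreover have "card (?B \<inter> {1..m}) \<le> card (C \<inter> {1..m})" for m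
    proof -
      \<comment> \<open>Below \<open>i\<close> nothing changes and from \<open>j\<close> on the
        count is the same. In between, minimality of \<open>j\<close> puts every element of the new
        set up to \<open>m\<close> into \<open>C\<close>.\<close>
      consider "m < i" | "i \<le> m" "m < j" | "j \<le> m" by linarith
      then show ?thesis
      proof cases
        case 1
        then have "?B \<inter> {1..m} = B \<inter> {1..m}" using \<open>i < j\<close> by auto
        then show ?thesis using less(5) by simp
      next
        case 2
        have "x \<in> C" if "x \<in> B" "x < j" for x
          using jmin[of x] that by (cases "x \<in> C") auto
        then have "?B \<inter> {1..m} \<subseteq> C \<inter> {1..m}" using i 2 by auto
        then show ?thesis by (intro card_mono) auto
      next
        case 3
        have eq: "?B \<inter> {1..m} = insert i ((B \<inter> {1..m}) - {j})"
          using \<open>i \<ge> 1\<close> \<open>i < j\<close> 3 by auto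
        have jm: "j \<in> B \<inter> {1..m}" using j 3 \<open>i < j\<close> by auto
        have "card (?B \<inter> {1..m}) = Suc (card ((B \<inter> {1..m}) - {j}))"
          unfolding eq using i by (subst card_insert_disjoint) auto
        also have "\<dots> = card (B \<inter> {1..m})"
          using jm by (intro card_Suc_Diff1) auto
        finally show ?thesis using less(5) by simp
      qed
    qed
    moreover have "card C = card ?B"
      using less(3,4) i j card_Suc_Diff1[of B j] by simp
    moreover have "finite ?B" "0 \<notin> ?B" using less(3,6) \<open>i \<ge> 1\<close> by auto
    ultimately show ?thesis by (intro less(1)[of ?B])
  qed
qed

lemma card_Int_Suc_interval:
  "card (X \<inter> {1..Suc m}) = card (X \<inter> {1..m}) + (if Suc m \<in> X then 1 else 0)"
proof -
  have "X \<inter> {1..Suc m} = (if Suc m \<in> X then insert (Suc m) (X \<inter> {1..m}) else X \<inter> {1..m})"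
    by (auto simp: le_Suc_eq)
  then show ?thesis by simp
qed

text \<open>\<open>card (X \<inter> {1..x})\<close> is the rank of \<open>x\<close> in
  \<open>X\<close>, so within the interval the filter keeps the \<open>r\<close> smallest
  elements.\<close>

lemma card_initial_part:
  fixes X :: "nat set"
  shows "card ({x \<in> X. card (X \<inter> {1..x}) \<le> r} \<inter> {1..m}) = min r (card (X \<inter> {1..m}))"
proof (induction m)
  case (Suc m)
  let ?Y = "{x \<in> X. card (X \<inter> {1..x}) \<le> r}"
  have "Suc m \<in> ?Y \<longleftrightarrow> Suc m \<in> X \<and> card (X \<inter> {1..m}) < r"
    using card_Int_Suc_interval[of X m] by auto
  then show ?case
    unfolding card_Int_Suc_interval[of ?Y] card_Int_Suc_interval[of X] Suc.IH by auto
qed simp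

lemma card_split_interval:
  fixes A :: "nat set"
  shows "card (A \<inter> {1..m}) + card (({1..m} - A)) = m"
proof -
  have "card {1..m} = card ({1..m} \<inter> A) + card ({1..m} - A)"
    by (rule card_Int_Diff) simp
  then show ?thesis by (simp add: Int_commute)
qed

text \<open>If no such \<open>m\<close> existed, \<open>B\<close> would be dominated by an initial part of
  the complement of \<open>A\<close> joined with the first \<open>t - 1\<close> elements of \<open>A\<close>.\<close>

lemma cross_intersecting_compressed:
  assumes "compressed \<B>" "\<A> \<subseteq> nsets {1..n} k" "\<B> \<subseteq> nsets {1..n} k"
    and cr: "cross_intersecting t \<A> \<B>" and A: "A \<in> \<A>" and B: "B \<in> \<B>"
  shows "\<exists>m\<le>n. m + t \<le> card (A \<inter> {1..m}) + card (B \<inter> {1..m})"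
proof (rule ccontr)
  assume "\<not> ?thesis"
  then have less: "card (A \<inter> {1..m}) + card (B \<inter> {1..m}) < m + t" if "m \<le> n" for m
    using that by force
  then have "0 < t" using less[of 0] by simp
  have nsA: "A \<subseteq> {1..n}" "finite A" "card A = k"
    and nsB: "B \<subseteq> {1..n}" "finite B" "card B = k"
    using A B assms(2,3) by (auto simp: nsets_def)
  define D where "D = {x \<in> A. card (A \<inter> {1..x}) \<le> t - 1}"
  define C\<^sub>0 where "C\<^sub>0 = D \<union> ({1..n} - A)"
  define C where "C = {x \<in> C\<^sub>0. card (C\<^sub>0 \<inter> {1..x}) \<le> k}"
  have D: "card (D \<inter> {1..m}) = min (t - 1) (card (A \<inter> {1..m}))" for m
    unfolding D_def by (rule card_initial_part)
  have C: "card (C \<inter> {1..m}) = min k (card (C\<^sub>0 \<inter> {1..m}))" for m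
    unfolding C_def by (rule card_initial_part)
  have "D \<subseteq> A" by (auto simp: D_def)
  then have sub: "C \<subseteq> C\<^sub>0" "C\<^sub>0 \<subseteq> {1..n}" using nsA by (auto simp: C_def C\<^sub>0_def)
  \<comment> \<open>Up to \<open>m\<close>, \<open>C\<^sub>0\<close> omits only the elements of
    \<open>A\<close> beyond the first \<open>t - 1\<close>. It has all \<open>m\<close> elements
    there or exactly \<open>m + t - 1 - card (A \<inter> {1..m})\<close> of them, and the assumed
    failure says that \<open>B\<close> has no more.\<close>
  have B_le: "card (B \<inter> {1..m}) \<le> card (C\<^sub>0 \<inter> {1..m})" if "m \<le> n" for m
  proof -
    have "C\<^sub>0 \<inter> {1..m} = (D \<inter> {1..m}) \<union> ({1..m} - A)"
      using that by (auto simp: C\<^sub>0_def)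
    then have "card (C\<^sub>0 \<inter> {1..m}) = card (D \<inter> {1..m}) + card ({1..m} - A)"
      using \<open>D \<subseteq> A\<close> by (simp add: card_Un_disjoint disjoint_iff subset_iff)
    moreover have "card (A \<inter> {1..m}) + card ({1..m} - A) = m"
      by (rule card_split_interval)
    moreover have "card (B \<inter> {1..m}) \<le> m"
      using card_mono[of "{1..m}" "B \<inter> {1..m}"] by simp
    ultimately show ?thesis using less[OF that] D[of m] by linarith
  qed
  have full: "X \<inter> {1..n} = X" if "X \<subseteq> {1..n}" for X :: "nat set" using that by blast
  have "k \<le> card C\<^sub>0"
    using B_le[of n] full[OF nsB(1)] full[OF sub(2)] nsB(3) by simp
  then have "card C = k"
    using C[of n] full[OF sub(2)] full[of C] sub by simp
  have dom: "card (B \<inter> {1..m}) \<le> card (C \<inter> {1..m})" for m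
  proof (cases "m \<le> n")
    case True
    have "card (B \<inter> {1..m}) \<le> k" using nsB card_mono[of B "B \<inter> {1..m}"] by simp
    then show ?thesis using B_le[OF True] C[of m] by simp
  next
    case False
    then have "B \<inter> {1..m} = B" "C \<inter> {1..m} = C" using nsB sub by force+
    then show ?thesis using nsB \<open>card C = k\<close> by simp
  qed
  have "finite C" using sub by (meson finite_atLeastAtMost finite_subset)
  have "0 \<notin> C" "0 \<notin> B" using sub nsB by auto
  then have "C \<in> \<B>"
    using nsB dom \<open>card C = k\<close> \<open>finite C\<close> by (intro compressed_dominating[OF assms(1) B]) auto
  then have "t \<le> card (A \<inter> C)" using cr A by (simp add: cross_intersecting_def)
  moreover have "A \<inter> C \<subseteq> D" using sub by (auto simp: C\<^sub>0_def)
  moreover have "finite D" using \<open>D \<subseteq> A\<close> nsA finite_subset by blast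
  moreover have "card D \<le> t - 1"
    using D[of n] full[of D] \<open>D \<subseteq> A\<close> nsA by simp
  ultimately show False using card_mono[of D "A \<inter> C"] \<open>0 < t\<close> by linarith
qed

section \<open>Full stars and the reversal of compressions\<close>

definition star :: "nat \<Rightarrow> nat \<Rightarrow> nat set \<Rightarrow> nat set set" where
  "star n k T = {F \<in> nsets {1..n} k. T \<subseteq> F}"

lemma Un_in_star:
  assumes "T \<subseteq> {1..n}" "card T \<le> k" "X \<subseteq> {1..n} - T" "card X = k - card T"
  shows "X \<union> T \<in> star n k T"
proof -
  have "finite T" "finite X" using assms by (meson finite_Diff finite_atLeastAtMost finite_subset)+
  moreover have "X \<inter> T = {}" using assms by blast
  ultimately have "card (X \<union> T) = card X + card T" by (simp add: card_Un_disjoint)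
  then show ?thesis using assms \<open>finite T\<close> \<open>finite X\<close> by (auto simp: star_def nsets_def)
qed

lemma card_star:
  assumes "T \<subseteq> {1..n}" "card T \<le> k"
  shows "card (star n k T) = (n - card T) choose (k - card T)"
proof -
  have fT: "finite T" using assms finite_subset by blast
  have "bij_betw (\<lambda>X. X \<union> T) (nsets ({1..n} - T) (k - card T)) (star n k T)"
  proof (rule bij_betw_byWitness[where f' = "\<lambda>F. F - T"])
    show "\<forall>X\<in>nsets ({1..n} - T) (k - card T). X \<union> T - T = X"
      by (auto simp: nsets_def)
    show "\<forall>F\<in>star n k T. F - T \<union> T = F" by (auto simp: star_def)
    show "(\<lambda>X. X \<union> T) ` nsets ({1..n} - T) (k - card T) \<subseteq> star n k T"
      using Un_in_star[OF assms] by (auto simp: nsets_def)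
    show "(\<lambda>F. F - T) ` star n k T \<subseteq> nsets ({1..n} - T) (k - card T)"
      using fT by (auto simp: star_def nsets_def card_Diff_subset)
  qed
  then have "card (star n k T) = card (nsets ({1..n} - T) (k - card T))"
    by (rule bij_betw_same_card[symmetric])
  also have "\<dots> = (n - card T) choose (k - card T)"
    unfolding card_nsets card_Diff_subset[OF fT assms(1)] by simp
  finally show ?thesis .
qed

lemma star_eqI:
  assumes "\<A> \<subseteq> star n k T" "card \<A> = card (star n k T)"
  shows "\<A> = star n k T"
proof (rule card_subset_eq[OF _ assms])
  have "star n k T \<subseteq> Pow {1..n}" by (auto simp: star_def nsets_def)
  then show "finite (star n k T)" by (rule finite_subset) simp
qed

text \<open>The link between the two families is the Kneser graph on \<open>(k - t)\<close>-subsets of the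
  \<open>n - t - 1\<close> points outside \<open>T\<close> and \<open>j\<close>: any two of its vertices have a common neighbour.\<close>

lemma compress_eq_star:
  assumes AB: "\<A> \<subseteq> nsets {1..n} k" "\<B> \<subseteq> nsets {1..n} k" and cr: "cross_intersecting t \<A> \<B>"
    and ij: "i \<in> {1..n}" "j \<in> {1..n}" "i \<noteq> j" and T: "T \<subseteq> {1..n}" "card T = t"
    and comp: "compress i j \<A> = star n k T" "compress i j \<B> = star n k T"
    and n: "t \<le> k" "1 \<le> t" "3 * (k - t) + t + 1 \<le> n"
  shows "\<exists>T'\<subseteq>{1..n}. card T' = t \<and> \<A> = star n k T' \<and> \<B> = star n k T'"
proof -
  let ?\<tau> = "\<lambda>F. Transposition.transpose i j ` F"
  note [simp] = in_transpose_image_iff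
  have fT: "finite T" using T finite_subset by blast
  have cards: "card \<A> = card (star n k T)" "card \<B> = card (star n k T)"
    using card_compress[of i j \<A>] card_compress[of i j \<B>] comp by simp_all
  have mem: "F \<in> star n k T \<or> (?\<tau> F \<in> star n k T \<and> j \<in> F \<and> i \<notin> F \<and> ?\<tau> F \<notin> \<C>)"
    if "compress i j \<C> = star n k T" "F \<in> \<C>" for F \<C>
  proof -
    have "down_shift i j \<C> F \<in> star n k T" using that unfolding compress_def by blast
    then show ?thesis unfolding down_shift_def by (auto split: if_splits)
  qed
  \<comment> \<open>The centre of a star that arises by compression cannot contain \<open>j\<close>
    but not \<open>i\<close>: a member without \<open>i\<close> would bring along its image, which
    lacks \<open>j\<close>.\<close>
  have both: "i \<in> T" if "compress i j \<C> = star n k T" "F \<in> star n k T" "j \<in> F" "i \<notin> F" "j \<in> T"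
    for F \<C>
  proof -
    have "?\<tau> F \<in> \<C>" using that compress_iff[OF ij(3), of F \<C>] by simp
    then have "?\<tau> F \<in> compress i j \<C>" using that compress_iff[OF ij(3), of "?\<tau> F" \<C>] by simp
    then have "T \<subseteq> ?\<tau> F" unfolding that(1) by (simp add: star_def)
    then have "j \<in> ?\<tau> F" using that by blast
    then show ?thesis using that by simp
  qed
  show ?thesis
  proof (cases "i \<in> T \<longleftrightarrow> j \<in> T")
    case True
    have sub: "\<C> \<subseteq> star n k T"
      if "compress i j \<C> = star n k T" "\<C> \<subseteq> nsets {1..n} k" for \<C>
    proof
      fix F assume F: "F \<in> \<C>"
      from mem[OF that(1) F] show "F \<in> star n k T"
      proof
        assume "?\<tau> F \<in> star n k T \<and> j \<in> F \<and> i \<notin> F \<and> ?\<tau> F \<notin> \<C>"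
        then have "?\<tau> T \<subseteq> ?\<tau> (?\<tau> F)" unfolding star_def by blast
        then have "T \<subseteq> F" using transpose_image_same[OF True] by simp
        then show ?thesis using F that by (auto simp: star_def)
      qed
    qed
    have "\<A> = star n k T" "\<B> = star n k T"
      using sub[OF comp(1) AB(1)] sub[OF comp(2) AB(2)] cards by (simp_all add: star_eqI)
    then show ?thesis using T by blast
  next
    case False
    have "i \<in> T"
    proof (rule ccontr)
      assume "i \<notin> T"
      then have "j \<in> T" using False by simp
      have "card ({1..n} - {i} - T) = n - 1 - t"
        using T ij fT \<open>i \<notin> T\<close> by (subst card_Diff_subset) auto
      then have "k - t \<le> card ({1..n} - {i} - T)" using n by simp
      then obtain X where X: "X \<subseteq> {1..n} - {i} - T" "card X = k - t"
        by (rule obtain_subset_with_card_n)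
      then have "X \<union> T \<in> star n k T" using T n by (intro Un_in_star) auto
      moreover have "i \<notin> X \<union> T" using X \<open>i \<notin> T\<close> by blast
      ultimately show False using both[OF comp(1)] \<open>j \<in> T\<close> \<open>i \<notin> T\<close> by blast
    qed
    then have "j \<notin> T" using False by simp
    define T' where "T' = ?\<tau> T"
    define R where "R = {1..n} - T - {j}"
    define V where "V = nsets R (k - t)"
    have T': "T' = insert j (T - {i})"
      unfolding T'_def using transpose_image_eq_insert[of i T j] \<open>i \<in> T\<close> \<open>j \<notin> T\<close>
      by (simp add: transpose_commute)
    have T'sub: "T' \<subseteq> {1..n}" using T ij unfolding T' by blast
    have cardT': "card T' = t" unfolding T'_def using T by simp
    have "card ({1..n} - T) = n - t" using card_Diff_subset[OF fT T(1)] T(2) by simp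
    moreover have "j \<in> {1..n} - T" using ij \<open>j \<notin> T\<close> by blast
    ultimately have cardR: "card R = n - t - 1" unfolding R_def by (simp add: card_Diff_singleton)
    have cardstar': "card (star n k T) = card (star n k T')"
      using T T'sub cardT' n by (simp add: card_star)
    have swapV: "?\<tau> (X \<union> T) = X \<union> T'" if "X \<in> V" for X
    proof -
      have "i \<notin> X" "j \<notin> X" using that \<open>i \<in> T\<close> by (auto simp: V_def R_def nsets_def)
      then have "?\<tau> X = X" by (intro transpose_image_same) simp
      then show ?thesis by (simp add: image_Un T'_def)
    qed
    have starV: "X \<union> T \<in> star n k T" if "X \<in> V" for X
      using that T n by (intro Un_in_star) (auto simp: V_def R_def nsets_def)
    \<comment> \<open>Each \<open>X\<close> has two lifts, over \<open>T\<close> and over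
      \<open>T'\<close>, and a family contains at least one of them. Disjoint \<open>X\<close> and
      \<open>Y\<close> cannot be lifted over different centres in the two families, since such lifts
      share at most \<open>t - 1\<close> points.\<close>
    have dich: "X \<union> T' \<in> \<C>" if "X \<union> T \<notin> \<C>" "X \<in> V" "compress i j \<C> = star n k T" for X \<C>
    proof -
      have "i \<in> X \<union> T" "j \<notin> X \<union> T"
        using that(2) \<open>i \<in> T\<close> \<open>j \<notin> T\<close> by (auto simp: V_def R_def nsets_def)
      moreover have "X \<union> T \<in> compress i j \<C>" using starV that by simp
      ultimately have "?\<tau> (X \<union> T) \<in> \<C>"
        using compress_iff[OF ij(3), of "X \<union> T" \<C>] that(1) by meson
      then show ?thesis by (simp only: swapV[OF that(2)])
    qed
    have cr': "\<not> (X \<inter> Y = {})" if "X \<in> V" "Y \<in> V" "X \<union> T \<in> \<C>" "Y \<union> T' \<in> \<D>"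
      "cross_intersecting t \<C> \<D>" for X Y \<C> \<D>
    proof
      assume "X \<inter> Y = {}"
      then have "(X \<union> T) \<inter> (Y \<union> T') \<subseteq> T - {i}"
        using that(1,2) ij(3) \<open>i \<in> T\<close> by (auto simp: T' V_def R_def nsets_def)
      then have "card ((X \<union> T) \<inter> (Y \<union> T')) \<le> t - 1"
        using card_mono[of "T - {i}" "(X \<union> T) \<inter> (Y \<union> T')"] fT T \<open>i \<in> T\<close> by simp
      moreover have "t \<le> card ((X \<union> T) \<inter> (Y \<union> T'))"
        using that by (simp add: cross_intersecting_def)
      ultimately show False using n by simp
    qed
    have step1: "Y \<union> T \<in> \<B>" if "X \<in> V" "Y \<in> V" "X \<inter> Y = {}" "X \<union> T \<in> \<A>" for X Y
    proof (rule ccontr)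
      assume "Y \<union> T \<notin> \<B>"
      then have "Y \<union> T' \<in> \<B>" by (rule dich[OF _ that(2) comp(2)])
      then show False using cr'[OF that(1,2,4) _ cr] that(3) by simp
    qed
    have step2: "X \<union> T \<in> \<A>" if "X \<in> V" "Y \<in> V" "X \<inter> Y = {}" "Y \<union> T \<in> \<B>" for X Y
    proof (rule ccontr)
      assume "X \<union> T \<notin> \<A>"
      then have "X \<union> T' \<in> \<A>" by (rule dich[OF _ that(1) comp(1)])
      then show False
        using cr'[OF that(2,1,4) _ cross_intersecting_commute[OF cr]] that(3) by (simp add: Int_commute)
    qed
    \<comment> \<open>Two vertices block at most \<open>2 * (k - t)\<close> of the
      \<open>n - t - 1\<close> points, so \<open>k - t\<close> remain because
      \<open>3 * (k - t) + t + 1 \<le> n\<close>. Thus a choice of centre made at one vertex spreads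
      to all of them.\<close>
    have common: "\<exists>Y\<in>V. X \<inter> Y = {} \<and> Z \<inter> Y = {}" if "X \<in> V" "Z \<in> V" for X Z
    proof -
      have XZ: "finite X" "finite Z" "card X = k - t" "card Z = k - t" "X \<subseteq> R" "Z \<subseteq> R"
        using that by (auto simp: V_def nsets_def)
      then have "card (X \<union> Z) \<le> 2 * (k - t)" using card_Un_le[of X Z] by simp
      moreover have "card (R - (X \<union> Z)) = card R - card (X \<union> Z)"
        using XZ by (intro card_Diff_subset) auto
      ultimately have "k - t \<le> card (R - (X \<union> Z))" using cardR n by linarith
      then obtain Y where Y: "Y \<subseteq> R - (X \<union> Z)" "card Y = k - t" "finite Y"
        by (rule obtain_subset_with_card_n)
      then have "Y \<in> V" unfolding V_def nsets_def by auto
      then show ?thesis using Y(1) by blast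
    qed
    have diffV: "G - T \<in> V" "G - T \<union> T = G" if "G \<in> star n k T" "j \<notin> G" for G
    proof -
      have G: "T \<subseteq> G" "G \<subseteq> {1..n}" "finite G" "card G = k"
        using that(1) unfolding star_def nsets_def by blast+
      have "card (G - T) = k - t" using card_Diff_subset[OF fT G(1)] G T by simp
      moreover have "G - T \<subseteq> R" using G that(2) by (auto simp: R_def)
      ultimately show "G - T \<in> V" using G(3) by (simp add: V_def nsets_def)
      show "G - T \<union> T = G" using G(1) by blast
    qed
    have eqT: "\<C> = star n k T"
      if C: "compress i j \<C> = star n k T" "\<forall>X\<in>V. X \<union> T \<in> \<C>" "card \<C> = card (star n k T)" for \<C>
    proof (rule star_eqI[OF _ C(3)])
      show "\<C> \<subseteq> star n k T"
      proof
        fix F assume F: "F \<in> \<C>"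
        show "F \<in> star n k T"
        proof (rule ccontr)
          assume "F \<notin> star n k T"
          then have *: "?\<tau> F \<in> star n k T" "j \<in> F" "i \<notin> F" "?\<tau> F \<notin> \<C>"
            using mem[OF C(1) F] by auto
          have "j \<notin> ?\<tau> F" using *(3) by simp
          then show False using diffV[OF *(1)] C(2) *(4) by metis
        qed
      qed
    qed
    have eqT': "\<C> = star n k T'"
      if C: "compress i j \<C> = star n k T" "\<forall>X\<in>V. X \<union> T \<notin> \<C>" "card \<C> = card (star n k T)"
        "\<C> \<subseteq> nsets {1..n} k" for \<C>
    proof (rule star_eqI)
      show "\<C> \<subseteq> star n k T'"
      proof
        fix F assume F: "F \<in> \<C>"
        have "T' \<subseteq> F"
        proof (cases "F \<in> star n k T")
          case False
          then have "T \<subseteq> ?\<tau> F" using mem[OF C(1) F] unfolding star_def by blast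
          then have "?\<tau> T \<subseteq> ?\<tau> (?\<tau> F)" by blast
          then show ?thesis by (simp add: T'_def)
        next
          case True
          then have TF: "T \<subseteq> F" "F \<subseteq> {1..n}" "finite F" "card F = k"
            by (auto simp: star_def nsets_def)
          have "j \<in> F"
          proof (rule ccontr)
            assume "j \<notin> F"
            then show False using diffV[OF True] C(2) F by metis
          qed
          then show ?thesis using TF T' by blast
        qed
        then show "F \<in> star n k T'" using F C(4) by (auto simp: star_def)
      qed
      show "card \<C> = card (star n k T')" using C(3) cardstar' by simp
    qed
    show ?thesis
    proof (cases "\<exists>X\<in>V. X \<union> T \<in> \<A>")
      case True
      then obtain X where X: "X \<in> V" "X \<union> T \<in> \<A>" by blast
      have allA: "\<forall>Z\<in>V. Z \<union> T \<in> \<A>"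
      proof
        fix Z assume "Z \<in> V"
        then obtain Y where Y: "Y \<in> V" "X \<inter> Y = {}" "Z \<inter> Y = {}" using common X(1) by blast
        then have "Y \<union> T \<in> \<B>" using step1 X by blast
        then show "Z \<union> T \<in> \<A>" using step2[OF \<open>Z \<in> V\<close> Y(1,3)] by blast
      qed
      have "\<forall>Z\<in>V. Z \<union> T \<in> \<B>"
      proof
        fix Z assume "Z \<in> V"
        then obtain Y where Y: "Y \<in> V" "Z \<inter> Y = {}" using common by blast
        then show "Z \<union> T \<in> \<B>" using step1[of Y Z] \<open>Z \<in> V\<close> allA by blast
      qed
      then have "\<A> = star n k T" "\<B> = star n k T"
        using eqT[OF comp(1) allA cards(1)] eqT[OF comp(2) _ cards(2)] by blast+
      then show ?thesis using T by blast
    next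
      case False
      then have noA: "\<forall>Z\<in>V. Z \<union> T \<notin> \<A>" by blast
      have "\<forall>Z\<in>V. Z \<union> T \<notin> \<B>"
      proof
        fix Z assume "Z \<in> V"
        then obtain Y where Y: "Y \<in> V" "Z \<inter> Y = {}" using common by blast
        then show "Z \<union> T \<notin> \<B>" using step2[of Y Z] \<open>Z \<in> V\<close> noA by blast
      qed
      then have "\<A> = star n k T'" "\<B> = star n k T'"
        using eqT'[OF comp(1) noA cards(1) AB(1)] eqT'[OF comp(2) _ cards(2) AB(2)] by blast+
      then show ?thesis using T'sub cardT' by blast
    qed
  qed
qed

text \<open>Sizes survive a compression, so the bound carries back unchanged. In the equality case
  the induction hypothesis makes the compressed pair equal stars, and
  \<open>compress_eq_star\<close> undoes the compression just applied. This may move the centre,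
  which is why it is arbitrary in the conclusion although it is \<open>{1..t}\<close> for compressed
  pairs.\<close>

lemma cross_intersecting_bound_from_compressed:
  fixes bound :: nat
  assumes compressed_case: "\<And>\<A> \<B>. \<lbrakk>\<A> \<subseteq> nsets {1..n} k; \<B> \<subseteq> nsets {1..n} k;
      cross_intersecting t \<A> \<B>; compressed \<A>; compressed \<B>\<rbrakk> \<Longrightarrow>
      card \<A> * card \<B> \<le> bound \<and>
      (card \<A> * card \<B> = bound \<longrightarrow> \<A> = star n k {1..t} \<and> \<B> = star n k {1..t})"
    and n: "t \<le> k" "1 \<le> t" "3 * (k - t) + t + 1 \<le> n"
    and "\<A> \<subseteq> nsets {1..n} k" "\<B> \<subseteq> nsets {1..n} k" "cross_intersecting t \<A> \<B>"
  shows "card \<A> * card \<B> \<le> bound \<and>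
    (card \<A> * card \<B> = bound \<longrightarrow>
      (\<exists>T\<subseteq>{1..n}. card T = t \<and> \<A> = star n k T \<and> \<B> = star n k T))"
  using assms(5-7)
proof (induction "weight_sum \<A> + weight_sum \<B>" arbitrary: \<A> \<B> rule: less_induct)
  case less
  have fin: "finite \<C>" "F \<in> \<C> \<Longrightarrow> finite F" if "\<C> \<subseteq> nsets {1..n} k" for \<C> F
  proof -
    have "\<C> \<subseteq> Pow {1..n}" using that by (auto simp: nsets_def)
    then show "finite \<C>" by (rule finite_subset) simp
    show "F \<in> \<C> \<Longrightarrow> finite F" using that by (auto simp: nsets_def)
  qed
  show ?case
  proof (cases "\<exists>i j. 1 \<le> i \<and> i < j \<and> j \<le> n \<and> (compress i j \<A> \<noteq> \<A> \<or> compress i j \<B> \<noteq> \<B>)")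
    case True
    then obtain i j where ij: "1 \<le> i" "i < j" "j \<le> n"
      and ne: "compress i j \<A> \<noteq> \<A> \<or> compress i j \<B> \<noteq> \<B>" by blast
    have ijn: "i \<in> {1..n}" "j \<in> {1..n}" "i \<noteq> j" using ij by auto
    let ?A = "compress i j \<A>" and ?B = "compress i j \<B>"
    have "weight_sum ?A + weight_sum ?B < weight_sum \<A> + weight_sum \<B>"
      using ne weight_sum_compress[OF ij(2) fin(1,2)[OF less(2)]]
        weight_sum_compress[OF ij(2) fin(1,2)[OF less(3)]] by linarith
    moreover have "?A \<subseteq> nsets {1..n} k" "?B \<subseteq> nsets {1..n} k"
      using less(2,3) ijn by (simp_all add: compress_nsets)
    moreover have "cross_intersecting t ?A ?B"
      using less(2,4) ijn fin(2) by (intro cross_intersecting_compress) auto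
    ultimately have IH: "card ?A * card ?B \<le> bound \<and> (card ?A * card ?B = bound \<longrightarrow>
      (\<exists>T\<subseteq>{1..n}. card T = t \<and> ?A = star n k T \<and> ?B = star n k T))"
      by (rule less(1))
    have "\<exists>T\<subseteq>{1..n}. card T = t \<and> \<A> = star n k T \<and> \<B> = star n k T"
      if eq: "card \<A> * card \<B> = bound"
    proof -
      obtain T where "T \<subseteq> {1..n}" "card T = t" "?A = star n k T" "?B = star n k T"
        using IH eq unfolding card_compress by blast
      then show ?thesis using compress_eq_star[OF less(2-4) ijn _ _ _ _ n] by simp
    qed
    then show ?thesis using IH card_compress[of i j \<A>] card_compress[of i j \<B>] by simp
  next
    case False
    then have "compressed \<A>" "compressed \<B>"
      by (auto intro!: compressed_if_compress_id[OF less(2)] compressed_if_compress_id[OF less(3)])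
    then have bound: "card \<A> * card \<B> \<le> bound \<and>
      (card \<A> * card \<B> = bound \<longrightarrow> \<A> = star n k {1..t} \<and> \<B> = star n k {1..t})"
      by (rule compressed_case[OF less(2-4)])
    have "{1..t} \<subseteq> {1..n}" "card {1..t} = t" using n by auto
    then show ?thesis using bound by (intro conjI impI exI[of _ "{1..t}"]) simp_all
  qed
qed

section \<open>Counting lattice walks\<close>

text \<open>Pascal's rule for walks with a property: the two terms collect the walks whose first
  step goes down or up. The counts below are inductions along it, which is why the starting time
  \<open>m\<close> is a parameter.\<close>

lemma card_nsets_Suc:
  "card {F \<in> nsets {m<..m + Suc N} k. P F} =
    card {F \<in> nsets {Suc m<..Suc m + N} k. P F} +
    (if k = 0 then 0 else card {F \<in> nsets {Suc m<..Suc m + N} (k - 1). P (insert (Suc m) F)})"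
proof -
  let ?S = "{Suc m<..Suc m + N}"
  let ?X = "{F \<in> nsets ?S k. P F}"
  let ?Y = "{F \<in> nsets ?S (k - 1). P (insert (Suc m) F)}"
  let ?Z = "if k = 0 then {} else insert (Suc m) ` ?Y"
  have S: "{m<..m + Suc N} = insert (Suc m) ?S" by auto
  have fin: "finite {F \<in> nsets ?S l. Q F}" for l Q
    by (rule finite_subset[of _ "Pow ?S"]) (auto simp: nsets_def)
  have notin: "Suc m \<notin> F" if "F \<in> nsets ?S l" for F l
    using that by (auto simp: nsets_def)
  have "{F \<in> nsets {m<..m + Suc N} k. P F} = ?X \<union> ?Z"
  proof (rule set_eqI)
    fix F
    show "F \<in> {F \<in> nsets {m<..m + Suc N} k. P F} \<longleftrightarrow> F \<in> ?X \<union> ?Z"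
    proof (cases "Suc m \<in> F")
      case False
      then have "F \<notin> ?Z" by auto
      moreover have "F \<in> nsets {m<..m + Suc N} k \<longleftrightarrow> F \<in> nsets ?S k"
        unfolding S nsets_def using False by blast
      ultimately show ?thesis by blast
    next
      case True
      define G where "G = F - {Suc m}"
      have FG: "F = insert (Suc m) G" "Suc m \<notin> G" using True by (auto simp: G_def)
      have "F \<in> nsets {m<..m + Suc N} k \<longleftrightarrow> k \<noteq> 0 \<and> G \<in> nsets ?S (k - 1)"
        unfolding S FG(1) nsets_def using FG(2) by (auto simp: card_insert_if)
      moreover have "F \<in> ?Z \<longleftrightarrow> k \<noteq> 0 \<and> G \<in> nsets ?S (k - 1) \<and> P F"
      proof (cases "k = 0")
        case False
        have "F \<in> insert (Suc m) ` ?Y \<longleftrightarrow> G \<in> ?Y"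
        proof
          assume "F \<in> insert (Suc m) ` ?Y"
          then obtain H where H: "H \<in> ?Y" "F = insert (Suc m) H" by blast
          then have "Suc m \<notin> H" using notin[of H "k - 1"] by simp
          then have "H = G" using H(2) FG insert_ident by metis
          then show "G \<in> ?Y" using H by simp
        qed (simp add: FG(1))
        then show ?thesis using False FG by simp
      qed simp
      moreover have "F \<notin> ?X" using True notin by blast
      ultimately show ?thesis by blast
    qed
  qed
  moreover have "?X \<inter> ?Z = {}" using notin by auto
  moreover have "finite ?Z" using fin by simp
  moreover have "inj_on (insert (Suc m)) ?Y"
  proof (rule inj_onI)
    fix F G assume "F \<in> ?Y" "G \<in> ?Y" "insert (Suc m) F = insert (Suc m) G"
    then show "F = G" using notin[of F "k - 1"] notin[of G "k - 1"] insert_ident[of "Suc m" F G] by simp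
  qed
  ultimately show ?thesis using fin
    by (simp add: card_Un_disjoint card_image)
qed

text \<open>The height, after step \<open>j\<close>, of the lattice walk that starts at time \<open>m\<close> with
  height \<open>0\<close> and goes up at the times in \<open>F\<close> and down at the others. The line
  \<open>y = x + u\<close> of the random walk method is the height \<open>u\<close>.\<close>

definition height :: "nat \<Rightarrow> nat set \<Rightarrow> nat \<Rightarrow> int" where
  "height m F j = 2 * int (card (F \<inter> {m<..j})) - (int j - int m)"

lemma height_start [simp]: "height m F m = 0"
  by (simp add: height_def)

lemma height_down:
  assumes "Suc m \<notin> F" "Suc m \<le> j"
  shows "height m F j = height (Suc m) F j - 1"
proof -
  have "F \<inter> {m<..j} = F \<inter> {Suc m<..j}" using assms by (auto simp: Suc_le_eq not_less_eq_eq) (metis Suc_lessI)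
  then show ?thesis by (simp add: height_def)
qed

lemma height_up:
  assumes "Suc m \<notin> F" "Suc m \<le> j"
  shows "height m (insert (Suc m) F) j = height (Suc m) F j + 1"
proof -
  have "insert (Suc m) F \<inter> {m<..j} = insert (Suc m) (F \<inter> {Suc m<..j})"
    using assms by auto
  then show ?thesis by (simp add: height_def)
qed

lemma height_Suc: "m \<le> j \<Longrightarrow> height m F (Suc j) = height m F j + (if Suc j \<in> F then 1 else - 1)"
proof -
  assume "m \<le> j"
  then have "F \<inter> {m<..Suc j} = (if Suc j \<in> F then insert (Suc j) (F \<inter> {m<..j}) else F \<inter> {m<..j})"
    by (auto simp: le_Suc_eq)
  then show ?thesis by (simp add: height_def)
qed

lemma height_split:
  assumes "m \<le> j" "j \<le> l"
  shows "height m F l = height m F j + height j F l"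
proof -
  have "F \<inter> {m<..l} = (F \<inter> {m<..j}) \<union> (F \<inter> {j<..l})" using assms by auto
  moreover have "(F \<inter> {m<..j}) \<inter> (F \<inter> {j<..l}) = {}" by auto
  ultimately have "card (F \<inter> {m<..l}) = card (F \<inter> {m<..j}) + card (F \<inter> {j<..l})"
    by (simp add: card_Un_disjoint)
  then show ?thesis by (simp add: height_def)
qed

lemma height_cong: "F \<inter> {m<..j} = G \<inter> {m<..j} \<Longrightarrow> height m F j = height m G j"
  by (simp add: height_def)

lemma height_Int:
  assumes "m \<le> l" "j \<le> n" 
  shows "height l (F \<inter> {m<..n}) j = height l F j"
  using assms by (intro height_cong) auto

lemma height_le: "m \<le> j \<Longrightarrow> height m F j \<le> int j - int m"
  using card_mono[of "{m<..j}" "F \<inter> {m<..j}"] by (simp add: height_def)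

lemma height_le_card: "finite F \<Longrightarrow> m \<le> j \<Longrightarrow> height m F j \<le> int (card F)"
  using card_mono[of F "F \<inter> {m<..j}"] card_mono[of "{m<..j}" "F \<inter> {m<..j}"]
  by (simp add: height_def)

lemma finite_nsets_filter: "finite S \<Longrightarrow> finite {F \<in> nsets S k. P F}"
  by (rule finite_subset[of _ "Pow S"]) (auto simp: nsets_def)

lemma card_nsets_filter_le:
  fixes m N :: nat
  shows "card {F \<in> nsets {m<..m + N} k. P F} \<le> N choose k"
proof -
  have "card {F \<in> nsets {m<..m + N} k. P F} \<le> card (nsets {m<..m + N} k)"
    by (rule card_mono) (auto simp: finite_imp_finite_nsets)
  then show ?thesis by simp
qed

lemma card_filter_mono:
  fixes m N :: nat
  assumes "\<And>F. F \<in> nsets {m<..m + N} k \<Longrightarrow> P F \<Longrightarrow> Q F"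
  shows "card {F \<in> nsets {m<..m + N} k. P F} \<le> card {F \<in> nsets {m<..m + N} k. Q F}"
  using assms by (intro card_mono finite_nsets_filter) auto

lemma not_in_nsets_Suc: "F \<in> nsets {Suc m<..Suc m + N} k \<Longrightarrow> Suc m \<notin> F"
  by (auto simp: nsets_def)

text \<open>This is the bound of the reflection principle, by induction on the first step. A
  down-step leaves \<open>u + 1\<close> to climb with \<open>k\<close> up-steps, an up-step leaves
  \<open>u - 1\<close> with \<open>k - 1\<close>, and the two binomials add up by Pascal's
  rule.\<close>

lemma card_hit_le:
  "card {F \<in> nsets {m<..m + N} k. \<exists>j\<in>{m..m + N}. int u \<le> height m F j}
    \<le> (if u \<le> k then N choose (k - u) else 0)"
proof (induction N arbitrary: m k u)
  case 0
  show ?case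
  proof (cases "u = 0")
    case True
    then show ?thesis using card_nsets_filter_le[of m 0 k] by simp
  qed simp
next
  case (Suc N)
  show ?case
  proof (cases u)
    case 0
    then show ?thesis using card_nsets_filter_le[of m "Suc N" k] by simp
  next
    case (Suc v)
    have down: "\<exists>j\<in>{Suc m..Suc m + N}. int (Suc u) \<le> height (Suc m) F j"
      if F: "F \<in> nsets {Suc m<..Suc m + N} k" and hit: "\<exists>j\<in>{m..m + Suc N}. int u \<le> height m F j" for F
    proof -
      obtain j where j: "j \<in> {m..m + Suc N}" "int u \<le> height m F j" using hit by blast
      then have "j \<noteq> m" using Suc by auto
      then have "j \<in> {Suc m..Suc m + N}" using j by auto
      moreover have "int (Suc u) \<le> height (Suc m) F j"
        using height_down[OF not_in_nsets_Suc[OF F]] j \<open>j \<noteq> m\<close> by simp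
      ultimately show ?thesis by blast
    qed
    have up: "\<exists>j\<in>{Suc m..Suc m + N}. int v \<le> height (Suc m) F j"
      if F: "F \<in> nsets {Suc m<..Suc m + N} (k - 1)"
        and hit: "\<exists>j\<in>{m..m + Suc N}. int u \<le> height m (insert (Suc m) F) j" for F
    proof -
      obtain j where j: "j \<in> {m..m + Suc N}" "int u \<le> height m (insert (Suc m) F) j" using hit by blast
      then have "j \<noteq> m" using Suc by auto
      then have "j \<in> {Suc m..Suc m + N}" using j by auto
      moreover have "int v \<le> height (Suc m) F j"
        using height_up[OF not_in_nsets_Suc[OF F]] j \<open>j \<noteq> m\<close> Suc by simp
      ultimately show ?thesis by blast
    qed
    have D: "card {F \<in> nsets {Suc m<..Suc m + N} k. \<exists>j\<in>{m..m + Suc N}. int u \<le> height m F j}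
      \<le> (if Suc u \<le> k then N choose (k - Suc u) else 0)"
      by (rule order_trans[OF card_filter_mono[OF down] Suc.IH])
    have U: "card {F \<in> nsets {Suc m<..Suc m + N} (k - 1).
        \<exists>j\<in>{m..m + Suc N}. int u \<le> height m (insert (Suc m) F) j}
      \<le> (if v \<le> k - 1 then N choose (k - 1 - v) else 0)"
      by (rule order_trans[OF card_filter_mono[OF up] Suc.IH])
    show ?thesis
    proof (cases "u \<le> k")
      case True
      then obtain d where "k = u + d" by (metis le_Suc_ex)
      then show ?thesis
        using D U Suc unfolding card_nsets_Suc by (cases d) simp_all
    next
      case False
      then show ?thesis using D U Suc unfolding card_nsets_Suc by (auto split: if_splits)
    qed
  qed
qed

text \<open>The first step shifts the level as for a single visit; the factor 2 comes from
  \<open>u = 0\<close>, where the start is already one visit. After an up-step every walk is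
  counted, after a down-step the walk has to climb by 1, and each of the two cases is bounded by
  \<open>N choose (k - 1)\<close> for \<open>N\<close> remaining steps.\<close>

lemma card_hit_twice_le:
  assumes "0 < N"
  shows "card {F \<in> nsets {m<..m + N} k.
      \<exists>i j. m \<le> i \<and> i < j \<and> j \<le> m + N \<and> int u \<le> height m F i \<and> int u \<le> height m F j}
    \<le> (if u < k then 2 * ((N - 1) choose (k - u - 1)) else 0)"
  using assms
proof (induction N arbitrary: m k u)
  case (Suc N)
  let ?tw = "\<lambda>m N F u. \<exists>i j. m \<le> i \<and> i < j \<and> j \<le> m + N \<and> int u \<le> height m F i \<and> int u \<le> height m F j"
  show ?case
  proof (cases u)
    case 0
    have down: "\<exists>j\<in>{Suc m..Suc m + N}. int 1 \<le> height (Suc m) F j"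
      if F: "F \<in> nsets {Suc m<..Suc m + N} k" and tw: "?tw m (Suc N) F u" for F
    proof -
      obtain i j where "m \<le> i" "i < j" "j \<le> m + Suc N" "int u \<le> height m F j" using tw by blast
      then show ?thesis
        using height_down[OF not_in_nsets_Suc[OF F], of j] 0 by (intro bexI[of _ j]) auto
    qed
    have D: "card {F \<in> nsets {Suc m<..Suc m + N} k. ?tw m (Suc N) F u}
      \<le> (if 1 \<le> k then N choose (k - 1) else 0)"
      by (rule order_trans[OF card_filter_mono[OF down] card_hit_le])
    have U: "card {F \<in> nsets {Suc m<..Suc m + N} (k - 1). ?tw m (Suc N) (insert (Suc m) F) u}
      \<le> N choose (k - 1)"
      by (rule card_nsets_filter_le)
    show ?thesis using D U 0 unfolding card_nsets_Suc by (cases k) simp_all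
  next
    case (Suc v)
    have late: "Suc m \<le> i" if "m \<le> i" "int u \<le> height m F i" for i F
      using that Suc by (cases "i = m") auto
    have down: "?tw (Suc m) N F (Suc u)"
      if F: "F \<in> nsets {Suc m<..Suc m + N} k" and tw: "?tw m (Suc N) F u" for F
    proof -
      obtain i j where ij: "m \<le> i" "i < j" "j \<le> m + Suc N" "int u \<le> height m F i" "int u \<le> height m F j"
        using tw by blast
      have "Suc m \<le> i" using late ij by blast
      then show ?thesis
        using height_down[OF not_in_nsets_Suc[OF F], of i] height_down[OF not_in_nsets_Suc[OF F], of j] ij
        by (intro exI[of _ i] exI[of _ j]) auto
    qed
    have up: "?tw (Suc m) N F v"
      if F: "F \<in> nsets {Suc m<..Suc m + N} (k - 1)" and tw: "?tw m (Suc N) (insert (Suc m) F) u" for F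
    proof -
      obtain i j where ij: "m \<le> i" "i < j" "j \<le> m + Suc N"
        "int u \<le> height m (insert (Suc m) F) i" "int u \<le> height m (insert (Suc m) F) j"
        using tw by blast
      have "Suc m \<le> i" using late ij by blast
      then show ?thesis
        using height_up[OF not_in_nsets_Suc[OF F], of i] height_up[OF not_in_nsets_Suc[OF F], of j] ij Suc
        by (intro exI[of _ i] exI[of _ j]) auto
    qed
    show ?thesis
    proof (cases "N = 0")
      case True
      have "\<not> ?tw m (Suc N) F u" for F
      proof
        assume "?tw m (Suc N) F u"
        then obtain i j where "m \<le> i" "i < j" "j \<le> m + Suc N" "int u \<le> height m F i" by blast
        then show False using late[of i F] True by simp
      qed
      then have "{F \<in> nsets {m<..m + Suc N} k. ?tw m (Suc N) F u} = {}" by blast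
      then show ?thesis by (simp only: card.empty)
    next
      case False
      then have "0 < N" by simp
      have D: "card {F \<in> nsets {Suc m<..Suc m + N} k. ?tw m (Suc N) F u}
        \<le> (if Suc u < k then 2 * ((N - 1) choose (k - Suc u - 1)) else 0)"
        by (rule order_trans[OF card_filter_mono[OF down] Suc.IH[OF \<open>0 < N\<close>]])
      have U: "card {F \<in> nsets {Suc m<..Suc m + N} (k - 1). ?tw m (Suc N) (insert (Suc m) F) u}
        \<le> (if v < k - 1 then 2 * ((N - 1) choose (k - 1 - v - 1)) else 0)"
        by (rule order_trans[OF card_filter_mono[OF up] Suc.IH[OF \<open>0 < N\<close>]])
      obtain M where M: "N = Suc M" using False by (cases N) auto
      show ?thesis
      proof (cases "u < k")
        case True
        then obtain d where "k = Suc (u + d)" by (metis less_iff_Suc_add)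
        then show ?thesis
          using D U Suc M unfolding card_nsets_Suc by (cases d) simp_all
      next
        case False
        then show ?thesis using D U Suc unfolding card_nsets_Suc by (auto split: if_splits)
      qed
    qed
  qed
qed simp

text \<open>Ballot numbers: \<open>ballot u s\<close> counts the walks with \<open>u + s\<close> up-steps and \<open>s\<close>
  down-steps that never exceed their final height \<open>u\<close>.\<close>

fun ballot :: "nat \<Rightarrow> nat \<Rightarrow> nat" where
  "ballot u 0 = 1"
| "ballot 0 (Suc s) = ballot 1 s"
| "ballot (Suc u) (Suc s) = ballot u (Suc s) + ballot (Suc (Suc u)) s"

text \<open>The recursion of \<open>ballot\<close> follows the first step: an up-step lowers the
  ceiling by one, a down-step raises it by one and uses up one of the \<open>s\<close> down-steps.
  Under ceiling 0 no up-step is possible, and \<open>s = 0\<close> leaves a single walk.\<close>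

lemma card_not_exceeding_le:
  "card {F \<in> nsets {m<..m + (u + 2 * s)} (u + s). \<forall>j\<in>{m..m + (u + 2 * s)}. height m F j \<le> int u}
    \<le> ballot u s"
proof (induction u s arbitrary: m rule: ballot.induct)
  case (1 u)
  show ?case using card_nsets_filter_le[of m u u] by simp
next
  case (2 s)
  let ?P = "\<lambda>F. \<forall>j\<in>{m..m + (0 + 2 * Suc s)}. height m F j \<le> int 0"
  have N: "0 + 2 * Suc s = Suc (1 + 2 * s)" by simp
  have down: "\<forall>j\<in>{Suc m..Suc m + (1 + 2 * s)}. height (Suc m) F j \<le> int 1"
    if F: "F \<in> nsets {Suc m<..Suc m + (1 + 2 * s)} (1 + s)" and P: "?P F" for F
  proof
    fix j assume j: "j \<in> {Suc m..Suc m + (1 + 2 * s)}"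
    then have "height m F j \<le> int 0" using P by auto
    then show "height (Suc m) F j \<le> int 1" using height_down[OF not_in_nsets_Suc[OF F], of j] j by simp
  qed
  have up: "\<not> ?P (insert (Suc m) F)"
    if F: "F \<in> nsets {Suc m<..Suc m + (1 + 2 * s)} s" for F
  proof
    assume "?P (insert (Suc m) F)"
    then have "height m (insert (Suc m) F) (Suc m) \<le> 0" by simp
    then show False using height_up[OF not_in_nsets_Suc[OF F], of "Suc m"] by simp
  qed
  have E: "{F \<in> nsets {Suc m<..Suc m + (1 + 2 * s)} s. ?P (insert (Suc m) F)} = {}"
    using up by blast
  have k: "0 + Suc s - 1 = s" "(0 + Suc s = 0) = False" "0 + Suc s = 1 + s" by simp_all
  have "card {F \<in> nsets {m<..m + (0 + 2 * Suc s)} (0 + Suc s). ?P F} =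
    card {F \<in> nsets {Suc m<..Suc m + (1 + 2 * s)} (1 + s). ?P F}"
    unfolding N card_nsets_Suc k(1,2) if_False E[unfolded N] card.empty by (simp only: k add_0_right)
  also have "card {F \<in> nsets {Suc m<..Suc m + (1 + 2 * s)} (1 + s). ?P F} \<le> ballot 1 s"
    by (rule order_trans[OF card_filter_mono[OF down] 2])
  finally show ?case by simp
next
  case (3 u s)
  let ?P = "\<lambda>F. \<forall>j\<in>{m..m + (Suc u + 2 * Suc s)}. height m F j \<le> int (Suc u)"
  have N: "Suc u + 2 * Suc s = Suc (Suc (Suc u) + 2 * s)" by simp
  have N': "Suc (Suc u) + 2 * s = u + 2 * Suc s" by simp
  have down: "\<forall>j\<in>{Suc m..Suc m + (Suc (Suc u) + 2 * s)}. height (Suc m) F j \<le> int (Suc (Suc u))"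
    if F: "F \<in> nsets {Suc m<..Suc m + (Suc (Suc u) + 2 * s)} (Suc (Suc u) + s)" and P: "?P F" for F
  proof
    fix j assume j: "j \<in> {Suc m..Suc m + (Suc (Suc u) + 2 * s)}"
    then have "height m F j \<le> int (Suc u)" using P by auto
    then show "height (Suc m) F j \<le> int (Suc (Suc u))"
      using height_down[OF not_in_nsets_Suc[OF F], of j] j by simp
  qed
  have up: "\<forall>j\<in>{Suc m..Suc m + (u + 2 * Suc s)}. height (Suc m) F j \<le> int u"
    if F: "F \<in> nsets {Suc m<..Suc m + (u + 2 * Suc s)} (u + Suc s)" and P: "?P (insert (Suc m) F)" for F
  proof
    fix j assume j: "j \<in> {Suc m..Suc m + (u + 2 * Suc s)}"
    then have "height m (insert (Suc m) F) j \<le> int (Suc u)" using P by auto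
    then show "height (Suc m) F j \<le> int u"
      using height_up[OF not_in_nsets_Suc[OF F], of j] j by simp
  qed
  have "card {F \<in> nsets {m<..m + (Suc u + 2 * Suc s)} (Suc u + Suc s). ?P F} =
    card {F \<in> nsets {Suc m<..Suc m + (Suc (Suc u) + 2 * s)} (Suc (Suc u) + s). ?P F} +
    card {F \<in> nsets {Suc m<..Suc m + (u + 2 * Suc s)} (u + Suc s). ?P (insert (Suc m) F)}"
    unfolding N card_nsets_Suc by (simp add: N')
  moreover have "card {F \<in> nsets {Suc m<..Suc m + (Suc (Suc u) + 2 * s)} (Suc (Suc u) + s). ?P F}
      \<le> ballot (Suc (Suc u)) s"
    by (rule order_trans[OF card_filter_mono[OF down] 3(2)])
  moreover have "card {F \<in> nsets {Suc m<..Suc m + (u + 2 * Suc s)} (u + Suc s). ?P (insert (Suc m) F)}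
      \<le> ballot u (Suc s)"
    by (rule order_trans[OF card_filter_mono[OF up] 3(1)])
  ultimately show ?case unfolding ballot.simps by linarith
qed

text \<open>A walk can be cut at time \<open>J\<close> and its two parts chosen independently once
  the number \<open>a\<close> of up-steps before the cut is fixed.\<close>

lemma card_nsets_product:
  fixes J n :: nat
  assumes "J \<le> n" "a + b = k" "P \<subseteq> nsets {0<..J} a" "Q \<subseteq> nsets {J<..n} b"
  shows "card {F \<in> nsets {0<..n} k. F \<inter> {0<..J} \<in> P \<and> F \<inter> {J<..n} \<in> Q} = card P * card Q"
proof -
  have I: "{0<..J} \<inter> {J<..n} = {}" "{0<..J} \<union> {J<..n} = {0<..n}" using assms(1) by auto
  have "bij_betw (\<lambda>(X, Y). X \<union> Y) (P \<times> Q)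
    {F \<in> nsets {0<..n} k. F \<inter> {0<..J} \<in> P \<and> F \<inter> {J<..n} \<in> Q}"
  proof (rule bij_betw_byWitness[where f' = "\<lambda>F. (F \<inter> {0<..J}, F \<inter> {J<..n})"])
    have split: "(X \<union> Y) \<inter> {0<..J} = X" "(X \<union> Y) \<inter> {J<..n} = Y"
      "X \<union> Y \<in> nsets {0<..n} k" if "X \<in> P" "Y \<in> Q" for X Y
    proof -
      have XY: "X \<subseteq> {0<..J}" "Y \<subseteq> {J<..n}" "finite X" "finite Y" "card X = a" "card Y = b"
        using that assms(3,4) by (auto simp: nsets_def)
      then have "X \<inter> Y = {}" using I by blast
      then have "card (X \<union> Y) = k" using XY assms(2) by (simp add: card_Un_disjoint)
      moreover have "X \<union> Y \<subseteq> {0<..n}" using XY(1,2) I by blast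
      ultimately show "X \<union> Y \<in> nsets {0<..n} k" using XY by (simp add: nsets_def)
      show "(X \<union> Y) \<inter> {0<..J} = X" "(X \<union> Y) \<inter> {J<..n} = Y"
        using XY(1,2) I by blast+
    qed
    show "\<forall>p\<in>P \<times> Q. ((case p of (X, Y) \<Rightarrow> X \<union> Y) \<inter> {0<..J}, (case p of (X, Y) \<Rightarrow> X \<union> Y) \<inter> {J<..n}) = p"
      using split(1,2) by (simp add: case_prod_beta)
    show "\<forall>F\<in>{F \<in> nsets {0<..n} k. F \<inter> {0<..J} \<in> P \<and> F \<inter> {J<..n} \<in> Q}.
        (case (F \<inter> {0<..J}, F \<inter> {J<..n}) of (X, Y) \<Rightarrow> X \<union> Y) = F"
    proof
      fix F assume "F \<in> {F \<in> nsets {0<..n} k. F \<inter> {0<..J} \<in> P \<and> F \<inter> {J<..n} \<in> Q}"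
      then have "F \<subseteq> {0<..n}" unfolding nsets_def by blast
      then show "(case (F \<inter> {0<..J}, F \<inter> {J<..n}) of (X, Y) \<Rightarrow> X \<union> Y) = F" using I by auto
    qed
    show "(\<lambda>(X, Y). X \<union> Y) ` (P \<times> Q) \<subseteq>
        {F \<in> nsets {0<..n} k. F \<inter> {0<..J} \<in> P \<and> F \<inter> {J<..n} \<in> Q}"
    proof clarify
      fix X Y assume "X \<in> P" "Y \<in> Q"
      then show "X \<union> Y \<in> nsets {0<..n} k \<and> (X \<union> Y) \<inter> {0<..J} \<in> P \<and> (X \<union> Y) \<inter> {J<..n} \<in> Q"
        using split[of X Y] by simp
    qed
    show "(\<lambda>F. (F \<inter> {0<..J}, F \<inter> {J<..n})) `
        {F \<in> nsets {0<..n} k. F \<inter> {0<..J} \<in> P \<and> F \<inter> {J<..n} \<in> Q} \<subseteq> P \<times> Q"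
      by auto
  qed
  from bij_betw_same_card[OF this] show ?thesis by (simp only: card_cartesian_product)
qed

section \<open>Binomial estimates\<close>

lemma binomial_ratio_lower: "Suc m * (N choose Suc m) = (N - m) * (N choose m)"
  using binomial_absorption[of m N] binomial_absorb_comp[of N m] by simp

text \<open>Raising the lower index from \<open>m\<close> to \<open>m + 1\<close> multiplies by (N -
  m) / (m + 1), which is at least \<open>t\<close> when
  \<open>(t + 1) * (m + 1) \<le> N\<close>.\<close>

lemma binomial_lower_le:
  assumes "(t + 1) * (m + r) \<le> N"
  shows "t ^ r * (N choose m) \<le> N choose (m + r)"
  using assms
proof (induction r)
  case (Suc r)
  have IH: "t ^ r * (N choose m) \<le> N choose (m + r)"
    using Suc by (simp add: algebra_simps)
  have "t * Suc (m + r) \<le> N - (m + r)" using Suc.prems by (simp add: algebra_simps)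
  then have "(t * Suc (m + r)) * (N choose (m + r)) \<le> (N - (m + r)) * (N choose (m + r))"
    by (rule mult_le_mono1)
  also have "\<dots> = Suc (m + r) * (N choose Suc (m + r))"
    by (rule binomial_ratio_lower[symmetric])
  finally have "Suc (m + r) * (t * (N choose (m + r))) \<le> Suc (m + r) * (N choose Suc (m + r))"
    by (simp only: ac_simps)
  then have "t * (N choose (m + r)) \<le> N choose Suc (m + r)" by (simp only: mult_le_cancel1)
  moreover have "t * (t ^ r * (N choose m)) \<le> t * (N choose (m + r))"
    using IH by (rule mult_le_mono2)
  ultimately have "t * (t ^ r * (N choose m)) \<le> N choose Suc (m + r)" by linarith
  then show ?case by (simp only: power_Suc mult.assoc add_Suc_right)
qed simp

text \<open>A diagonal step multiplies by (N + 1) / (m + 1), hence by at least \<open>t + 1\<close>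
  here. These factors are what pays for the ballot numbers.\<close>

lemma binomial_diagonal_le:
  assumes "(t + 1) * (m + a) \<le> N + a"
  shows "(t + 1) ^ a * (N choose m) \<le> (N + a) choose (m + a)"
  using assms
proof (induction a)
  case (Suc a)
  have IH: "(t + 1) ^ a * (N choose m) \<le> (N + a) choose (m + a)"
    using Suc by (simp add: algebra_simps)
  have "(t + 1) * Suc (m + a) \<le> Suc (N + a)" using Suc.prems by simp
  then have "((t + 1) * Suc (m + a)) * ((N + a) choose (m + a))
      \<le> Suc (N + a) * ((N + a) choose (m + a))"
    by (rule mult_le_mono1)
  also have "\<dots> = Suc (m + a) * (Suc (N + a) choose Suc (m + a))"
    by (rule Suc_times_binomial[symmetric])
  finally have "Suc (m + a) * ((t + 1) * ((N + a) choose (m + a)))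
      \<le> Suc (m + a) * (Suc (N + a) choose Suc (m + a))"
    by (simp only: ac_simps)
  then have "(t + 1) * ((N + a) choose (m + a)) \<le> Suc (N + a) choose Suc (m + a)"
    by (simp only: mult_le_cancel1)
  moreover have "(t + 1) * ((t + 1) ^ a * (N choose m)) \<le> (t + 1) * ((N + a) choose (m + a))"
    using IH by (rule mult_le_mono2)
  ultimately show ?case by (simp only: power_Suc mult.assoc add_Suc_right)
qed simp

lemma binomial_upper_Suc:
  assumes "m \<le> Suc N"
  shows "(real (Suc N) - real m) * real (Suc N choose m) = real (Suc N) * real (N choose m)"
proof -
  have "(Suc N - m) * (Suc N choose m) = Suc N * (N choose m)"
    using binomial_absorb_comp[of "Suc N" m] by simp
  then have "real (Suc N - m) * real (Suc N choose m) = real (Suc N) * real (N choose m)"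
    by (metis of_nat_mult)
  then show ?thesis using assms by (simp add: of_nat_diff)
qed

text \<open>One more point multiplies by (N + 1) / (N + 1 - m), at most 1 + 1/t. The companion
  \<open>binomial_upper_ge\<close> reads the same ratio in the direction of removing points.\<close>

lemma binomial_upper_le:
  assumes "(t + 1) * m \<le> N + 1" "0 < t"
  shows "real ((N + r) choose m) \<le> (1 + 1 / real t) ^ r * real (N choose m)"
proof (induction r)
  case (Suc r)
  let ?N = "N + r"
  have tm: "real t * real m + real m \<le> real ?N + 1"
    using assms(1) of_nat_mono[of "(t + 1) * m" "N + 1", where 'a = real] by (simp add: algebra_simps)
  have "m \<le> t * m" using assms(2) by simp
  then have mle: "m \<le> Suc ?N" using assms(1) by (simp add: algebra_simps)
  have pos: "0 < real (Suc ?N) - real m"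
  proof (cases "m = 0")
    case False
    then have "0 < real t * real m" using assms(2) by simp
    then show ?thesis using tm by linarith
  qed simp
  have "real t * real (Suc ?N) \<le> (real t + 1) * (real (Suc ?N) - real m)"
    using tm by (simp add: algebra_simps)
  then have "real (Suc ?N) \<le> (1 + 1 / real t) * (real (Suc ?N) - real m)"
    using assms(2) by (simp add: field_simps)
  then have "real (Suc ?N) * real (?N choose m)
      \<le> (1 + 1 / real t) * (real (Suc ?N) - real m) * real (?N choose m)"
    by (rule mult_right_mono) simp
  then have "(real (Suc ?N) - real m) * real (Suc ?N choose m)
      \<le> (real (Suc ?N) - real m) * ((1 + 1 / real t) * real (?N choose m))"
    unfolding binomial_upper_Suc[OF mle] by (simp only: ac_simps)
  then have "real (Suc ?N choose m) \<le> (1 + 1 / real t) * real (?N choose m)"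
    using pos by (simp only: mult_le_cancel_left_pos)
  also have "\<dots> \<le> (1 + 1 / real t) * ((1 + 1 / real t) ^ r * real (N choose m))"
    using Suc by (intro mult_left_mono) simp_all
  finally show ?case by (simp add: mult.assoc)
qed simp

lemma binomial_upper_ge:
  assumes "t * m \<le> N" "1 < t"
  shows "(1 - 1 / real t) ^ r * real ((N + r) choose m) \<le> real (N choose m)"
proof (induction r)
  case (Suc r)
  let ?N = "N + r"
  have tm: "real t * real m \<le> real (Suc ?N)"
    using assms(1) of_nat_mono[of "t * m" N, where 'a = real] by simp
  have "m \<le> t * m" using assms(2) by simp
  then have mle: "m \<le> Suc ?N" using assms(1) by linarith
  have "(1 - 1 / real t) * real (Suc ?N) \<le> real (Suc ?N) - real m"
    using tm assms(2) by (simp add: field_simps)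
  then have "(1 - 1 / real t) * real (Suc ?N) * real (Suc ?N choose m)
      \<le> (real (Suc ?N) - real m) * real (Suc ?N choose m)"
    by (rule mult_right_mono) simp
  then have "real (Suc ?N) * ((1 - 1 / real t) * real (Suc ?N choose m))
      \<le> real (Suc ?N) * real (?N choose m)"
    unfolding binomial_upper_Suc[OF mle] by (simp only: ac_simps)
  then have "(1 - 1 / real t) * real (Suc ?N choose m) \<le> real (?N choose m)"
    by (simp only: mult_le_cancel_left_pos of_nat_0_less_iff zero_less_Suc)
  then have "(1 - 1 / real t) ^ r * ((1 - 1 / real t) * real (Suc ?N choose m))
      \<le> (1 - 1 / real t) ^ r * real (?N choose m)"
    using assms(2) by (intro mult_left_mono) simp_all
  also have "\<dots> \<le> real (N choose m)" by (rule Suc)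
  finally show ?case by (simp add: ac_simps)
qed simp

text \<open>Ratios of neighbours decrease along a row of Pascal's triangle, so moving two lower
  indices apart symmetrically does not increase the product. Unequal levels
  \<open>u + v = 2 * t\<close> are thereby replaced by the balanced lower index
  \<open>K\<close>.\<close>

lemma binomial_log_concave:
  assumes "d \<le> M"
  shows "(n choose (M - d)) * (n choose (M + d)) \<le> (n choose M)\<^sup>2"
  using assms
proof (induction d)
  case (Suc d)
  show ?case
  proof (cases "M + Suc d \<le> n")
    case True
    define p q r w where "p = n choose (M - Suc d)" "q = n choose (M - d)"
      "r = n choose (M + d)" "w = n choose (M + Suc d)"
    have eq1: "(M - d) * q = (n - (M - Suc d)) * p"
      using binomial_ratio_lower[of "M - Suc d" n] Suc.prems by (simp add: p_q_r_w_def Suc_diff_Suc)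
    have eq2: "(M + Suc d) * w = (n - (M + d)) * r"
      using binomial_ratio_lower[of "M + d" n] by (simp add: p_q_r_w_def)
    define X where "X = (n - (M - Suc d)) * (M + Suc d)"
    have "X * (p * w) = ((M - d) * q) * ((n - (M + d)) * r)"
      unfolding X_def eq1 eq2[symmetric] by (simp only: ac_simps)
    also have "\<dots> = ((M - d) * (n - (M + d))) * (q * r)" by (simp only: ac_simps)
    also have "\<dots> \<le> X * (q * r)"
      unfolding X_def mult.commute[of "n - (M - Suc d)"] by (intro mult_le_mono) simp_all
    finally have "p * w \<le> q * r" using True Suc.prems by (simp add: X_def)
    then show ?thesis using Suc by (simp add: p_q_r_w_def)
  next
    case False
    then show ?thesis by (simp add: binomial_eq_0)
  qed
qed (simp add: power2_eq_square)

lemma binomial_log_concave_sum: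
  assumes "a + b = 2 * M"
  shows "(n choose a) * (n choose b) \<le> (n choose M)\<^sup>2"
proof (cases "a \<le> b")
  case True
  then have "a = M - (M - a)" "b = M + (M - a)" using assms by auto
  then show ?thesis using binomial_log_concave[of "M - a" M n] by (metis diff_le_self)
next
  case False
  then have "b = M - (M - b)" "a = M + (M - b)" using assms by auto
  then show ?thesis using binomial_log_concave[of "M - b" M n] by (metis diff_le_self mult.commute)
qed

lemma one_plus_inverse_power_less:
  assumes "0 < t"
  shows "(1 + 1 / real t) ^ t < 272 / 100"
proof -
  have "(1 + 1 / real t) ^ t \<le> exp 1"
    using exp_ge_one_plus_x_over_n_power_n[of t 1] assms by simp
  then show ?thesis using e_less_272 by linarith
qed

section \<open>Estimates relative to the size of a star\<close>

locale large_ground_set =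
  fixes K t n :: nat
  assumes t_ge: "14 \<le> t" and n_ge: "(t + 1) * (K + t) \<le> n"
begin

text \<open>The size of a full star: \<open>K\<close> stands for k - t, the number of elements of a
  member outside the \<open>t\<close> fixed points. The bound to be proved is
  \<open>S\<^sup>2\<close>.\<close>

definition S :: real where "S = real ((n - t) choose K)"

lemma tK: "t * K + K + t * t + t \<le> n"
  using n_ge by (simp add: algebra_simps)

lemma t_le_n: "t \<le> n"
  using tK by linarith

lemma tt: "14 * t \<le> t * t"
  using t_ge by simp

lemma S_pos: "0 < S"
proof -
  have "K \<le> n - t" using tK by linarith
  then show ?thesis by (simp add: S_def)
qed

lemma choose_K_less: "real (n choose K) < 272 / 100 * S"
proof -
  have "real ((n - t + t) choose K) \<le> (1 + 1 / real t) ^ t * real ((n - t) choose K)"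
    using tK tt t_ge by (intro binomial_upper_le) (simp_all add: algebra_simps)
  also have "\<dots> < 272 / 100 * real ((n - t) choose K)"
    using one_plus_inverse_power_less[of t] t_ge S_pos
    by (intro mult_strict_right_mono) (simp_all add: S_def)
  finally show ?thesis using t_le_n by (simp add: S_def)
qed

lemma choose_lower_le:
  assumes "r \<le> K"
  shows "real (n choose (K - r)) \<le> (1 / real t) ^ r * real (n choose K)"
proof -
  have "t ^ r * (n choose (K - r)) \<le> n choose (K - r + r)"
    using assms tK by (intro binomial_lower_le) (simp add: algebra_simps)
  then have "t ^ r * (n choose (K - r)) \<le> n choose K" using assms by simp
  then have "real t ^ r * real (n choose (K - r)) \<le> real (n choose K)"
    by (metis of_nat_le_iff of_nat_mult of_nat_power)
  then show ?thesis using t_ge by (simp add: field_simps)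
qed

text \<open>By absorption \<open>(n - 1) choose (a - 1)\<close> is a/n times
  \<open>n choose a\<close>, and a/n is at most 1/(t + 1). So visiting a level twice gains the
  factor \<open>t + 1\<close>, of which the bound for double visits gives back 2. Log-concavity
  balances the two binomials at \<open>K\<close>.\<close>

lemma hit_twice_product_less:
  assumes "u + v = 2 * t"
  shows "real ((if u < K + t then 2 * ((n - 1) choose (K + t - u - 1)) else 0) *
    (if v \<le> K + t then n choose (K + t - v) else 0)) < S\<^sup>2"
proof (cases "u < K + t \<and> v \<le> K + t")
  case True
  define a b where "a = K + t - u" "b = K + t - v"
  have ab: "a + b = 2 * K" "0 < a" "a \<le> K + t" using True assms by (auto simp: a_b_def)
  have n: "(t + 1) * a \<le> n" using n_ge ab(3) by (meson le_trans mult_le_mono2)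
  have eq: "n * ((n - 1) choose (a - 1)) = a * (n choose a)"
    using times_binomial_minus1_eq[OF ab(2), of n] by simp
  have "(t + 1) * a * ((n - 1) choose (a - 1)) \<le> a * (n choose a)"
    unfolding eq[symmetric] using n by (rule mult_le_mono1)
  then have "a * ((t + 1) * ((n - 1) choose (a - 1))) \<le> a * (n choose a)"
    by (simp only: ac_simps)
  then have "(t + 1) * ((n - 1) choose (a - 1)) \<le> n choose a"
    using ab(2) by (simp only: mult_le_cancel1) 
  then have "(t + 1) * (((n - 1) choose (a - 1)) * (n choose b)) \<le> (n choose a) * (n choose b)"
    using mult_le_mono1 by (metis mult.assoc)
  also have "\<dots> \<le> (n choose K)\<^sup>2" by (rule binomial_log_concave_sum[OF ab(1)])
  finally have "real (t + 1) * real (((n - 1) choose (a - 1)) * (n choose b)) \<le> (real (n choose K))\<^sup>2"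
    by (metis of_nat_le_iff of_nat_mult of_nat_power)
  also have "\<dots> < (272 / 100 * S)\<^sup>2"
    using choose_K_less by (intro power_strict_mono) simp_all
  \<comment> \<open>The square of \<open>272 / 100\<close> is 7.3984, just below 15/2, the value of
    (t + 1)/2 at \<open>t = 14\<close>.\<close>
  also have "\<dots> < 15 / 2 * S\<^sup>2" using S_pos by (simp add: power2_eq_square)
  also have "\<dots> \<le> real (t + 1) / 2 * S\<^sup>2" using t_ge by (intro mult_right_mono) simp_all
  finally have "real (t + 1) * (2 * real (((n - 1) choose (a - 1)) * (n choose b)))
    < real (t + 1) * S\<^sup>2" by (simp add: mult.commute)
  then have "2 * real (((n - 1) choose (a - 1)) * (n choose b)) < S\<^sup>2"
    by (subst (asm) mult_less_cancel_left_pos) simp_all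
  then show ?thesis using True by (simp add: a_b_def)
next
  case False
  have "0 < S\<^sup>2" using S_pos by simp
  then show ?thesis using False by (simp split: if_splits)
qed

lemma q_ge: "13 / 14 \<le> 1 - 1 / real t"
  using t_ge by (simp add: field_simps)

text \<open>The 10 arises from \<open>(t - 1) ^ r \<ge> 13\<close> and 13 * (13/14)^3 > 10. Of the
  exponent \<open>r + 3\<close>, the part \<open>r + 2\<close> pays for the initial down-steps in
  \<open>tail\<close> and 1 pays for its subtracted term.\<close>

lemma ten_power_le:
  assumes "1 \<le> r"
  shows "10 * (1 / real t) ^ r \<le> (1 - 1 / real t) ^ (r + 3)"
proof -
  have "real t - 1 \<le> (real t - 1) ^ r"
    using power_increasing[OF assms, of "real t - 1"] t_ge by simp
  then have "13 * (1 / real t) ^ r \<le> (real t - 1) ^ r * (1 / real t) ^ r"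
    using t_ge by (intro mult_right_mono) simp_all
  also have "\<dots> = (1 - 1 / real t) ^ r"
    using t_ge by (simp add: field_simps flip: power_mult_distrib)
  finally have 1: "13 * (1 / real t) ^ r \<le> (1 - 1 / real t) ^ r" .
  have "(13 / 14) ^ 3 \<le> (1 - 1 / real t) ^ 3"
    using q_ge by (intro power_mono) simp_all
  then have 2: "10 / 13 \<le> (1 - 1 / real t) ^ 3" by (simp add: power3_eq_cube)
  have "13 * (1 / real t) ^ r * (10 / 13) \<le> (1 - 1 / real t) ^ r * (1 - 1 / real t) ^ 3"
    using 1 2 t_ge by (intro mult_mono) (simp_all add: zero_le_power)
  then show ?thesis by (simp add: power_add)
qed

text \<open>The bound \<open>tail N M r\<close> for the number of walks of length \<open>N\<close> with \<open>M\<close> up-steps that begin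
  with \<open>r + 2\<close> down-steps and afterwards never rise by \<open>2\<close>.\<close>

definition tail :: "nat \<Rightarrow> nat \<Rightarrow> nat \<Rightarrow> real" where
  "tail N M r = real ((N - (r + 2)) choose M) - real (if 2 \<le> M then (N - (r + 2)) choose (M - 2) else 0)"

text \<open>Dropping \<open>r + 2\<close> points costs (1 - 1/t)^(r + 2). The subtracted binomial,
  two lower indices down, is at most 1/t of the main one because \<open>t \<le> (t - 1) ^ 2\<close>,
  which costs one more factor 1 - 1/t.\<close>

lemma tail_ge:
  assumes r: "1 \<le> r" and N: "t * M + r + 2 \<le> N"
  shows "10 * (1 / real t) ^ r * real (N choose M) \<le> tail N M r"
proof -
  define N' where "N' = N - (r + 2)"
  have N': "N = N' + (r + 2)" "t * M \<le> N'" using N by (auto simp: N'_def)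
  let ?q = "1 - 1 / real t" and ?c = "real (N' choose M)"
  have 1: "?q ^ (r + 2) * real (N choose M) \<le> ?c"
    unfolding N'(1) using N'(2) t_ge by (intro binomial_upper_ge) simp_all
  have "real (if 2 \<le> M then N' choose (M - 2) else 0) \<le> 1 / real t * ?c"
  proof (cases "2 \<le> M")
    case True
    have "(t - 1) ^ 2 * (N' choose (M - 2)) \<le> N' choose (M - 2 + 2)"
    proof (rule binomial_lower_le)
      have "t - 1 + 1 = t" "M - 2 + 2 = M" using True t_ge by simp_all
      then show "(t - 1 + 1) * (M - 2 + 2) \<le> N'" using N'(2) by (simp only:)
    qed
    moreover have "M - 2 + 2 = M" using True by simp
    ultimately have "(t - 1) ^ 2 * (N' choose (M - 2)) \<le> N' choose M" by (simp only:)
    moreover have "t \<le> (t - 1) ^ 2"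
    proof -
      have "t \<le> (t - 1) * 2" "(t - 1) * 2 \<le> (t - 1) * (t - 1)" using t_ge by simp_all
      then show ?thesis unfolding power2_eq_square by linarith
    qed
    ultimately have "t * (N' choose (M - 2)) \<le> N' choose M"
      using mult_le_mono1 le_trans by blast
    then have "real t * real (N' choose (M - 2)) \<le> ?c" by (metis of_nat_le_iff of_nat_mult)
    then show ?thesis using True t_ge by (simp add: field_simps)
  qed simp
  then have 2: "?q * ?c \<le> tail N M r" unfolding tail_def N'_def[symmetric] by (simp add: algebra_simps)
  have "10 * (1 / real t) ^ r * real (N choose M) \<le> ?q ^ (r + 3) * real (N choose M)"
    by (intro mult_right_mono ten_power_le r) simp
  also have "\<dots> = ?q * (?q ^ (r + 2) * real (N choose M))"
    by (simp add: power_add power3_eq_cube power2_eq_square)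
  also have "\<dots> \<le> ?q * ?c" using 1 q_ge by (intro mult_left_mono) simp_all
  finally show ?thesis using 2 by linarith
qed

text \<open>\<open>P\<close> and \<open>Q\<close> count the members of a star that contain or avoid
  one further point, so \<open>S = Q + P\<close> by Pascal's rule. The cores for s = 0, s' = 1 have
  sizes \<open>P\<close> and \<open>(t + 1) * Q + P\<close>.\<close>

definition P :: real where "P = real ((n - (t + 1)) choose (K - 1))"

definition Q :: real where "Q = real ((n - (t + 1)) choose K)"

lemma S_eq: assumes "1 \<le> K" shows "S = Q + P"
proof -
  have "n - t = Suc (n - (t + 1))" using tK assms by linarith
  moreover obtain L where "K = Suc L" using assms by (cases K) auto
  ultimately show ?thesis unfolding S_def P_def Q_def by simp
qed

lemma P_eq: assumes "1 \<le> K" shows "(real n - real t) * P = real K * S"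
proof -
  have nt: "n - t = Suc (n - (t + 1))" using tK assms by linarith
  have "K * ((n - t) choose K) = (n - t) * ((n - t - 1) choose (K - 1))"
    using times_binomial_minus1_eq[of K "n - t"] assms by simp
  then have "real K * S = real (n - t) * P"
    unfolding S_def P_def by (metis diff_diff_left of_nat_mult)
  then show ?thesis using t_le_n by (simp add: of_nat_diff)
qed

lemma PQ_nonneg: "0 \<le> P" "0 \<le> Q"
  by (simp_all add: P_def Q_def)

lemma P_pos: assumes "1 \<le> K" shows "0 < P"
proof -
  have "K - 1 \<le> n - (t + 1)" using tK assms by linarith
  then show ?thesis by (simp add: P_def)
qed

lemma P_less: assumes "1 \<le> K" shows "(real t + 1) * P < S"
proof -
  have "t * K + K + t < n" using tK tt t_ge by linarith
  then have *: "(real t + 1) * real K < real n - real t"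
    using of_nat_less_iff[of "t * K + K + t" n, where 'a = real] by (simp add: algebra_simps)
  have "(real t + 1) * P * (real n - real t) = (real t + 1) * real K * S"
    using P_eq[OF assms] by (simp add: algebra_simps)
  also have "\<dots> < (real n - real t) * S" using * S_pos by (intro mult_strict_right_mono)
  finally have "(real n - real t) * ((real t + 1) * P) < (real n - real t) * S" by (simp only: ac_simps)
  moreover have "0 < real n - real t"
    using * by (rule le_less_trans[rotated]) simp
  ultimately show ?thesis by (simp only: mult_less_cancel_left_pos)
qed

text \<open>A comparison with \<open>S\<close> is too weak here, since
  \<open>P = K / (n - t) * S\<close> may be far below \<open>S / t\<close> for large
  \<open>n\<close>. The constant is twice \<open>272 / 100\<close>: passing from \<open>S\<close> to
  \<open>P\<close> leaves the quotient (n - t) / (n - K + 1), which is at most 2.\<close>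

lemma choose_lower_le_P:
  assumes "1 \<le> r" "r \<le> K"
  shows "real (n choose (K - r)) \<le> 544 / 100 * real t * (1 / real t) ^ r * P"
proof -
  have K: "1 \<le> K" using assms by simp
  obtain r' where r': "r = Suc r'" using assms(1) by (cases r) auto
  define c where "c = real (n choose (K - 1))"
  have "t ^ r' * (n choose (K - r)) \<le> n choose (K - r + r')"
    using assms tK r' by (intro binomial_lower_le) (simp add: algebra_simps)
  moreover have "K - r + r' = K - 1" using assms r' by simp
  ultimately have "real t ^ r' * real (n choose (K - r)) \<le> c"
    unfolding c_def by (metis of_nat_le_iff of_nat_mult of_nat_power)
  then have 1: "real (n choose (K - r)) \<le> (1 / real t) ^ r' * c"
    using t_ge by (simp add: field_simps)
  have "Suc (K - 1) * (n choose Suc (K - 1)) = (n - (K - 1)) * (n choose (K - 1))"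
    by (rule binomial_ratio_lower)
  then have "real (n - (K - 1)) * c = real K * real (n choose K)"
    using K unfolding c_def by (metis Suc_diff_1 less_eq_Suc_le One_nat_def of_nat_mult)
  also have "\<dots> \<le> real K * (272 / 100 * S)" using choose_K_less by (intro mult_left_mono) simp_all
  also have "\<dots> = 272 / 100 * ((real n - real t) * P)" using P_eq[OF K] by simp
  finally have 2: "real (n - (K - 1)) * c \<le> 272 / 100 * ((real n - real t) * P)" .
  have "n - t \<le> 2 * (n - (K - 1))" using tK tt t_ge by (cases t) auto
  then have "real n - real t \<le> 2 * real (n - (K - 1))"
    using of_nat_mono[of "n - t" "2 * (n - (K - 1))", where 'a = real] t_le_n by (simp add: of_nat_diff)
  then have "(real n - real t) * P \<le> 2 * real (n - (K - 1)) * P"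
    using PQ_nonneg by (intro mult_right_mono)
  then have "real (n - (K - 1)) * c \<le> real (n - (K - 1)) * (544 / 100 * P)" using 2 by (simp add: mult.assoc)
  moreover have "0 < n - (K - 1)" using tK t_ge by linarith
  ultimately have "c \<le> 544 / 100 * P" by (simp only: mult_le_cancel_left_pos of_nat_0_less_iff)
  then have "(1 / real t) ^ r' * c \<le> (1 / real t) ^ r' * (544 / 100 * P)" by (intro mult_left_mono) simp_all
  also have "\<dots> = 544 / 100 * real t * (1 / real t) ^ r * P" using r' t_ge by simp
  finally show ?thesis using 1 by linarith
qed

text \<open>The lemmas \<open>trade_0_0\<close>, \<open>trade_1_1\<close>, \<open>trade_0_1\<close>,
  \<open>trade_1_0\<close> are the rates of exchange between two cores. Walks outside one core
  number at most the binomial on the left, and their presence costs the other core at least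
  \<open>t choose s\<close> times \<open>tail\<close>; after weighting with the core sizes, which
  cancel when they are equal, the cost has to win. Here this is 272/100 < 10.\<close>

lemma trade_0_0:
  assumes "1 \<le> r" "r \<le> K"
  shows "real (n choose (K - r)) < tail (n - t) K r"
proof -
  have "real (n choose (K - r)) \<le> (1 / real t) ^ r * real (n choose K)"
    by (rule choose_lower_le[OF assms(2)])
  also have "\<dots> \<le> (1 / real t) ^ r * (272 / 100 * S)"
    using choose_K_less by (intro mult_left_mono) simp_all
  also have "\<dots> < 10 * (1 / real t) ^ r * S"
    using S_pos t_ge by simp
  also have "\<dots> \<le> tail (n - t) K r"
    unfolding S_def using assms tK tt t_ge by (intro tail_ge) linarith+
  finally show ?thesis .
qed

lemma trade_1_1:
  assumes "1 \<le> r" "r \<le> K"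
  shows "real (n choose (K - r)) < real t * tail (n - (t + 2)) (K - 1) r"
proof -
  have K: "1 \<le> K" using assms by simp
  have tK1: "t * (K - 1) \<le> t * K" by simp
  have "(1 - 1 / real t) ^ 1 * real ((n - (t + 2) + 1) choose (K - 1)) \<le> real ((n - (t + 2)) choose (K - 1))"
    using tK tK1 tt t_ge by (intro binomial_upper_ge) linarith+
  moreover have "n - (t + 2) + 1 = n - (t + 1)" using tK tt t_ge by linarith
  ultimately have "(1 - 1 / real t) * P \<le> real ((n - (t + 2)) choose (K - 1))"
    by (simp add: P_def)
  moreover have "13 / 14 * P \<le> (1 - 1 / real t) * P"
    using q_ge PQ_nonneg by (intro mult_right_mono) simp_all
  ultimately have q: "13 / 14 * P \<le> real ((n - (t + 2)) choose (K - 1))" by linarith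
  define X where "X = real t * (1 / real t) ^ r"
  have "0 < X" using t_ge by (simp add: X_def)
  have "real (n choose (K - r)) \<le> 544 / 100 * X * P"
    using choose_lower_le_P[OF assms] by (simp add: X_def)
  also have "\<dots> < 10 * X * (13 / 14 * P)" using \<open>0 < X\<close> P_pos[OF K] by simp
  also have "\<dots> \<le> 10 * X * real ((n - (t + 2)) choose (K - 1))"
    using q \<open>0 < X\<close> by (intro mult_left_mono) simp_all
  also have "\<dots> = real t * (10 * (1 / real t) ^ r * real ((n - (t + 2)) choose (K - 1)))"
    by (simp add: X_def)
  also have "\<dots> \<le> real t * tail (n - (t + 2)) (K - 1) r"
  proof (intro mult_left_mono tail_ge assms)
    show "t * (K - 1) + r + 2 \<le> n - (t + 2)" using tK tK1 tt t_ge assms by linarith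
  qed simp
  finally show ?thesis .
qed

lemma Q_ge: "13 / 14 * S \<le> Q"
proof -
  have "(1 - 1 / real t) ^ 1 * real ((n - (t + 1) + 1) choose K) \<le> real ((n - (t + 1)) choose K)"
    using tK tt t_ge by (intro binomial_upper_ge) linarith+
  moreover have "n - (t + 1) + 1 = n - t" using tK tt t_ge by linarith
  ultimately have "(1 - 1 / real t) * S \<le> Q" by (simp add: S_def Q_def)
  moreover have "13 / 14 * S \<le> (1 - 1 / real t) * S"
    using q_ge S_pos by (intro mult_right_mono) simp_all
  ultimately show ?thesis by linarith
qed

text \<open>Walks outside the large core are weighted by the small core \<open>P\<close>. This
  weight makes up for the lower index \<open>K + 1 - r\<close>, which is one higher than in
  \<open>trade_0_0\<close>.\<close>

lemma trade_0_1:
  assumes "1 \<le> r" "r \<le> K + 1" "1 \<le> K"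
  shows "real (n choose (K + 1 - r)) * P < tail (n - (t + 1)) (K - 1) r * ((real t + 1) * Q + P)"
proof -
  obtain r' where r': "r = Suc r'" "r' \<le> K" using assms by (cases r) auto
  define X where "X = real t * (1 / real t) ^ r"
  have X: "0 < X" "(1 / real t) ^ r' = X" using t_ge by (simp_all add: X_def r')
  have "t * (K - 1) \<le> t * K" by simp
  then have tl: "10 * (1 / real t) ^ r * P \<le> tail (n - (t + 1)) (K - 1) r"
    unfolding P_def using tK tt t_ge assms by (intro tail_ge) linarith+
  have "real (n choose (K + 1 - r)) \<le> X * real (n choose K)"
    using choose_lower_le[OF r'(2)] r' X by simp
  also have "\<dots> \<le> X * (272 / 100 * S)" using choose_K_less X by (intro mult_left_mono) simp_all
  also have "\<dots> < 10 * X * (13 / 14 * S)" using X S_pos by simp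
  also have "\<dots> \<le> 10 * X * Q" using Q_ge X by (intro mult_left_mono) simp_all
  finally have "real (n choose (K + 1 - r)) * P < 10 * X * Q * P"
    using P_pos[OF assms(3)] by (intro mult_strict_right_mono)
  also have "\<dots> = (10 * (1 / real t) ^ r * P) * (real t * Q)" by (simp add: X_def)
  also have "\<dots> \<le> tail (n - (t + 1)) (K - 1) r * ((real t + 1) * Q + P)"
  proof (intro mult_mono tl)
    show "real t * Q \<le> (real t + 1) * Q + P" using PQ_nonneg by (simp add: algebra_simps)
    have "0 \<le> 10 * (1 / real t) ^ r * P" using PQ_nonneg by simp
    then show "0 \<le> tail (n - (t + 1)) (K - 1) r" using tl by linarith
  qed (use PQ_nonneg in simp)
  finally show ?thesis .
qed

text \<open>With the roles exchanged, walks outside the small core carry the large weight. The lower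
  index \<open>K - 1 - r\<close> and the factor \<open>t = t choose 1\<close> compensate for
  it.\<close>

lemma trade_1_0:
  assumes "1 \<le> r" "r \<le> K - 1"
  shows "real (n choose (K - 1 - r)) * ((real t + 1) * Q + P) < real t * tail (n - (t + 1)) K r * P"
proof -
  have K: "1 \<le> K" using assms by simp
  define X where "X = (1 / real t) ^ r"
  have X: "0 < X" using t_ge by (simp add: X_def)
  have "t * K + r + 2 \<le> n - (t + 1)" using tK tt t_ge assms by linarith
  then have tl: "10 * X * Q \<le> tail (n - (t + 1)) K r"
    unfolding Q_def X_def using assms by (intro tail_ge)
  have "real (n choose (K - Suc r)) \<le> 544 / 100 * real t * (1 / real t) ^ Suc r * P"
    using assms by (intro choose_lower_le_P) simp_all
  then have 1: "real (n choose (K - 1 - r)) \<le> 544 / 100 * X * P"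
    using t_ge by (simp add: X_def)
  have 2: "(real t + 1) * Q + P \<le> (real t + 1) * S"
    using S_eq[OF K] PQ_nonneg by (simp add: algebra_simps)
  have "real (n choose (K - 1 - r)) * ((real t + 1) * Q + P) \<le> 544 / 100 * X * P * ((real t + 1) * S)"
    using 1 2 X PQ_nonneg by (intro mult_mono) simp_all
  also have "\<dots> = (544 / 100 * (real t + 1)) * (X * P * S)" by simp
  also have "\<dots> < (10 * (13 / 14) * real t) * (X * P * S)"
    using t_ge X P_pos[OF K] S_pos by (intro mult_strict_right_mono) simp_all
  also have "\<dots> = real t * (10 * X * (13 / 14 * S)) * P" by simp
  also have "\<dots> \<le> real t * (10 * X * Q) * P"
    using Q_ge X PQ_nonneg by (intro mult_right_mono mult_left_mono) simp_all
  also have "\<dots> \<le> real t * tail (n - (t + 1)) K r * P"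
    using tl PQ_nonneg by (intro mult_right_mono mult_left_mono) simp_all
  finally show ?thesis .
qed

text \<open>The large core is at most \<open>t + 1\<close> times a star, which
  \<open>(t + 1) * P < S\<close> just absorbs.\<close>

lemma product_0_1_less:
  assumes "1 \<le> K"
  shows "P * ((real t + 1) * Q + P) < S\<^sup>2"
proof -
  have "(real t + 1) * Q + P \<le> (real t + 1) * S"
    using S_eq[OF assms] PQ_nonneg by (simp add: algebra_simps)
  then have "P * ((real t + 1) * Q + P) \<le> P * ((real t + 1) * S)"
    using PQ_nonneg by (intro mult_left_mono)
  also have "\<dots> = ((real t + 1) * P) * S" by simp
  also have "\<dots> < S * S" using P_less[OF assms] S_pos by (intro mult_strict_right_mono)
  finally show ?thesis by (simp add: power2_eq_square)
qed

text \<open>The left side is the size of \<open>frankl_family 1 t n (K + t)\<close>. With N = n - (t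
  + 2), two applications of Pascal's rule expand \<open>S\<close> so that only t * (N choose (K -
  1)) < N choose K remains.\<close>

lemma frankl_1_less:
  assumes "1 \<le> K"
  shows "real ((t + 2) * ((n - (t + 2)) choose (K - 1)) + (if 2 \<le> K then (n - (t + 2)) choose (K - 2) else 0)) < S"
proof -
  obtain L where L: "K = Suc L" using assms by (cases K) auto
  define N where "N = n - (t + 2)"
  have nt: "n - t = Suc (Suc N)" using tK tt t_ge unfolding N_def by linarith
  have *: "t * K < N - L" using tK tt t_ge L unfolding N_def by linarith
  have "K * (N choose K) = (N - L) * (N choose L)" using binomial_ratio_lower[of L N] L by simp
  moreover have "0 < N choose L" using * by simp
  ultimately have "K * (t * (N choose L)) < K * (N choose K)"
    using * by (metis mult.assoc mult.commute mult_less_mono1)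
  then have "t * (N choose L) < N choose K" by simp
  then have "(t + 2) * (N choose L) + (if 2 \<le> K then N choose (K - 2) else 0) < (n - t) choose K"
    unfolding nt using L by (cases L) (simp_all add: algebra_simps)
  then show ?thesis using L unfolding S_def N_def by (simp del: of_nat_add of_nat_mult)
qed

end

section \<open>Ballot numbers\<close>

lemma ballot_mono: "u \<le> w \<Longrightarrow> ballot u s \<le> ballot w s"
proof (induction w)
  case (Suc w)
  have "ballot w s \<le> ballot (Suc w) s" by (cases s) simp_all
  then show ?case using Suc by (cases "u = Suc w") auto
qed simp

text \<open>The ballot theorem, ballot u s = (u + 1) / (u + s + 1) * ((u + 2 s) choose s), cleared
  of denominators; \<open>u = 0\<close> gives the Catalan numbers.\<close>

lemma ballot_closed_form: "fact s * fact (u + s + 1) * ballot u s = (u + 1) * fact (u + 2 * s)"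
proof (induction u s rule: ballot.induct)
  case (2 s)
  have "fact (Suc s) * fact (0 + Suc s + 1) * ballot 0 (Suc s) = Suc s * (fact s * fact (1 + s + 1) * ballot 1 s)"
  proof -
    have "0 + Suc s + 1 = 1 + s + 1" "fact (Suc s) = (Suc s * fact s :: nat)" by simp_all
    then show ?thesis unfolding ballot.simps by (simp only: mult.assoc)
  qed
  also have "\<dots> = (2 * s + 2) * fact (2 * s + 1)" unfolding 2 by simp
  also have "\<dots> = fact (2 * s + 2)" by simp
  finally show ?case by simp
next
  case (3 u s)
  define F :: nat where "F = fact (u + 2 * s + 2)"
  have 1: "fact (Suc s) * fact (u + s + 2) * ballot u (Suc s) = (u + 1) * F"
    using 3(1) by (simp add: F_def)
  have 2: "fact s * fact (u + s + 3) * ballot (Suc (Suc u)) s = (u + 3) * F"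
    using 3(2) by (simp add: F_def eval_nat_numeral)
  have "fact (Suc s) * fact (Suc u + Suc s + 1) * ballot (Suc u) (Suc s) =
    (u + s + 3) * (fact (Suc s) * fact (u + s + 2) * ballot u (Suc s)) +
    Suc s * (fact s * fact (u + s + 3) * ballot (Suc (Suc u)) s)"
    by (simp add: eval_nat_numeral algebra_simps)
  also have "\<dots> = ((u + s + 3) * (u + 1) + Suc s * (u + 3)) * F"
    unfolding 1 2 by (simp add: algebra_simps)
  also have "\<dots> = (u + 2) * ((u + 2 * s + 3) * F)" by (simp add: algebra_simps)
  also have "(u + 2 * s + 3) * F = fact (Suc u + 2 * Suc s)"
    by (simp add: F_def eval_nat_numeral)
  finally show ?case by simp
qed simp

lemma ballot_ratio:
  "(s + 1) * (u + s + 2) * ballot u (Suc s) = (u + 2 * s + 1) * (u + 2 * s + 2) * ballot u s"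
proof -
  define G where "G = (fact s * fact (u + s + 1) :: nat)"
  have "G * ((s + 1) * (u + s + 2) * ballot u (Suc s)) = fact (Suc s) * fact (u + Suc s + 1) * ballot u (Suc s)"
    by (simp add: G_def eval_nat_numeral algebra_simps)
  also have "\<dots> = (u + 1) * fact (u + 2 * Suc s)" by (rule ballot_closed_form)
  also have "\<dots> = (u + 2 * s + 1) * (u + 2 * s + 2) * ((u + 1) * fact (u + 2 * s))"
    by (simp add: eval_nat_numeral algebra_simps)
  also have "\<dots> = (u + 2 * s + 1) * (u + 2 * s + 2) * (G * ballot u s)"
    unfolding G_def by (simp only: ballot_closed_form)
  finally have "G * ((s + 1) * (u + s + 2) * ballot u (Suc s))
      = G * ((u + 2 * s + 1) * (u + 2 * s + 2) * ballot u s)" by (simp only: ac_simps)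
  moreover have "0 < G" by (simp add: G_def)
  ultimately show ?thesis by simp
qed

lemma ballot_1: "ballot u 1 = u + 1"
  by (induction u) simp_all

lemma ballot_2: "2 * ballot u 2 = (u + 1) * (u + 4)"
proof -
  have "(u + 3) * (2 * ballot u 2) = (u + 3) * ((u + 1) * (u + 4))"
    using ballot_ratio[of 1 u] ballot_1[of u] by (simp add: eval_nat_numeral algebra_simps)
  then show ?thesis by simp
qed

lemma ballot_3: "6 * ballot u 3 = (u + 1) * (u + 5) * (u + 6)"
proof -
  have "(u + 4) * (3 * ballot u 3) = (u + 5) * (u + 6) * ballot u 2"
    using ballot_ratio[of 2 u] by (simp add: eval_nat_numeral algebra_simps)
  moreover have "(u + 4) * (6 * ballot u 3) = 2 * ((u + 4) * (3 * ballot u 3))" by simp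
  ultimately have "(u + 4) * (6 * ballot u 3) = (u + 5) * (u + 6) * (2 * ballot u 2)"
    by (simp only: ac_simps)
  then have "(u + 4) * (6 * ballot u 3) = (u + 4) * ((u + 1) * (u + 5) * (u + 6))"
    unfolding ballot_2 by (simp only: ac_simps)
  then show ?thesis by simp
qed

lemma ballot_4: "24 * ballot u 4 = (u + 1) * (u + 6) * (u + 7) * (u + 8)"
proof -
  have "(u + 5) * (4 * ballot u 4) = (u + 7) * (u + 8) * ballot u 3"
    using ballot_ratio[of 3 u] by (simp add: eval_nat_numeral algebra_simps)
  moreover have "(u + 5) * (24 * ballot u 4) = 6 * ((u + 5) * (4 * ballot u 4))" by simp
  ultimately have "(u + 5) * (24 * ballot u 4) = (u + 7) * (u + 8) * (6 * ballot u 3)"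
    by (simp only: ac_simps)
  then have "(u + 5) * (24 * ballot u 4) = (u + 5) * ((u + 1) * (u + 6) * (u + 7) * (u + 8))"
    unfolding ballot_3 by (simp only: ac_simps)
  then show ?thesis by simp
qed

text \<open>By \<open>ballot_ratio\<close> the second hypothesis says that passing from
  \<open>s\<close> to \<open>s + 1\<close> multiplies \<open>ballot u s\<close> by at most
  \<open>w\<close>, so a constant checked at \<open>m\<close> persists.\<close>

lemma ballot_induct_le:
  assumes base: "c * ballot u m \<le> d * w ^ m"
    and step: "\<And>s. m \<le> s \<Longrightarrow> (u + 2 * s + 1) * (u + 2 * s + 2) \<le> w * ((s + 1) * (u + s + 2))"
    and "m \<le> s"
  shows "c * ballot u s \<le> d * w ^ s"
  using assms(3)
proof (induction s rule: dec_induct)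
  case base
  show ?case by fact
next
  case (step s)
  let ?z = "(s + 1) * (u + s + 2)"
  have "?z * (c * ballot u (Suc s)) = (u + 2 * s + 1) * (u + 2 * s + 2) * (c * ballot u s)"
    using ballot_ratio[of s u] by (simp only: ac_simps)
  also have "\<dots> \<le> (w * ?z) * (d * w ^ s)"
    by (rule mult_le_mono[OF assms(2)[OF step.hyps(1)] step.IH])
  also have "\<dots> = ?z * (d * w ^ Suc s)" by (simp only: power_Suc ac_simps)
  finally have "?z * (c * ballot u (Suc s)) \<le> ?z * (d * w ^ Suc s)" .
  moreover have "0 < ?z" by simp
  ultimately show ?case by (simp only: mult_le_cancel1)
qed

context
  fixes t :: nat
  assumes t_ge: "14 \<le> t"
begin

text \<open>The constant is decided at \<open>s = 2\<close>: for \<open>t = 14\<close> the quotient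
  by \<open>(t + 1) ^ 2\<close> is 464/225, just under 21/10.\<close>

lemma ballot_upper_2t: "10 * ballot (2 * t) s \<le> 21 * (t + 1) ^ s"
proof -
  consider "s = 0" | "s = 1" | "2 \<le> s" by linarith
  then show ?thesis
  proof cases
    case 2
    then show ?thesis using ballot_1[of "2 * t"] by simp
  next
    case 3
    obtain a where a: "t = 14 + a" using t_ge le_Suc_ex by blast
    have "20 * ballot (2 * t) 2 \<le> 42 * (t + 1) ^ 2"
      using ballot_2[of "2 * t"] unfolding a by (simp add: power2_eq_square algebra_simps)
    then have base: "10 * ballot (2 * t) 2 \<le> 21 * (t + 1) ^ 2" by simp
    show ?thesis
    proof (rule ballot_induct_le[OF base _ 3])
      fix s :: nat assume "2 \<le> s"
      then obtain b where b: "s = 2 + b" using le_Suc_ex by blast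
      show "(2 * t + 2 * s + 1) * (2 * t + 2 * s + 2) \<le> (t + 1) * ((s + 1) * (2 * t + s + 2))"
        unfolding a b by (simp add: algebra_simps)
    qed
  qed simp
qed

lemma ballot_upper_t:
  assumes "4 \<le> s" "v \<le> t"
  shows "100 * ballot v s \<le> 16 * t ^ s"
proof -
  obtain a where a: "t = 14 + a" using t_ge le_Suc_ex by blast
  \<comment> \<open>For \<open>t \<ge> 14\<close> each factor t + c is at most (14 + c) / 14 times
    t, with equality at \<open>t = 14\<close>.\<close>
  have "(14 * (t + 1)) * (14 * (t + 6)) * (14 * (t + 7)) * (14 * (t + 8))
      \<le> (15 * t) * (20 * t) * (21 * t) * (22 * t)"
    by (rule mult_le_mono[OF mult_le_mono[OF mult_le_mono]]) (use t_ge in simp_all)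
  moreover have "(14 * A) * (14 * B) * (14 * C) * (14 * D) = 38416 * (A * B * C * D)" for A B C D :: nat
    by simp
  moreover have "(15 * t) * (20 * t) * (21 * t) * (22 * t) = 138600 * t ^ 4"
    by (simp add: power4_eq_xxxx)
  ultimately have "38416 * (24 * ballot t 4) \<le> 138600 * t ^ 4"
    unfolding ballot_4 by (simp only:)
  then have base: "100 * ballot t 4 \<le> 16 * t ^ 4" by linarith
  have "100 * ballot t s \<le> 16 * t ^ s"
  proof (rule ballot_induct_le[OF base _ assms(1)])
    fix s :: nat assume "4 \<le> s"
    then obtain b where b: "s = 4 + b" using le_Suc_ex by blast
    show "(t + 2 * s + 1) * (t + 2 * s + 2) \<le> t * ((s + 1) * (t + s + 2))"
      unfolding a b by (simp add: algebra_simps)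
  qed
  then show ?thesis using ballot_mono[OF assms(2), of s] by linarith
qed

lemma ballot_upper_3:
  assumes "v \<le> t"
  shows "100 * ballot v 3 \<le> 35 * t ^ 3"
proof -
  have "(14 * (t + 1)) * (14 * (t + 5)) * (14 * (t + 6)) \<le> (15 * t) * (19 * t) * (20 * t)"
    by (rule mult_le_mono[OF mult_le_mono]) (use t_ge in simp_all)
  moreover have "(14 * A) * (14 * B) * (14 * C) = 2744 * (A * B * C)" for A B C :: nat
    by simp
  moreover have "(15 * t) * (19 * t) * (20 * t) = 5700 * t ^ 3"
    by (simp add: power3_eq_cube)
  ultimately have "2744 * (6 * ballot t 3) \<le> 5700 * t ^ 3"
    unfolding ballot_3 by (simp only:)
  then show ?thesis using ballot_mono[OF assms, of 3] by linarith
qed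

text \<open>The factor \<open>272 / 1400\<close> bounds \<open>(1 + 1 / t) ^ t / t\<close>.\<close>

lemma ballot_numeric:
  assumes "2 \<le> s + d" "d \<le> t"
  shows "\<exists>x y z :: real. 0 \<le> x \<and> 0 \<le> y \<and> 0 \<le> z \<and>
    ballot (t + d) s \<le> x * (real t + 1) ^ s \<and>
    ballot (t - d) (s + d) \<le> y * (real t + 1) ^ (s + d) \<and>
    ballot (t - d) (s + d) \<le> z * real t ^ (s + d) \<and>
    x * y + (15 / 14 * x + z) * (272 / 1400) + (272 / 1400)\<^sup>2 < 1"
proof -
  obtain a where a: "t = 14 + a" using t_ge le_Suc_ex by blast
  have bx: "ballot u s \<le> real c / real e * (real t + 1) ^ s" if "e * ballot u s \<le> c * (t + 1) ^ s" "0 < e"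
    for u s c e
  proof -
    have "real e * real (ballot u s) \<le> real c * (real t + 1) ^ s"
      using that(1) of_nat_mono[of "e * ballot u s" "c * (t + 1) ^ s", where 'a = real]
      by (simp add: add.commute)
    then show ?thesis using that(2) by (simp add: field_simps)
  qed
  have bz: "ballot u s \<le> real c / real e * real t ^ s" if "e * ballot u s \<le> c * t ^ s" "0 < e"
    for u s c e
  proof -
    have "real e * real (ballot u s) \<le> real c * real t ^ s"
      using that(1) of_nat_mono[of "e * ballot u s" "c * t ^ s", where 'a = real] by simp
    then show ?thesis using that(2) by (simp add: field_simps)
  qed
  have weaken: "e * ballot u s \<le> c * (t + 1) ^ s" if "e * ballot u s \<le> c * t ^ s" for u s c e
    using that power_mono[of t "t + 1" s] mult_le_mono2 by (meson le_add1 le_trans zero_le)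
  have ex: ?thesis if "0 \<le> x" "0 \<le> y" "0 \<le> z"
    "ballot (t + d) s \<le> x * (real t + 1) ^ s"
    "ballot (t - d) (s + d) \<le> y * (real t + 1) ^ (s + d)"
    "ballot (t - d) (s + d) \<le> z * real t ^ (s + d)"
    "x * y + (15 / 14 * x + z) * (272 / 1400) + (272 / 1400)\<^sup>2 < 1" for x y z :: real
    using that by blast
  \<comment> \<open>\<open>x\<close> measures the ballot number of the higher level,
    \<open>y\<close> and \<open>z\<close> that of the lower one. From \<open>s + d = 4\<close> on
    crude constants suffice; with fewer down-steps the quotients are larger and need individual
    constants.\<close>
  consider "4 \<le> s + d" | "s + d = 3" | "s = 0" "d = 2" | "s = 1" "d = 1" | "s = 2" "d = 0"
    using assms(1) by linarith
  then show ?thesis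
  proof cases
    case 1
    have "10 * ballot (t + d) s \<le> 21 * (t + 1) ^ s"
      using ballot_upper_2t[of s] ballot_mono[of "t + d" "2 * t" s] assms(2) by linarith
    note x = bx[OF this]
    have z: "100 * ballot (t - d) (s + d) \<le> 16 * t ^ (s + d)"
      using 1 by (intro ballot_upper_t) simp_all
    show ?thesis
      by (rule ex[of "21 / 10" "16 / 100" "16 / 100"]) (use x bx[OF weaken[OF z]] bz[OF z] in \<open>simp_all add: numeral_2_eq_2\<close>)
  next
    case 2
    have "100 * ballot (t + d) s \<le> 125 * (t + 1) ^ s"
    proof -
      consider "s = 0" | "s = 1" "d = 2" | "s = 2" "d = 1" | "s = 3" "d = 0" using 2 by linarith
      then show ?thesis
      proof cases
        case 2
        then show ?thesis using ballot_1[of "t + d"] t_ge by simp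
      next
        case 3
        have "200 * ballot (t + 1) 2 = 100 * (2 * ballot (t + 1) 2)" by simp
        also have "\<dots> = 100 * ((t + 2) * (t + 5))" unfolding ballot_2 by simp
        also have "\<dots> \<le> 250 * (t + 1) ^ 2"
          unfolding a by (simp add: power2_eq_square algebra_simps)
        finally show ?thesis using 3 by simp
      next
        case 4
        then show ?thesis using weaken[OF ballot_upper_3[of t]] by simp
      qed simp
    qed
    note x = bx[OF this]
    have z: "100 * ballot (t - d) (s + d) \<le> 35 * t ^ (s + d)"
      unfolding 2 by (intro ballot_upper_3) simp
    show ?thesis
      by (rule ex[of "125 / 100" "35 / 100" "35 / 100"]) (use x bx[OF weaken[OF z]] bz[OF z] in \<open>simp_all add: numeral_2_eq_2\<close>)
  next
    case 3
    have u: "t - 2 + 1 = 13 + a" "t - 2 + 4 = 16 + a" unfolding a by simp_all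
    have "2 * ballot (t - 2) 2 \<le> 1 * (t + 1) ^ 2"
      unfolding ballot_2 u unfolding a by (simp add: power2_eq_square algebra_simps)
    note y = bx[OF this]
    have "50 * (2 * ballot (t - 2) 2) \<le> 54 * t ^ 2"
      unfolding ballot_2 u unfolding a by (simp add: power2_eq_square algebra_simps)
    then have "100 * ballot (t - 2) 2 \<le> 54 * t ^ 2" by simp
    note z = bz[OF this]
    show ?thesis
      by (rule ex[of "1" "1 / 2" "54 / 100"]) (use 3 y z in \<open>simp_all add: numeral_2_eq_2\<close>)
  next
    \<comment> \<open>The tightest case: the four terms add up to about 0.944.\<close>
    case 4
    have "15 * ballot (t + 1) 1 \<le> 16 * (t + 1) ^ 1" using ballot_1[of "t + 1"] t_ge by simp
    note x = bx[OF this]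
    have u: "t - 1 + 1 = 14 + a" "t - 1 + 4 = 17 + a" unfolding a by simp_all
    have "50 * (2 * ballot (t - 1) 2) \<le> 53 * (t + 1) ^ 2"
      unfolding ballot_2 u unfolding a by (simp add: power2_eq_square algebra_simps)
    then have "100 * ballot (t - 1) 2 \<le> 53 * (t + 1) ^ 2" by simp
    note y = bx[OF this]
    have "50 * (2 * ballot (t - 1) 2) \<le> 61 * t ^ 2"
      unfolding ballot_2 u unfolding a by (simp add: power2_eq_square algebra_simps)
    then have "100 * ballot (t - 1) 2 \<le> 61 * t ^ 2" by simp
    note z = bz[OF this]
    show ?thesis
      by (rule ex[of "16 / 15" "53 / 100" "61 / 100"]) (use 4 x y z in \<open>simp_all add: numeral_2_eq_2\<close>)
  next
    case 5
    have "50 * (2 * ballot t 2) \<le> 60 * (t + 1) ^ 2"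
      unfolding ballot_2 unfolding a by (simp add: power2_eq_square algebra_simps)
    then have "100 * ballot t 2 \<le> 60 * (t + 1) ^ 2" by simp
    note y = bx[OF this]
    have "50 * (2 * ballot t 2) \<le> 70 * t ^ 2"
      unfolding ballot_2 unfolding a by (simp add: power2_eq_square algebra_simps)
    then have "100 * ballot t 2 \<le> 70 * t ^ 2" by simp
    note z = bz[OF this]
    show ?thesis
      by (rule ex[of "60 / 100" "60 / 100" "70 / 100"]) (use 5 y z in \<open>simp_all add: numeral_2_eq_2\<close>)
  qed
qed

end

section \<open>Products of ballot bounds\<close>

context large_ground_set
begin

text \<open>Of the \<open>d - e\<close> points by which the upper indices differ, \<open>a\<close>
  serve diagonal steps that gain \<open>t + 1\<close> each; the others only shrink the
  binomial.\<close>

lemma choose_shifted_le: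
  assumes "a \<le> M" "a \<le> d" "M \<le> K" "d + t \<le> n" "(t + 1) * M + t + e \<le> n" "e + a \<le> d"
  shows "(t + 1) ^ a * ((n - (t + d)) choose (M - a)) \<le> (n - (t + e)) choose M"
proof -
  have "(t + 1) ^ a * ((n - (t + d)) choose (M - a)) \<le> (t + 1) ^ a * ((n - (t + e) - a) choose (M - a))"
    using assms by (intro mult_le_mono2 binomial_right_mono) linarith
  also have "\<dots> \<le> (n - (t + e) - a + a) choose (M - a + a)"
  proof (rule binomial_diagonal_le)
    have "M - a + a = M" using assms by simp
    then show "(t + 1) * (M - a + a) \<le> n - (t + e) - a + a" using assms(5) by simp
  qed
  also have "n - (t + e) - a + a = n - (t + e)" using assms by linarith
  also have "M - a + a = M" using assms by simp
  finally show ?thesis .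
qed

text \<open>The quotient of the products for \<open>d + 1\<close> and \<open>d\<close> is (K - d) (n
  - K - d + 1) / ((n - t - d) (K + d)). It is at most 1 for \<open>d \<ge> 1\<close>, and only the
  passage from 0 to 1 can exceed 1, by a factor of at most (t + 1) / t. This is the 15/14 in
  \<open>ballot_numeric\<close>.\<close>

lemma choose_exchange_le:
  assumes "1 \<le> K" "d \<le> K"
  shows "t * (((n - (t + d)) choose (K - d)) * (n choose (K + d - 1)))
    \<le> (t + 1) * (((n - t) choose K) * (n choose (K - 1)))"
  using assms(2)
proof (induction d)
  case (Suc d)
  define p q where "p = (n - (t + d)) choose (K - d)" "q = n choose (K + d - 1)"
  define p' q' where "p' = (n - (t + Suc d)) choose (K - Suc d)" "q' = n choose (K + d)"
  have "(K - d) * ((n - (t + d)) choose (K - d)) = (n - (t + d)) * ((n - (t + d) - 1) choose (K - d - 1))"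
    using Suc.prems by (intro times_binomial_minus1_eq) simp
  then have eq1: "(n - (t + d)) * p' = (K - d) * p"
    by (simp add: p_q_def p'_q'_def)
  have "Suc (K + d - 1) * (n choose Suc (K + d - 1)) = (n - (K + d - 1)) * q"
    unfolding p_q_def by (rule binomial_ratio_lower)
  then have eq2: "(K + d) * q' = (n - (K + d - 1)) * q"
    using assms(1) by (simp add: p'_q'_def)
  have eq: "((n - (t + d)) * (K + d)) * (p' * q') = ((K - d) * (n - (K + d - 1))) * (p * q)"
  proof -
    have "((n - (t + d)) * (K + d)) * (p' * q') = ((n - (t + d)) * p') * ((K + d) * q')"
      by (simp only: ac_simps)
    then show ?thesis unfolding eq1 eq2 by (simp only: ac_simps)
  qed
  have nt: "0 < n - (t + d)" using tK tt t_ge Suc.prems by linarith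
  have pos: "0 < (n - (t + d)) * (K + d)" using nt assms(1) by simp
  show ?case
  proof (cases "d = 0")
    case True
    have "t * (n - (K - 1)) \<le> (t + 1) * (n - t)"
    proof -
      have "t * (n - (K - 1)) \<le> t * n" by simp
      moreover have "(t + 1) * (n - t) = t * n + n - (t * t + t)"
        by (simp add: diff_mult_distrib2 algebra_simps)
      moreover have "t * t + t \<le> n" using tK by linarith
      ultimately show ?thesis by linarith
    qed
    then have "(t * (n - (K - 1))) * (K * (p * q)) \<le> ((t + 1) * (n - t)) * (K * (p * q))"
      by (rule mult_le_mono1)
    moreover have "((n - t) * K) * (p' * q') = (K * (n - (K - 1))) * (p * q)"
      using eq unfolding True by (simp only: add_0_right diff_zero)
    then have "((n - t) * K) * (t * (p' * q')) = (t * (n - (K - 1))) * (K * (p * q))"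
      by (simp only: mult.left_commute[of "(n - t) * K" t]) (simp only: ac_simps)
    moreover have "((n - t) * K) * ((t + 1) * (p * q)) = ((t + 1) * (n - t)) * (K * (p * q))"
      by (simp only: ac_simps)
    ultimately have "((n - t) * K) * (t * (p' * q')) \<le> ((n - t) * K) * ((t + 1) * (p * q))"
      by (simp only:)
    moreover have "0 < (n - t) * K" using pos True by simp
    ultimately have "t * (p' * q') \<le> (t + 1) * (p * q)"
      by (simp only: mult_le_cancel1)
    then show ?thesis using True by (simp add: p_q_def p'_q'_def)
  next
    case False
    have "(K - d) * (n - (K + d - 1)) \<le> (n - (t + d)) * (K + d)"
    proof (cases "t + 1 \<le> K")
      case True
      then show ?thesis by (subst mult.commute) (intro mult_le_mono, simp_all)
    next
      case False
      have "n - (K + d - 1) \<le> (n - (t + d)) + t" using assms(1) by simp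
      then have "(K - d) * (n - (K + d - 1)) \<le> (K - d) * ((n - (t + d)) + t)" by (rule mult_le_mono2)
      also have "\<dots> = (K - d) * (n - (t + d)) + (K - d) * t" by (rule add_mult_distrib2)
      also have "(K - d) * t \<le> K * t" by simp
      also have "K * t \<le> 1 * (n - (t + d))" using tK tt t_ge Suc.prems by (simp add: mult.commute)
      also have "(K - d) * (n - (t + d)) + 1 * (n - (t + d)) = (K - d + 1) * (n - (t + d))"
        by (rule add_mult_distrib[symmetric])
      also have "\<dots> \<le> (K + d) * (n - (t + d))" using \<open>d \<noteq> 0\<close> by (intro mult_le_mono1) simp
      finally show ?thesis by (simp add: mult.commute)
    qed
    then have "((n - (t + d)) * (K + d)) * (p' * q') \<le> ((n - (t + d)) * (K + d)) * (p * q)"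
      unfolding eq by (rule mult_le_mono1)
    then have "p' * q' \<le> p * q" using pos by (simp only: mult_le_cancel1)
    then have "t * (p' * q') \<le> t * (p * q)" by simp
    also have "\<dots> \<le> (t + 1) * (((n - t) choose K) * (n choose (K - 1)))"
      using Suc by (simp add: p_q_def)
    finally show ?thesis by (simp add: p'_q'_def)
  qed
qed simp

text \<open>The four terms of the expanded product correspond to the four terms of
  \<open>ballot_numeric\<close>. In the main term the diagonal steps supply \<open>s + d\<close> and
  \<open>s\<close> factors \<open>t + 1\<close>, while the ballot numbers are of orders
  \<open>s\<close> and \<open>s + d\<close>: they match only crosswise, so the product is under
  control but not each family alone.\<close>

lemma ballot_product_less:
  assumes "2 \<le> s + d" "d \<le> t" "s + d \<le> K"
  shows "real ((ballot (t + d) s * ((n - (t + (2 * s + d))) choose (K - (s + d))) +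
      (if d + 1 \<le> K then n choose (K - (d + 1)) else 0)) *
    (ballot (t - d) (s + d) * ((n - (t + (2 * s + d))) choose (K - s)) + (n choose (K + d - 1)))) < S\<^sup>2"
proof -
  have K: "1 \<le> K" using assms by simp
  have t0: "0 < real t" using t_ge by simp
  obtain x y z :: real where xyz: "0 \<le> x" "0 \<le> y" "0 \<le> z"
    "ballot (t + d) s \<le> x * (real t + 1) ^ s"
    "ballot (t - d) (s + d) \<le> y * (real t + 1) ^ (s + d)"
    "ballot (t - d) (s + d) \<le> z * real t ^ (s + d)"
    and num: "x * y + (15 / 14 * x + z) * (272 / 1400) + (272 / 1400)\<^sup>2 < 1"
    using ballot_numeric[OF t_ge assms(1,2)] by blast
  define bA bB where "bA = real (ballot (t + d) s)" "bB = real (ballot (t - d) (s + d))"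
  define cA cB where "cA = real ((n - (t + (2 * s + d))) choose (K - (s + d)))"
    "cB = real ((n - (t + (2 * s + d))) choose (K - s))"
  define gA gB where "gA = real (if d + 1 \<le> K then n choose (K - (d + 1)) else 0)"
    "gB = real (n choose (K + d - 1))"
  define w where "w = real t + 1"
  have w: "0 < w" using t0 by (simp add: w_def)
  have nonneg: "0 \<le> bA" "0 \<le> bB" "0 \<le> cA" "0 \<le> cB" "0 \<le> gA" "0 \<le> gB"
    by (simp_all add: bA_bB_def cA_cB_def gA_gB_def)
  have real_le: "real A * real B \<le> real C" if "A * B \<le> C" for A B C :: nat
    using that by (metis of_nat_le_iff of_nat_mult)
  have "14 * K \<le> t * K" using t_ge by simp
  then have nK: "2 * s + d + t \<le> n" "(t + 1) * K + t \<le> n"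
    using tK assms by (linarith, simp)
  have "(t + 1) ^ (s + d) * ((n - (t + (2 * s + d))) choose (K - (s + d))) \<le> (n - (t + 0)) choose K"
    using assms nK by (intro choose_shifted_le) simp_all
  from real_le[OF this] have cA: "w ^ (s + d) * cA \<le> S"
    by (simp add: cA_cB_def w_def S_def add.commute)
  have "(t + 1) ^ s * ((n - (t + (2 * s + d))) choose (K - s)) \<le> (n - (t + 0)) choose K"
    using assms nK by (intro choose_shifted_le) simp_all
  from real_le[OF this] have cB: "w ^ s * cB \<le> S"
    by (simp add: cA_cB_def w_def S_def add.commute)
  \<comment> \<open>\<open>E\<close> bounds \<open>n choose (K - 1)\<close>, the number of walks
    that exceed level \<open>t\<close>.\<close>
  define E where "E = 272 / 100 * S / real t"
  have E: "E \<le> 272 / 1400 * S" "0 < E"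
    using t_ge S_pos by (simp_all add: E_def field_simps)
  have gA: "gA * real t ^ d \<le> E"
  proof (cases "d + 1 \<le> K")
    case True
    have "gA \<le> (1 / real t) ^ (d + 1) * real (n choose K)"
      using choose_lower_le[OF True] True by (simp add: gA_gB_def)
    also have "\<dots> \<le> (1 / real t) ^ (d + 1) * (272 / 100 * S)"
      using choose_K_less by (intro mult_left_mono) simp_all
    finally have "gA * real t ^ d \<le> (1 / real t) ^ (d + 1) * (272 / 100 * S) * real t ^ d"
      by (intro mult_right_mono) simp_all
    also have "\<dots> = E" using t0 by (simp add: E_def field_simps)
    finally show ?thesis .
  qed (use E in \<open>simp add: gA_gB_def\<close>)
  have g1: "real (n choose (K - 1)) \<le> E"
    using choose_lower_le[OF K] choose_K_less t0 by (simp add: E_def field_simps)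
  have gAB: "gA * gB \<le> E\<^sup>2"
  proof (cases "d + 1 \<le> K")
    case True
    have "(n choose (K - (d + 1))) * (n choose (K + d - 1)) \<le> (n choose (K - 1))\<^sup>2"
      using True by (intro binomial_log_concave_sum) simp
    then have "gA * gB \<le> (real (n choose (K - 1)))\<^sup>2"
      using True real_le[of "n choose (K - (d + 1))" "n choose (K + d - 1)" "(n choose (K - 1))\<^sup>2"]
      by (simp add: gA_gB_def)
    also have "\<dots> \<le> E\<^sup>2" using g1 by (intro power_mono) simp_all
    finally show ?thesis .
  qed (simp add: gA_gB_def)
  have ba: "bA * cA \<le> x * w ^ s * cA" using xyz(4) nonneg by (intro mult_right_mono) (simp_all add: bA_bB_def w_def)
  have bb: "bB * cB \<le> y * w ^ (s + d) * cB"
    using xyz(5) nonneg by (intro mult_right_mono) (simp_all add: bA_bB_def w_def)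
  have "(bA * cA) * (bB * cB) \<le> (x * w ^ s * cA) * (y * w ^ (s + d) * cB)"
    by (rule mult_mono[OF ba bb]) (use nonneg xyz w in simp_all)
  also have "\<dots> = x * y * ((w ^ (s + d) * cA) * (w ^ s * cB))" by (simp only: ac_simps)
  also have "\<dots> \<le> x * y * (S * S)"
    using cA cB xyz nonneg w S_pos by (intro mult_left_mono mult_mono) simp_all
  finally have p1: "(bA * cA) * (bB * cB) \<le> x * y * S\<^sup>2" by (simp add: power2_eq_square)
  \<comment> \<open>For large \<open>d\<close> the factor \<open>gB\<close> alone can be far larger
    than \<open>S\<close>. It is paired with the \<open>d\<close> shifts that \<open>bA\<close> has
    left over, which is the product treated by \<open>choose_exchange_le\<close>.\<close>
  have p2: "(bA * cA) * gB \<le> 15 / 14 * x * (272 / 1400) * S\<^sup>2"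
  proof -
    define m where "m = real ((n - (t + d)) choose (K - d))"
    have "K - d - s = K - (s + d)" by simp
    have "(t + 1) ^ s * ((n - (t + (2 * s + d))) choose (K - d - s)) \<le> (n - (t + d)) choose (K - d)"
    proof (rule choose_shifted_le)
      have "(t + 1) * (K - d) + (t + 1) * d = (t + 1) * K"
        using assms(3) by (simp flip: distrib_left)
      moreover have "d \<le> (t + 1) * d" by simp
      ultimately show "(t + 1) * (K - d) + t + d \<le> n" using nK(2) by linarith
    qed (use assms nK in simp_all)
    from real_le[OF this[unfolded \<open>K - d - s = K - (s + d)\<close>]] have m: "w ^ s * cA \<le> m"
      by (simp add: cA_cB_def w_def m_def add.commute)
    have "t * (((n - (t + d)) choose (K - d)) * (n choose (K + d - 1)))
        \<le> (t + 1) * (((n - t) choose K) * (n choose (K - 1)))"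
      using assms(3) by (intro choose_exchange_le K) simp
    from of_nat_mono[OF this, where 'a = real]
    have "real t * (m * gB) \<le> w * (S * real (n choose (K - 1)))"
      by (simp add: m_def gA_gB_def w_def S_def algebra_simps)
    also have "\<dots> \<le> w * (S * E)" using g1 w S_pos by (intro mult_left_mono) simp_all
    finally have "real t * (m * gB) \<le> w * (S * E)" .
    also have "\<dots> \<le> 15 / 14 * real t * (S * (272 / 1400 * S))"
      using E S_pos t_ge w by (intro mult_mono) (simp_all add: w_def)
    finally have "real t * (m * gB) \<le> real t * (15 / 14 * (S * (272 / 1400 * S)))" by (simp only: ac_simps)
    then have mg: "m * gB \<le> 15 / 14 * (S * (272 / 1400 * S))" using t0 by (simp only: mult_le_cancel_left_pos)
    have "(bA * cA) * gB \<le> x * w ^ s * cA * gB"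
      using xyz(4) nonneg by (intro mult_right_mono) (simp_all add: bA_bB_def w_def)
    also have "\<dots> = x * ((w ^ s * cA) * gB)" by (simp only: ac_simps)
    also have "\<dots> \<le> x * (m * gB)" using m xyz nonneg by (intro mult_left_mono mult_right_mono)
    also have "\<dots> \<le> x * (15 / 14 * (S * (272 / 1400 * S)))" using mg xyz by (intro mult_left_mono)
    finally show ?thesis by (simp add: power2_eq_square)
  qed
  \<comment> \<open>The \<open>d\<close> spare factors of \<open>gA\<close> are powers of
    \<open>t\<close> and have to help cover a ballot number of order \<open>s + d\<close>; hence the
    separate constant \<open>z\<close>.\<close>
  have p3: "gA * (bB * cB) \<le> z * (272 / 1400) * S\<^sup>2"
  proof -
    have "real t ^ s \<le> w ^ s" using t0 by (intro power_mono) (simp_all add: w_def)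
    then have "real t ^ s * cB \<le> w ^ s * cB" using nonneg by (intro mult_right_mono)
    then have c: "real t ^ s * cB \<le> S" using cB by linarith
    have "gA * (bB * cB) \<le> gA * (z * real t ^ (s + d) * cB)"
      using xyz(6) nonneg by (intro mult_left_mono mult_right_mono) (simp_all add: bA_bB_def)
    also have "\<dots> = z * ((gA * real t ^ d) * (real t ^ s * cB))" by (simp only: power_add ac_simps)
    also have "\<dots> \<le> z * (E * S)"
      using gA c xyz nonneg t0 E by (intro mult_left_mono mult_mono) simp_all
    also have "\<dots> \<le> z * (272 / 1400 * S * S)"
      using E xyz S_pos by (intro mult_left_mono mult_right_mono) simp_all
    finally show ?thesis by (simp add: power2_eq_square)
  qed
  have p4: "gA * gB \<le> (272 / 1400)\<^sup>2 * S\<^sup>2"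
  proof -
    have "E\<^sup>2 \<le> (272 / 1400 * S)\<^sup>2" using E by (intro power_mono) simp_all
    then show ?thesis using gAB by (simp only: power_mult_distrib)
  qed
  have "(bA * cA + gA) * (bB * cB + gB) = (bA * cA) * (bB * cB) + (bA * cA) * gB + gA * (bB * cB) + gA * gB"
    by (simp add: algebra_simps)
  also have "\<dots> \<le> x * y * S\<^sup>2 + 15 / 14 * x * (272 / 1400) * S\<^sup>2 + z * (272 / 1400) * S\<^sup>2
      + (272 / 1400)\<^sup>2 * S\<^sup>2"
    by (intro add_mono p1 p2 p3 p4)
  also have "\<dots> = (x * y + (15 / 14 * x + z) * (272 / 1400) + (272 / 1400)\<^sup>2) * S\<^sup>2"
    by (simp only: distrib_right)
  also have "\<dots> < 1 * S\<^sup>2" using num S_pos by (intro mult_strict_right_mono) simp_all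
  finally show ?thesis by (simp add: bA_bB_def cA_cB_def gA_gB_def)
qed

end

section \<open>Walks of cross-intersecting families\<close>

context large_ground_set
begin

text \<open>In terms of counts: \<open>m + t \<le> card (A \<inter> {1..m}) + card (B \<inter>
  {1..m})\<close> for some time \<open>m\<close>. This is all that the walk argument retains of
  cross-intersection.\<close>

definition meets :: "nat set set \<Rightarrow> nat set set \<Rightarrow> bool" where
  "meets \<A> \<B> \<longleftrightarrow> (\<forall>A\<in>\<A>. \<forall>B\<in>\<B>. \<exists>j\<le>n. 2 * int t \<le> height 0 A j + height 0 B j)"

definition hits :: "nat \<Rightarrow> nat set \<Rightarrow> bool" where
  "hits u F \<longleftrightarrow> (\<exists>j\<le>n. int u \<le> height 0 F j)"

definition core :: "nat \<Rightarrow> nat \<Rightarrow> nat set set" where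
  "core J u = {F \<in> nsets {0<..n} (K + t). int u \<le> height 0 F J}"

lemma meets_commute: "meets \<A> \<B> \<Longrightarrow> meets \<B> \<A>"
  unfolding meets_def by (metis add.commute)

lemma card_hits_le:
  assumes "\<A> \<subseteq> nsets {0<..n} k" "\<And>A. A \<in> \<A> \<Longrightarrow> hits u A"
  shows "card \<A> \<le> (if u \<le> k then n choose (k - u) else 0)"
proof -
  have "\<A> \<subseteq> {F \<in> nsets {0<..0 + n} k. \<exists>j\<in>{0..0 + n}. int u \<le> height 0 F j}"
  proof
    fix A assume "A \<in> \<A>"
    moreover from this obtain j where "j \<le> n" "int u \<le> height 0 A j"
      using assms(2) unfolding hits_def by blast
    moreover have "j \<in> {0..0 + n}" using \<open>j \<le> n\<close> by simp
    ultimately show "A \<in> {F \<in> nsets {0<..0 + n} k. \<exists>j\<in>{0..0 + n}. int u \<le> height 0 F j}"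
      using assms(1) by auto
  qed
  then have "card \<A> \<le> card {F \<in> nsets {0<..0 + n} k. \<exists>j\<in>{0..0 + n}. int u \<le> height 0 F j}"
    by (intro card_mono finite_nsets_filter) simp_all
  also have "\<dots> \<le> (if u \<le> k then n choose (k - u) else 0)" by (rule card_hit_le)
  finally show ?thesis .
qed

lemma hits_le_card: "F \<in> nsets {0<..n} k \<Longrightarrow> hits u F \<Longrightarrow> u \<le> k"
proof -
  assume "F \<in> nsets {0<..n} k" "hits u F"
  then obtain j where "finite F" "card F = k" "int u \<le> height 0 F j"
    by (auto simp: hits_def nsets_def)
  then show "u \<le> k" using height_le_card[of F 0 j] by simp
qed

lemma card_split_at:
  assumes "F \<in> nsets {0<..n} k"
  shows "card F = card (F \<inter> {0<..J}) + card (F \<inter> {J<..n})"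
proof -
  have F: "F \<subseteq> {0<..n}" "finite F" using assms by (auto simp: nsets_def)
  then have "card ((F \<inter> {0<..J}) \<union> (F \<inter> {J<..n})) = card (F \<inter> {0<..J}) + card (F \<inter> {J<..n})"
    by (intro card_Un_disjoint) auto
  moreover have "(F \<inter> {0<..J}) \<union> (F \<inter> {J<..n}) = F" using F by auto
  ultimately show ?thesis by simp
qed

lemma finite_family: "\<A> \<subseteq> nsets {0<..n} k \<Longrightarrow> finite \<A>"
  by (rule finite_subset[of _ "Pow {0<..n}"]) (auto simp: nsets_def)

text \<open>The walk \<open>F\<close> is the useful part: it never gets above \<open>u + r\<close>,
  so any walk that meets it must make up the difference, while the whole family can still be counted
  at level \<open>u + r\<close>.\<close>

lemma largest_hit:
  assumes "\<And>F. F \<in> \<C> \<Longrightarrow> hits u F" "\<not> (\<forall>F\<in>\<C>. hits w F)" 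
  obtains r F where "u + r < w" "\<And>F. F \<in> \<C> \<Longrightarrow> hits (u + r) F" "F \<in> \<C>" "\<not> hits (Suc (u + r)) F"
proof -
  have uw: "u < w"
  proof (rule ccontr)
    assume "\<not> u < w"
    then have "\<forall>F\<in>\<C>. hits w F" using assms(1) unfolding hits_def by (meson not_less of_nat_mono order_trans)
    then show False using assms(2) by blast
  qed
  define P where "P i \<longleftrightarrow> \<not> (\<forall>F\<in>\<C>. hits (u + i) F)" for i
  have "P (w - u)" using assms(2) uw by (simp add: P_def)
  then obtain i where i: "i \<le> w - u" "\<forall>l<i. \<not> P l" "P i" using ex_least_nat_le by blast
  have "i \<noteq> 0"
  proof
    assume "i = 0"
    then show False using i(3) assms(1) by (simp add: P_def)
  qed
  then obtain r where r: "i = Suc r" by (cases i) auto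
  obtain F where F: "F \<in> \<C>" "\<not> hits (Suc (u + r)) F" using i(3) r by (auto simp: P_def)
  moreover have "hits (u + r) G" if "G \<in> \<C>" for G using i(2) r that by (auto simp: P_def)
  moreover have "u + r < w" using i(1) r uw by linarith
  ultimately show ?thesis using that by blast
qed

lemma not_hits_Suc: "\<not> hits (Suc u) F \<Longrightarrow> j \<le> n \<Longrightarrow> height 0 F j \<le> int u"
  unfolding hits_def by (metis int_ops(4) not_le zless_imp_add1_zle)

lemma hits_0: "hits 0 F"
  unfolding hits_def by (rule exI[of _ 0]) simp

text \<open>Take for \<open>u\<close> the highest level below \<open>2 * t\<close> that all of \<A>
  reaches. Some walk of \<A> gets no higher and forces every walk of \<B> up to
  \<open>2 * t - u\<close>. If all of \<A> reaches \<open>2 * t\<close>, level 0 is left for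
  \<B>.\<close>

lemma levels:
  assumes "meets \<A> \<B>"
  obtains u v where "u + v = 2 * t" "\<And>A. A \<in> \<A> \<Longrightarrow> hits u A" "\<And>B. B \<in> \<B> \<Longrightarrow> hits v B"
proof (cases "\<forall>A\<in>\<A>. hits (2 * t) A")
  case True
  then show ?thesis using that[of "2 * t" 0] hits_0 by simp
next
  case False
  obtain r A where r: "0 + r < 2 * t" "\<And>F. F \<in> \<A> \<Longrightarrow> hits (0 + r) F"
    and A: "A \<in> \<A>" "\<not> hits (Suc (0 + r)) A"
    using largest_hit[OF hits_0 False] by blast
  have "hits (2 * t - r) B" if "B \<in> \<B>" for B
  proof -
    obtain j where j: "j \<le> n" "2 * int t \<le> height 0 A j + height 0 B j"
      using assms A(1) \<open>B \<in> \<B>\<close> unfolding meets_def by blast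
    then have "height 0 A j \<le> int r" using not_hits_Suc A(2) by simp
    then have "int (2 * t - r) \<le> height 0 B j" using j(2) r(1) by simp
    then show ?thesis using j(1) unfolding hits_def by blast
  qed
  then show ?thesis using that[of r "2 * t - r"] r by simp
qed

text \<open>A walk that is at \<open>u\<close> at time \<open>J = u + 2 * s\<close> and never
  exceeds \<open>u\<close> has made exactly \<open>u + s\<close> up-steps by then: a ballot path
  followed by an arbitrary remainder. The other walks reach \<open>u + 1\<close>.\<close>

lemma card_through_le:
  assumes \<A>: "\<A> \<subseteq> nsets {0<..n} k" and J: "J = u + 2 * s" "J \<le> n" "u + s \<le> k"
    and through: "\<And>A. A \<in> \<A> \<Longrightarrow> int u \<le> height 0 A J \<or> hits (Suc u) A"
  shows "card \<A> \<le> ballot u s * ((n - J) choose (k - (u + s))) +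
    (if Suc u \<le> k then n choose (k - Suc u) else 0)"
proof -
  define P where "P = {X \<in> nsets {0<..0 + (u + 2 * s)} (u + s).
    \<forall>j\<in>{0..0 + (u + 2 * s)}. height 0 X j \<le> int u}"
  define X where "X = {F \<in> nsets {0<..n} k. F \<inter> {0<..J} \<in> P \<and> F \<inter> {J<..n} \<in> nsets {J<..n} (k - (u + s))}"
  have "card X = card P * card (nsets {J<..n} (k - (u + s)))"
    unfolding X_def using J by (intro card_nsets_product[of J n "u + s"]) (auto simp: P_def)
  also have "\<dots> \<le> ballot u s * ((n - J) choose (k - (u + s)))"
    using card_not_exceeding_le[of 0 u s] by (simp add: P_def)
  finally have X: "card X \<le> ballot u s * ((n - J) choose (k - (u + s)))" .
  have sub: "\<A> \<subseteq> X \<union> {A \<in> \<A>. hits (Suc u) A}"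
  proof
    fix A assume A: "A \<in> \<A>"
    show "A \<in> X \<union> {A \<in> \<A>. hits (Suc u) A}"
    proof (cases "hits (Suc u) A")
      case False
      then have le: "height 0 A j \<le> int u" if "j \<le> n" for j
        using not_hits_Suc[OF False] that by simp
      have "int u \<le> height 0 A J" using through[OF A] False by blast
      then have eq: "height 0 A J = int u" using le[OF J(2)] by simp
      have An: "A \<subseteq> {0<..n}" "finite A" "card A = k" using A \<A> by (auto simp: nsets_def)
      have c1: "card (A \<inter> {0<..J}) = u + s" using eq J(1) by (simp add: height_def)
      have "k = card (A \<inter> {0<..J}) + card (A \<inter> {J<..n})"
        using card_split_at[of A k J] A \<A> An(3) by auto
      then have "card (A \<inter> {J<..n}) = k - (u + s)" using c1 by simp
      moreover have "A \<inter> {0<..J} \<in> P"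
      proof -
        have "height 0 (A \<inter> {0<..J}) j \<le> int u" if "j \<le> J" for j
          using le[of j] that J(2) height_Int[of 0 0 j J A] by simp
        then show ?thesis using c1 J(1) by (simp add: P_def nsets_def)
      qed
      ultimately have "A \<in> X" using A \<A> by (auto simp: X_def nsets_def)
      then show ?thesis by blast
    qed (use A in blast)
  qed
  have "finite X" unfolding X_def by (intro finite_nsets_filter) simp
  then have "card \<A> \<le> card (X \<union> {A \<in> \<A>. hits (Suc u) A})"
    using sub finite_family[OF \<A>] by (intro card_mono) auto
  also have "\<dots> \<le> card X + card {A \<in> \<A>. hits (Suc u) A}" by (rule card_Un_le)
  also have "card {A \<in> \<A>. hits (Suc u) A} \<le> (if Suc u \<le> k then n choose (k - Suc u) else 0)"
    using \<A> by (intro card_hits_le) auto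
  finally show ?thesis using X by linarith
qed

lemma card_core:
  assumes J: "J + u = 2 * l" "J \<le> n"
  shows "card (core J u) =
    (\<Sum>i\<in>{l..J}. (J choose i) * (if i \<le> K + t then (n - J) choose (K + t - i) else 0))"
proof -
  define X where "X i = {F \<in> nsets {0<..n} (K + t). F \<inter> {0<..J} \<in> nsets {0<..J} i \<and>
     F \<inter> {J<..n} \<in> {Y \<in> nsets {J<..n} (K + t - i). i \<le> K + t}}" for i
  have "core J u = (\<Union>i\<in>{l..J}. X i)"
  proof (intro equalityI subsetI)
    fix F assume F: "F \<in> core J u"
    then have Fn: "F \<in> nsets {0<..n} (K + t)" by (simp add: core_def)
    then have F': "F \<subseteq> {0<..n}" "finite F" "card F = K + t" by (auto simp: nsets_def)
    define i where "i = card (F \<inter> {0<..J})"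
    have "i \<le> J" using card_mono[of "{0<..J}" "F \<inter> {0<..J}"] by (simp add: i_def)
    moreover have "l \<le> i" using F J by (auto simp: core_def height_def i_def)
    moreover have "F \<in> X i" using Fn F' card_split_at[OF Fn, of J] by (auto simp: X_def nsets_def i_def)
    ultimately show "F \<in> (\<Union>i\<in>{l..J}. X i)" by auto
  next
    fix F assume "F \<in> (\<Union>i\<in>{l..J}. X i)"
    then show "F \<in> core J u" using J by (auto simp: core_def X_def height_def nsets_def)
  qed
  moreover have "card (\<Union>i\<in>{l..J}. X i) = (\<Sum>i\<in>{l..J}. card (X i))"
  proof (rule card_UN_disjoint)
    show "\<forall>i\<in>{l..J}. finite (X i)" unfolding X_def by (intro ballI finite_nsets_filter) simp
    show "\<forall>i\<in>{l..J}. \<forall>j\<in>{l..J}. i \<noteq> j \<longrightarrow> X i \<inter> X j = {}" by (auto simp: X_def nsets_def)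
  qed simp
  moreover have "card (X i) = (J choose i) * (if i \<le> K + t then (n - J) choose (K + t - i) else 0)" for i
  proof (cases "i \<le> K + t")
    case True
    then have "card (X i) = card (nsets {0<..J} i) * card {Y \<in> nsets {J<..n} (K + t - i). i \<le> K + t}"
      unfolding X_def using J by (intro card_nsets_product[of J n i "K + t - i"]) auto
    then show ?thesis using True by simp
  qed (simp add: X_def)
  ultimately show ?thesis by simp
qed

lemma finite_core: "finite (core J u)"
  unfolding core_def by (intro finite_nsets_filter) simp

text \<open>A walk \<open>b\<close> of \<open>\<B>\<close> outside the core that exceeds \<open>v\<close> by exactly \<open>r\<close> costs \<open>\<A>\<close> all the core
  walks that make their \<open>s\<close> down-steps up to time \<open>J\<close> within the first \<open>t\<close> steps, then go down
  \<open>r + 2\<close> times and afterwards never rise by \<open>2\<close>: none of them meets \<open>b\<close>.\<close>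

lemma excess_le:
  assumes \<A>: "\<A> \<subseteq> nsets {0<..n} (K + t)" and \<B>: "\<B> \<subseteq> nsets {0<..n} (K + t)"
    and meets: "meets \<A> \<B>"
    and J: "u + s = t + s'" "v + s' = t + s" "J = t + s + s'" "s \<le> 1" "s' \<le> 1" "s' \<le> K"
    and through: "\<And>B. B \<in> \<B> \<Longrightarrow> int v \<le> height 0 B J \<or> hits (Suc v) B"
    and trade: "\<And>r. 1 \<le> r \<Longrightarrow> v + r \<le> K + t \<Longrightarrow>
      real (n choose (K + t - (v + r))) * real (card (core J u))
        < real (t choose s) * tail (n - J) (K - s') r * real (card (core J v))"
  shows "real (card (\<B> - core J v)) * real (card (core J u))
      \<le> (real (card (core J u)) - real (card (\<A> \<inter> core J u))) * real (card (core J v))"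
    and "\<B> - core J v \<noteq> {} \<Longrightarrow> real (card (\<B> - core J v)) * real (card (core J u))
      < (real (card (core J u)) - real (card (\<A> \<inter> core J u))) * real (card (core J v))"
proof -
  let ?cA = "real (card (core J u))" and ?cB = "real (card (core J v))"
  have strict: "real (card (\<B> - core J v)) * ?cA < (?cA - real (card (\<A> \<inter> core J u))) * ?cB"
    if ne: "\<B> - core J v \<noteq> {}"
  proof -
    have sub: "\<B> - core J v \<subseteq> nsets {0<..n} (K + t)" using \<B> by blast
    have out: "height 0 B J < int v" if "B \<in> \<B> - core J v" for B
      using that \<B> by (auto simp: core_def)
    have hit1: "hits (Suc v) B" if "B \<in> \<B> - core J v" for B
      using that through out by force
    \<comment> \<open>A walk has only \<open>K + t\<close> up-steps, so the common level of the
      walks outside the core is bounded, and the walk \<open>b\<close> obtained from it has the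
      lowest peak among them.\<close>
    have "\<not> (\<forall>B\<in>\<B> - core J v. hits (Suc (K + t)) B)"
      using ne hits_le_card sub by fastforce
    from largest_hit[OF hit1 this] obtain r0 b where r0: "Suc v + r0 < Suc (K + t)"
      "\<And>B. B \<in> \<B> - core J v \<Longrightarrow> hits (Suc v + r0) B"
      and b: "b \<in> \<B> - core J v" "\<not> hits (Suc (Suc v + r0)) b" by blast
    define r where "r = Suc r0"
    have r: "1 \<le> r" "v + r \<le> K + t" using r0(1) by (auto simp: r_def)
    have hit: "hits (v + r) B" if "B \<in> \<B> - core J v" for B using r0(2)[OF that] by (simp add: r_def)
    have b_le: "height 0 b j \<le> int (v + r)" if "j \<le> n" for j
      using not_hits_Suc[OF b(2) that] by (simp add: r_def)
    have few: "card (\<B> - core J v) \<le> n choose (K + t - (v + r))"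
      using card_hits_le[OF sub hit] r by simp
    define J' where "J' = J + (r + 2)"
    define M where "M = K - s'"
    have "14 * K \<le> t * K" using t_ge by simp
    then have J'n: "J' \<le> n" "J \<le> n" using tK tt t_ge J r unfolding J'_def by linarith+
    define P where "P = {X \<in> nsets {0<..J} (J - s). X \<inter> {0<..t} \<in> nsets {0<..t} (t - s) \<and>
      X \<inter> {t<..J} \<in> {{t<..J}}}"
    define Q where "Q = {Y \<in> nsets {J'<..n} M. \<forall>j\<in>{J'..n}. height J' Y j \<le> 1}"
    define L where "L = {F \<in> nsets {0<..n} (K + t). F \<inter> {0<..J} \<in> P \<and> F \<inter> {J<..n} \<in> Q}"
    have "card P = card (nsets {0<..t} (t - s)) * card {{t<..J}}"
      unfolding P_def using J t_ge by (intro card_nsets_product[of t J "t - s" "J - t"]) (auto simp: nsets_def)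
    also have "\<dots> = t choose s"
      using binomial_symmetric[of s t] J t_ge by simp
    finally have cardP: "card P = t choose s" .
    have cardQ: "tail (n - J) M r \<le> real (card Q)"
    proof -
      define H where "H = {Y \<in> nsets {J'<..J' + (n - J')} M. \<exists>j\<in>{J'..J' + (n - J')}. int 2 \<le> height J' Y j}"
      have fin: "finite Q" "finite H" unfolding Q_def H_def by (intro finite_nsets_filter; simp)+
      have "nsets {J'<..n} M \<subseteq> Q \<union> H"
      proof
        fix Y assume Y: "Y \<in> nsets {J'<..n} M"
        show "Y \<in> Q \<union> H"
        proof (cases "\<exists>j\<in>{J'..n}. int 2 \<le> height J' Y j")
          case True
          then show ?thesis using Y J'n by (simp add: H_def)
        next
          case False
          have "height J' Y j \<le> 1" if "j \<in> {J'..n}" for j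
          proof -
            have "\<not> int 2 \<le> height J' Y j" using False that by blast
            then show ?thesis by simp
          qed
          then show ?thesis using Y unfolding Q_def by blast
        qed
      qed
      then have "card (nsets {J'<..n} M) \<le> card (Q \<union> H)" using fin by (intro card_mono) auto
      also have "\<dots> \<le> card Q + card H" by (rule card_Un_le)
      finally have "(n - J') choose M \<le> card Q + card H" by simp
      moreover have "card H \<le> (if 2 \<le> M then (n - J') choose (M - 2) else 0)"
        unfolding H_def by (rule card_hit_le)
      ultimately have "(n - J') choose M \<le> card Q + (if 2 \<le> M then (n - J') choose (M - 2) else 0)"
        by linarith
      then have "real ((n - J') choose M) \<le> real (card Q) + real (if 2 \<le> M then (n - J') choose (M - 2) else 0)"
        by (metis of_nat_le_iff of_nat_add)
      moreover have "n - J - (r + 2) = n - J'" by (simp add: J'_def)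
      ultimately show ?thesis unfolding tail_def by (simp only:)
    qed
    have "card L = card P * card Q"
      unfolding L_def
    proof (rule card_nsets_product)
      show "J - s + M = K + t" using J by (simp add: M_def)
      show "P \<subseteq> nsets {0<..J} (J - s)" by (auto simp: P_def)
      show "Q \<subseteq> nsets {J<..n} M" by (auto simp: Q_def nsets_def J'_def)
    qed (use J'n in simp)
    then have cardL: "real (t choose s) * tail (n - J) M r \<le> real (card L)"
      using cardP cardQ by (simp add: mult_left_mono)
    have cnt: "card (F \<inter> {0<..j}) = j - s" if F: "F \<in> L" and j: "t \<le> j" "j \<le> J" for F j
    proof -
      define X where "X = F \<inter> {0<..J}"
      have X: "card (X \<inter> {0<..t}) = t - s" "X \<inter> {t<..J} = {t<..J}"
        using F by (auto simp: L_def P_def X_def nsets_def)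
      have "F \<inter> {0<..j} = (X \<inter> {0<..t}) \<union> {t<..j}"
      proof -
        have "F \<inter> {0<..j} = X \<inter> {0<..j}" using j by (auto simp: X_def)
        moreover have "{0<..j} = {0<..t} \<union> {t<..j}" using j by auto
        moreover have "X \<inter> {t<..j} = {t<..j}"
        proof -
          have "{t<..j} \<subseteq> {t<..J}" using j by auto
          then show ?thesis using X(2) by blast
        qed
        ultimately show ?thesis by (simp only: Int_Un_distrib)
      qed
      also have "card \<dots> = card (X \<inter> {0<..t}) + card {t<..j}"
        by (intro card_Un_disjoint) auto
      finally show ?thesis using X(1) J j t_ge by simp
    qed
    have b_cnt: "card (b \<inter> {0<..J}) + s' + 1 \<le> J"
      using out[OF b(1)] J by (simp add: height_def)
    have L_not_meet: "\<not> 2 * int t \<le> height 0 F j + height 0 b j" if F: "F \<in> L" and j: "j \<le> n" for F j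
    proof -
      \<comment> \<open>Before time \<open>t\<close> the sum is at most \<open>2 * j\<close>. From
        \<open>t\<close> to \<open>J\<close> the down-steps of \<open>F\<close> are over, so its
        height is \<open>j - 2 * s\<close>, while \<open>b\<close>, being outside its core, has at
        most \<open>t + s - 1\<close> up-steps. Then the descent of \<open>F\<close> cancels any
        rise of \<open>b\<close>, and afterwards the heights are at most \<open>u - r - 1\<close>
        and \<open>v + r\<close>.\<close>
      consider "j < t" | "t \<le> j" "j \<le> J" | "J \<le> j" "j \<le> J'" | "J' \<le> j" by linarith
      then show ?thesis
      proof cases
        case 1
        then show ?thesis using height_le[of 0 j F] height_le[of 0 j b] by simp
      next
        case 2
        have "card (b \<inter> {0<..j}) \<le> card (b \<inter> {0<..J})" using 2 by (intro card_mono) auto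
        then show ?thesis using cnt[OF F 2] b_cnt 2 J t_ge by (simp add: height_def)
      next
        case 3
        have "F \<inter> {J<..n} \<subseteq> {J'<..n}" using F by (auto simp: L_def Q_def nsets_def)
        then have "F \<inter> {J<..j} = {}" using 3 j by force
        then have "height J F j = - (int j - int J)" by (simp add: height_def)
        then have "height 0 F j = height 0 F J - (int j - int J)"
          using height_split[of 0 J j F] 3 by simp
        moreover have "height 0 b j \<le> height 0 b J + (int j - int J)"
          using height_split[of 0 J j b] height_le[of J j b] 3 by simp
        ultimately have "height 0 F j + height 0 b j \<le> height 0 F J + height 0 b J" by simp
        also have "\<dots> < 2 * int t"
          using cnt[OF F, of J] b_cnt J t_ge by (simp add: height_def)
        finally show ?thesis by simp
      next
        case 4
        have Q: "F \<inter> {J<..n} \<subseteq> {J'<..n}" "height J' (F \<inter> {J<..n}) j \<le> 1"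
          using F 4 j by (auto simp: L_def Q_def nsets_def)
        have "F \<inter> {J<..J'} = {}" using Q(1) J'n by force
        then have "height J F J' = - int (r + 2)" by (simp add: height_def J'_def)
        moreover have "height J' F j \<le> 1"
          using Q(2) height_Int[of J J' j n F] j by (simp add: J'_def)
        moreover have "height 0 F j = height 0 F J + height J F J' + height J' F j"
          using height_split[of 0 J j F] height_split[of J J' j F] 4 by (simp add: J'_def)
        moreover have "height 0 F J = int u"
          using cnt[OF F, of J] J t_ge by (simp add: height_def)
        ultimately have "height 0 F j \<le> int u - int r - 1" by simp
        moreover have "u + v = 2 * t" using J by simp
        ultimately show ?thesis using b_le[OF j] by linarith
      qed
    qed
    have "L \<inter> \<A> = {}"
    proof (rule ccontr)
      assume "L \<inter> \<A> \<noteq> {}"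
      then obtain F where F: "F \<in> L" "F \<in> \<A>" by blast
      then obtain j where "j \<le> n" "2 * int t \<le> height 0 F j + height 0 b j"
        using meets b(1) unfolding meets_def by blast
      then show False using L_not_meet F(1) by blast
    qed
    moreover have "L \<subseteq> core J u"
    proof
      fix F assume F: "F \<in> L"
      then have "height 0 F J = int u" using cnt[OF F, of J] J t_ge by (simp add: height_def)
      then show "F \<in> core J u" using F by (simp add: L_def core_def)
    qed
    ultimately have "(\<A> \<inter> core J u) \<union> L \<subseteq> core J u" "(\<A> \<inter> core J u) \<inter> L = {}" by auto
    then have "card (\<A> \<inter> core J u) + card L \<le> card (core J u)"
      using card_mono[OF finite_core, of "(\<A> \<inter> core J u) \<union> L" J u]
        card_Un_disjoint[of "\<A> \<inter> core J u" L] finite_core[of J u] finite_subset by fastforce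
    then have "real (t choose s) * tail (n - J) M r \<le> ?cA - real (card (\<A> \<inter> core J u))"
      using cardL by linarith
    then have "real (t choose s) * tail (n - J) M r * ?cB
        \<le> (?cA - real (card (\<A> \<inter> core J u))) * ?cB" by (intro mult_right_mono) simp_all
    moreover have "real (card (\<B> - core J v)) * ?cA \<le> real (n choose (K + t - (v + r))) * ?cA"
      using few by (intro mult_right_mono) simp_all
    ultimately show ?thesis using trade[OF r] by (simp add: M_def)
  qed
  then show "\<B> - core J v \<noteq> {} \<Longrightarrow> real (card (\<B> - core J v)) * ?cA
      < (?cA - real (card (\<A> \<inter> core J u))) * ?cB" .
  show "real (card (\<B> - core J v)) * ?cA \<le> (?cA - real (card (\<A> \<inter> core J u))) * ?cB"
  proof (cases "\<B> - core J v = {}")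
    case True
    have "card (\<A> \<inter> core J u) \<le> card (core J u)" by (intro card_mono finite_core) auto
    then show ?thesis unfolding True by simp
  qed (use strict in simp)
qed

end

text \<open>After division by \<open>a\<close> and \<open>b\<close> the last two hypotheses say that
  the four fractions sum to at most 2, and the inequality of arithmetic and geometric means bounds
  the product of the two sums by 1. In the application \<open>p\<close> and \<open>q\<close> count
  walks inside cores of sizes \<open>a\<close> and \<open>b\<close>, \<open>p'\<close> and
  \<open>q'\<close> those outside.\<close>

lemma exchange_product_le:
  fixes a b :: real
  assumes "0 < a" "0 < b" "0 \<le> p" "p \<le> a" "0 \<le> q" "q \<le> b" "0 \<le> p'" "0 \<le> q'"
    and "q' * a \<le> (a - p) * b" "p' * b \<le> (b - q) * a"
  shows "(p + p') * (q + q') \<le> a * b"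
    and "q' * a < (a - p) * b \<or> p' * b < (b - q) * a \<Longrightarrow> (p + p') * (q + q') < a * b"
proof -
  define x y x' y' where "x = p / a" "y = q / b" "x' = p' / a" "y' = q' / b"
  have eq: "p = x * a" "q = y * b" "p' = x' * a" "q' = y' * b"
    using assms(1,2) by (simp_all add: x_y_x'_y'_def)
  have nn: "0 \<le> x" "0 \<le> y" "0 \<le> x'" "0 \<le> y'" using assms by (simp_all add: x_y_x'_y'_def)
  have "y' * (a * b) \<le> (1 - x) * (a * b)" "x' * (a * b) \<le> (1 - y) * (a * b)"
    using assms(9,10) unfolding eq by (simp_all add: algebra_simps)
  then have le: "y' \<le> 1 - x" "x' \<le> 1 - y" using assms(1,2) by simp_all
  have prod: "(p + p') * (q + q') = ((x + x') * (y + y')) * (a * b)"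
    unfolding eq by (simp add: algebra_simps)
  have amgm: "4 * ((x + x') * (y + y')) \<le> ((x + x') + (y + y'))\<^sup>2"
    using zero_le_square[of "(x + x') - (y + y')"] by (simp add: power2_eq_square algebra_simps)
  have "((x + x') + (y + y'))\<^sup>2 \<le> 2\<^sup>2" using le nn by (intro power_mono) simp_all
  then have "(x + x') * (y + y') \<le> 1" using amgm by simp
  then show "(p + p') * (q + q') \<le> a * b" unfolding prod using assms(1,2) by simp
  assume "q' * a < (a - p) * b \<or> p' * b < (b - q) * a"
  then have "y' * (a * b) < (1 - x) * (a * b) \<or> x' * (a * b) < (1 - y) * (a * b)"
    unfolding eq by (simp add: algebra_simps)
  then have "y' < 1 - x \<or> x' < 1 - y" using assms(1,2) by simp
  then have "((x + x') + (y + y'))\<^sup>2 < 2\<^sup>2" using le nn by (intro power_strict_mono) auto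
  then have "(x + x') * (y + y') < 1" using amgm by simp
  then show "(p + p') * (q + q') < a * b" unfolding prod using assms(1,2) by simp
qed

section \<open>The bound and its equality case\<close>

context large_ground_set
begin

lemma core_product_le:
  assumes \<A>: "\<A> \<subseteq> nsets {0<..n} (K + t)" and \<B>: "\<B> \<subseteq> nsets {0<..n} (K + t)"
    and meets: "meets \<A> \<B>"
    and J: "u + s = t + s'" "v + s' = t + s" "J = t + s + s'" "s \<le> 1" "s' \<le> 1" "s \<le> K" "s' \<le> K"
    and A: "\<And>A. A \<in> \<A> \<Longrightarrow> int u \<le> height 0 A J \<or> hits (Suc u) A"
    and B: "\<And>B. B \<in> \<B> \<Longrightarrow> int v \<le> height 0 B J \<or> hits (Suc v) B"
    and pos: "0 < card (core J u)" "0 < card (core J v)"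
    and trade: "\<And>r. 1 \<le> r \<Longrightarrow> v + r \<le> K + t \<Longrightarrow>
      real (n choose (K + t - (v + r))) * real (card (core J u))
        < real (t choose s) * tail (n - J) (K - s') r * real (card (core J v))"
    and trade': "\<And>r. 1 \<le> r \<Longrightarrow> u + r \<le> K + t \<Longrightarrow>
      real (n choose (K + t - (u + r))) * real (card (core J v))
        < real (t choose s') * tail (n - J) (K - s) r * real (card (core J u))"
  shows "real (card \<A>) * real (card \<B>) \<le> real (card (core J u)) * real (card (core J v))"
    and "\<not> (\<A> \<subseteq> core J u \<and> \<B> \<subseteq> core J v) \<Longrightarrow>
      real (card \<A>) * real (card \<B>) < real (card (core J u)) * real (card (core J v))"
proof -
  have J': "J = t + s' + s" using J by simp
  note excess = excess_le[OF \<A> \<B> meets J(1-5) J(7) B trade]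
  note excess' = excess_le[OF \<B> \<A> meets_commute[OF meets] J(2) J(1) J' J(5) J(4) J(6) A trade']
  have split: "real (card \<C>) = real (card (\<C> \<inter> \<D>)) + real (card (\<C> - \<D>))"
    if "\<C> \<subseteq> nsets {0<..n} (K + t)" for \<C> \<D>
    using card_Int_Diff[of \<C> \<D>] finite_family[OF that] by simp
  have le: "card (\<C> \<inter> core J w) \<le> card (core J w)" for \<C> w
    by (intro card_mono finite_core) auto
  note exchange = exchange_product_le[of "real (card (core J u))" "real (card (core J v))"
      "real (card (\<A> \<inter> core J u))" "real (card (\<B> \<inter> core J v))"
      "real (card (\<A> - core J u))" "real (card (\<B> - core J v))"]
  show "real (card \<A>) * real (card \<B>) \<le> real (card (core J u)) * real (card (core J v))"
    unfolding split[OF \<A>, of "core J u"] split[OF \<B>, of "core J v"]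
    by (rule exchange(1)) (use pos le excess(1) excess'(1) in simp_all)
  assume "\<not> (\<A> \<subseteq> core J u \<and> \<B> \<subseteq> core J v)"
  then have "\<B> - core J v \<noteq> {} \<or> \<A> - core J u \<noteq> {}" by blast
  then show "real (card \<A>) * real (card \<B>) < real (card (core J u)) * real (card (core J v))"
    unfolding split[OF \<A>, of "core J u"] split[OF \<B>, of "core J v"]
    using excess(2) excess'(2)
    by (intro exchange(2)) (use pos le excess(1) excess'(1) in auto)
qed

text \<open>Of the four cases only \<open>s = s' = 0\<close>, where both cores are the star on
  \<open>{1..t}\<close>, can attain \<open>S\<^sup>2\<close>; the others are strict, so the equality
  clause holds vacuously there.\<close>

lemma single_time_bound:
  assumes \<A>: "\<A> \<subseteq> nsets {0<..n} (K + t)" and \<B>: "\<B> \<subseteq> nsets {0<..n} (K + t)"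
    and meets: "meets \<A> \<B>"
    and J: "u + s = t + s'" "v + s' = t + s" "J = t + s + s'" "J \<le> n" "s \<le> K" "s' \<le> K"
    and ss: "s \<le> s'"
    and A: "\<And>A. A \<in> \<A> \<Longrightarrow> int u \<le> height 0 A J \<or> hits (Suc u) A"
    and B: "\<And>B. B \<in> \<B> \<Longrightarrow> int v \<le> height 0 B J \<or> hits (Suc v) B"
  shows "real (card \<A>) * real (card \<B>) \<le> S\<^sup>2 \<and>
    (real (card \<A>) * real (card \<B>) = S\<^sup>2 \<longrightarrow> \<A> \<subseteq> core t t \<and> \<B> \<subseteq> core t t)"
proof -
  consider "2 \<le> s'" | "s = 0" "s' = 0" | "s = 0" "s' = 1" | "s = 1" "s' = 1" using ss by linarith
  then show ?thesis
  proof cases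
    case 1
    obtain d where d: "s' = s + d" using ss le_Suc_ex by blast
    have u: "u = t + d" and v: "v = t - d" and dt: "d \<le> t" using J d by auto
    have "card \<A> \<le> ballot u s * ((n - J) choose (K + t - (u + s))) +
        (if Suc u \<le> K + t then n choose (K + t - Suc u) else 0)"
      using J d by (intro card_through_le[OF \<A> _ _ _ A]) auto
    moreover have "n - J = n - (t + (2 * s + d))" "K + t - (u + s) = K - (s + d)"
      "K + t - Suc u = K - (d + 1)" "Suc u \<le> K + t \<longleftrightarrow> d + 1 \<le> K" using J d u by auto
    ultimately have a: "card \<A> \<le> ballot (t + d) s * ((n - (t + (2 * s + d))) choose (K - (s + d))) +
      (if d + 1 \<le> K then n choose (K - (d + 1)) else 0)" unfolding u by (simp only:)
    have "card \<B> \<le> ballot v s' * ((n - J) choose (K + t - (v + s'))) +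
        (if Suc v \<le> K + t then n choose (K + t - Suc v) else 0)"
      using J d by (intro card_through_le[OF \<B> _ _ _ B]) auto
    moreover have "n - J = n - (t + (2 * s + d))" "K + t - (v + s') = K - s"
      "K + t - Suc v = K + d - 1" "(Suc v \<le> K + t) = True" using J d v dt 1 by auto
    ultimately have b: "card \<B> \<le> ballot (t - d) (s + d) * ((n - (t + (2 * s + d))) choose (K - s)) +
      (n choose (K + d - 1))" unfolding v d by (simp only: if_True)
    have "real (card \<A>) * real (card \<B>) = real (card \<A> * card \<B>)" by simp
    also have "\<dots> \<le> real ((ballot (t + d) s * ((n - (t + (2 * s + d))) choose (K - (s + d))) +
      (if d + 1 \<le> K then n choose (K - (d + 1)) else 0)) *
      (ballot (t - d) (s + d) * ((n - (t + (2 * s + d))) choose (K - s)) + (n choose (K + d - 1))))"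
      using mult_le_mono[OF a b] by (simp only: of_nat_le_iff)
    also have "\<dots> < S\<^sup>2" using 1 d dt J by (intro ballot_product_less) auto
    finally show ?thesis by simp
  next
    case 2
    then have uv: "u = t" "v = t" "J = t" using J by auto
    have core: "real (card (core t t)) = S"
      using card_core[of t t t] t_le_n by (simp add: S_def)
    have trade: "real (n choose (K + t - (t + r))) * real (card (core t t))
        < real (t choose 0) * tail (n - t) (K - 0) r * real (card (core t t))"
      if "1 \<le> r" "t + r \<le> K + t" for r
      using trade_0_0[of r] that S_pos unfolding core by simp
    have pos: "0 < card (core t t)" using core S_pos by simp
    note bound = core_product_le[OF \<A> \<B> meets, of t 0 0 t t]
    have "real (card \<A>) * real (card \<B>) \<le> S\<^sup>2"
      using bound(1) A B pos trade uv core by (simp add: power2_eq_square)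
    moreover have "\<A> \<subseteq> core t t \<and> \<B> \<subseteq> core t t" if "real (card \<A>) * real (card \<B>) = S\<^sup>2"
      using bound(2) A B pos trade uv core that by (force simp add: power2_eq_square)
    ultimately show ?thesis by blast
  next
    case 3
    \<comment> \<open>One core requires \<open>t + 1\<close> up-steps at the start, the other allows
      one down-step among the first \<open>t + 1\<close>.\<close>
    then have uv: "u = t + 1" "v = t - 1" "J = t + 1" and K: "1 \<le> K" using J by auto
    have Jn: "t + 1 \<le> n" using J(4) uv by simp
    have cu: "real (card (core (t + 1) (t + 1))) = P"
      using card_core[of "t + 1" "t + 1" "t + 1"] Jn K by (simp add: P_def)
    have "{t..t + 1} = {t, t + 1}" by auto
    then have cv: "real (card (core (t + 1) (t - 1))) = (real t + 1) * Q + P"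
      using card_core[of "t + 1" "t - 1" t] Jn K t_ge by (simp add: P_def Q_def algebra_simps)
    have "real (card \<A>) * real (card \<B>)
      \<le> real (card (core (t + 1) (t + 1))) * real (card (core (t + 1) (t - 1)))"
    proof (rule core_product_le(1)[OF \<A> \<B> meets, of _ 0 1])
      show "0 < card (core (t + 1) (t + 1))" using cu P_pos[OF K] by (metis of_nat_0_less_iff)
      have "0 < (real t + 1) * Q + P" using P_pos[OF K] PQ_nonneg by (simp add: add_nonneg_pos)
      then show "0 < card (core (t + 1) (t - 1))" using cv by (metis of_nat_0_less_iff)
    next
      fix r assume r: "1 \<le> r" "t - 1 + r \<le> K + t"
      then have "K + t - (t - 1 + r) = K + 1 - r" "r \<le> K + 1" using t_ge by auto
      then show "real (n choose (K + t - (t - 1 + r))) * real (card (core (t + 1) (t + 1)))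
        < real (t choose 0) * tail (n - (t + 1)) (K - 1) r * real (card (core (t + 1) (t - 1)))"
        using trade_0_1[of r] r K unfolding cu cv by simp
    next
      fix r assume r: "1 \<le> r" "t + 1 + r \<le> K + t"
      then have "K + t - (t + 1 + r) = K - 1 - r" "r \<le> K - 1" by auto
      then show "real (n choose (K + t - (t + 1 + r))) * real (card (core (t + 1) (t - 1)))
        < real (t choose 1) * tail (n - (t + 1)) (K - 0) r * real (card (core (t + 1) (t + 1)))"
        using trade_1_0[of r] r unfolding cu cv by simp
    qed (use A B uv K t_ge in auto)
    also have "\<dots> < S\<^sup>2" unfolding cu cv by (rule product_0_1_less[OF K])
    finally show ?thesis by simp
  next
    case 4
    \<comment> \<open>Both cores are the family with at least \<open>t + 1\<close> of the first
      \<open>t + 2\<close> elements.\<close>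
    then have uv: "u = t" "v = t" "J = t + 2" and K: "1 \<le> K" using J by auto
    have Jn: "t + 2 \<le> n" using J(4) uv by simp
    have set: "{t + 1..t + 2} = {t + 1, t + 2}" by auto
    have ch: "(t + 2) choose (t + 1) = t + 2" "(t + 2) choose (t + 2) = 1"
      "K + t - (t + 1) = K - 1" "K + t - (t + 2) = K - 2" "(t + 1 \<le> K + t) = True" "t + 2 \<le> K + t \<longleftrightarrow> 2 \<le> K"
      using K by simp_all
    have "card (core (t + 2) t) = ((t + 2) choose (t + 1)) *
        (if t + 1 \<le> K + t then (n - (t + 2)) choose (K + t - (t + 1)) else 0) +
        ((t + 2) choose (t + 2)) * (if t + 2 \<le> K + t then (n - (t + 2)) choose (K + t - (t + 2)) else 0)"
      using card_core[of "t + 2" t "t + 1"] Jn unfolding set by simp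
    then have eq: "card (core (t + 2) t) = (t + 2) * ((n - (t + 2)) choose (K - 1)) +
        (if 2 \<le> K then (n - (t + 2)) choose (K - 2) else 0)"
      by (simp only: ch if_True mult_1)
    have less: "real (card (core (t + 2) t)) < S" using frankl_1_less[OF K] by (simp only: eq)
    have "0 < (n - (t + 2)) choose (K - 1)"
      using tK tt t_ge by (intro zero_less_binomial) linarith
    then have pos: "0 < card (core (t + 2) t)"
      using eq by simp
    have trade: "real (n choose (K + t - (t + r))) * real (card (core (t + 2) t))
        < real (t choose 1) * tail (n - (t + 2)) (K - 1) r * real (card (core (t + 2) t))"
      if "1 \<le> r" "t + r \<le> K + t" for r
      using trade_1_1[of r] that pos by simp
    have "real (card \<A>) * real (card \<B>)
      \<le> real (card (core (t + 2) t)) * real (card (core (t + 2) t))"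
      by (rule core_product_le(1)[OF \<A> \<B> meets, of _ 1 1]) (use A B uv K pos trade in auto)
    also have "\<dots> < S * S" using less by (intro mult_strict_mono) simp_all
    finally show ?thesis by (simp add: power2_eq_square)
  qed
qed

definition hits_twice :: "nat \<Rightarrow> nat set \<Rightarrow> bool" where
  "hits_twice u F \<longleftrightarrow> (\<exists>i j. i < j \<and> j \<le> n \<and> int u \<le> height 0 F i \<and> int u \<le> height 0 F j)"

lemma card_hits_twice_le:
  assumes "\<A> \<subseteq> nsets {0<..n} k" "\<And>A. A \<in> \<A> \<Longrightarrow> hits_twice u A"
  shows "card \<A> \<le> (if u < k then 2 * ((n - 1) choose (k - u - 1)) else 0)"
proof -
  let ?X = "{F \<in> nsets {0<..0 + n} k.
    \<exists>i j. 0 \<le> i \<and> i < j \<and> j \<le> 0 + n \<and> int u \<le> height 0 F i \<and> int u \<le> height 0 F j}"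
  have "\<A> \<subseteq> ?X" using assms unfolding hits_twice_def by auto
  then have "card \<A> \<le> card ?X" by (intro card_mono finite_nsets_filter) simp_all
  also have "\<dots> \<le> (if u < k then 2 * ((n - 1) choose (k - u - 1)) else 0)"
    using t_le_n t_ge by (intro card_hit_twice_le) simp
  finally show ?thesis .
qed

lemma all_hits_twice_bound:
  assumes "\<A> \<subseteq> nsets {0<..n} (K + t)" "\<B> \<subseteq> nsets {0<..n} (K + t)" "u + v = 2 * t"
    and "\<And>A. A \<in> \<A> \<Longrightarrow> hits_twice u A" "\<And>B. B \<in> \<B> \<Longrightarrow> hits v B"
  shows "real (card \<A>) * real (card \<B>) < S\<^sup>2"
proof -
  have "card \<A> * card \<B> \<le> (if u < K + t then 2 * ((n - 1) choose (K + t - u - 1)) else 0) *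
    (if v \<le> K + t then n choose (K + t - v) else 0)"
    using assms by (intro mult_le_mono card_hits_twice_le card_hits_le) auto
  then have "real (card \<A> * card \<B>) \<le> real ((if u < K + t then 2 * ((n - 1) choose (K + t - u - 1)) else 0) *
    (if v \<le> K + t then n choose (K + t - v) else 0))" by (simp only: of_nat_le_iff)
  also have "\<dots> < S\<^sup>2" by (rule hit_twice_product_less[OF assms(3)])
  finally show ?thesis by simp
qed

text \<open>Steps have size 1, so a walk above \<open>u\<close> was at least at \<open>u\<close> one
  step earlier, which makes two visits.\<close>

lemma hit_once_le:
  assumes "\<not> hits_twice u F" "j \<le> n"
  shows "height 0 F j \<le> int u"
proof (rule ccontr)
  assume "\<not> ?thesis"
  then have h: "int u + 1 \<le> height 0 F j" by simp
  then obtain i where i: "j = Suc i" by (cases j) auto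
  then have "int u \<le> height 0 F i" using h height_Suc[of 0 i F] by (auto split: if_splits)
  then show False using assms h i unfolding hits_twice_def by (metis le_add_same_cancel1 lessI order_trans zero_le_one)
qed

lemma meets_bound:
  assumes \<A>: "\<A> \<subseteq> nsets {0<..n} (K + t)" and \<B>: "\<B> \<subseteq> nsets {0<..n} (K + t)"
    and meets: "meets \<A> \<B>"
  shows "real (card \<A>) * real (card \<B>) \<le> S\<^sup>2 \<and>
    (real (card \<A>) * real (card \<B>) = S\<^sup>2 \<longrightarrow> \<A> \<subseteq> core t t \<and> \<B> \<subseteq> core t t)"
proof -
  obtain u v where uv: "u + v = 2 * t" and hA: "\<And>A. A \<in> \<A> \<Longrightarrow> hits u A"
    and hB: "\<And>B. B \<in> \<B> \<Longrightarrow> hits v B" using levels[OF meets] by blast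
  consider "\<forall>A\<in>\<A>. hits_twice u A" | "\<forall>B\<in>\<B>. hits_twice v B" |
    a b where "a \<in> \<A>" "\<not> hits_twice u a" "b \<in> \<B>" "\<not> hits_twice v b" by blast
  then show ?thesis
  proof cases
    case 1
    then have "real (card \<A>) * real (card \<B>) < S\<^sup>2"
      using hB by (intro all_hits_twice_bound[OF \<A> \<B> uv]) auto
    then show ?thesis by simp
  next
    case 2
    have "v + u = 2 * t" using uv by simp
    then have "real (card \<B>) * real (card \<A>) < S\<^sup>2"
      using hA 2 by (intro all_hits_twice_bound[OF \<B> \<A>, of v u]) auto
    then show ?thesis by (simp add: mult.commute)
  next
    case 3
    obtain J where J: "J \<le> n" "2 * int t \<le> height 0 a J + height 0 b J"
      using meets 3 unfolding meets_def by blast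
    have uv': "int u + int v = 2 * int t" using uv by linarith
    \<comment> \<open>Neither walk exceeds its level and the levels sum to \<open>2 * t\<close>, so
      a common time leaves no slack.\<close>
    have ha: "height 0 a J = int u" and hb: "height 0 b J = int v"
      using J uv' hit_once_le[OF 3(2) J(1)] hit_once_le[OF 3(4) J(1)] by linarith+
    have low: "height 0 F j < int w"
      if "\<not> hits_twice w F" "height 0 F J = int w" "j \<le> n" "j \<noteq> J" for F w j
    proof (rule ccontr)
      assume "\<not> ?thesis"
      then have "hits_twice w F"
        unfolding hits_twice_def using that(2-4) J(1)
        by (cases "j < J") (force intro: exI[of _ j] exI[of _ J])+
      then show False using that(1) by simp
    qed
    \<comment> \<open>At any time other than \<open>J\<close> the single-visit walk \<open>F\<close>
      is strictly below its level, so a walk that meets it there exceeds its own.\<close>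
    have through: "int y \<le> height 0 G J \<or> hits (Suc y) G"
      if "meets \<C> \<D>" "F \<in> \<C>" "G \<in> \<D>" "\<not> hits_twice w F" "height 0 F J = int w"
        "int w + int y = 2 * int t" for \<C> \<D> F G w y
    proof -
      note hyps = that
      obtain j where j: "j \<le> n" "2 * int t \<le> height 0 F j + height 0 G j"
        using hyps(1-3) unfolding meets_def by blast
      show ?thesis
      proof (cases "j = J")
        case True
        then show ?thesis using j(2) that(5,6) by simp
      next
        case False
        then have "int (Suc y) \<le> height 0 G j" using low[OF that(4,5) j(1)] j(2) that(6) by simp
        then show ?thesis using j(1) unfolding hits_def by blast
      qed
    qed
    have A: "int u \<le> height 0 A J \<or> hits (Suc u) A" if "A \<in> \<A>" for A
      using through[OF meets_commute[OF meets] 3(3) that 3(4) hb] uv' by simp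
    have B: "int v \<le> height 0 B J \<or> hits (Suc v) B" if "B \<in> \<B>" for B
      using through[OF meets 3(1) that 3(2) ha] uv' by simp
    \<comment> \<open>These are the down-steps until \<open>J\<close>. The up-steps,
      \<open>u + s = t + s'\<close> and \<open>v + s' = t + s\<close>, are at most
      \<open>K + t\<close>, which bounds \<open>s\<close> and \<open>s'\<close> by
      \<open>K\<close>.\<close>
    define s s' where "s = J - card (a \<inter> {0<..J})" "s' = J - card (b \<inter> {0<..J})"
    have cardJ: "card (F \<inter> {0<..J}) \<le> J" for F
      using card_mono[of "{0<..J}" "F \<inter> {0<..J}"] by simp
    have cardk: "card (F \<inter> {0<..J}) \<le> K + t" if "F \<in> nsets {0<..n} (K + t)" for F
      using that card_mono[of F "F \<inter> {0<..J}"] by (auto simp: nsets_def)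
    have eqs: "u + 2 * s = J" "v + 2 * s' = J"
      using ha hb cardJ[of a] cardJ[of b] by (auto simp: s_s'_def height_def)
    have "u + s \<le> K + t" "v + s' \<le> K + t"
      using eqs cardJ[of a] cardJ[of b] cardk[of a] cardk[of b] 3 \<A> \<B> by (auto simp: s_s'_def)
    then have st: "u + s = t + s'" "v + s' = t + s" "J = t + s + s'" "s \<le> K" "s' \<le> K"
      using eqs uv by linarith+
    show ?thesis
    proof (cases "s \<le> s'")
      case True
      then show ?thesis using single_time_bound[OF \<A> \<B> meets st(1-3) J(1) st(4,5) True A B] by blast
    next
      case False
      have "J = t + s' + s" "s' \<le> s" using st False by simp_all
      then show ?thesis
        using single_time_bound[OF \<B> \<A> meets_commute[OF meets] st(2,1) _ J(1) st(5,4) _ B A]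
        by (metis mult.commute)
    qed
  qed
qed

lemma core_eq_star: "core t t = star n (K + t) {1..t}"
proof -
  have "{1..n} = {0<..n}" by auto
  moreover have "int t \<le> height 0 F t \<longleftrightarrow> {1..t} \<subseteq> F" if "finite F" for F
  proof -
    have e: "{1..t} = {0<..t}" by auto
    have "int t \<le> height 0 F t \<longleftrightarrow> t \<le> card (F \<inter> {1..t})" unfolding e by (auto simp: height_def)
    also have "\<dots> \<longleftrightarrow> {1..t} \<subseteq> F"
    proof
      assume "t \<le> card (F \<inter> {1..t})"
      then have "F \<inter> {1..t} = {1..t}" by (intro card_seteq) auto
      then show "{1..t} \<subseteq> F" by blast
    next
      assume "{1..t} \<subseteq> F"
      then have "F \<inter> {1..t} = {1..t}" by blast
      then show "t \<le> card (F \<inter> {1..t})" by simp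
    qed
    finally show ?thesis .
  qed
  ultimately show ?thesis unfolding core_def star_def by (auto simp: nsets_def)
qed

lemma compressed_bound:
  assumes \<A>: "\<A> \<subseteq> nsets {1..n} (K + t)" and \<B>: "\<B> \<subseteq> nsets {1..n} (K + t)"
    and cross: "cross_intersecting t \<A> \<B>" and comp: "compressed \<B>"
  shows "card \<A> * card \<B> \<le> ((n - t) choose K)\<^sup>2 \<and>
    (card \<A> * card \<B> = ((n - t) choose K)\<^sup>2 \<longrightarrow>
      \<A> = star n (K + t) {1..t} \<and> \<B> = star n (K + t) {1..t})"
proof -
  have e: "{1..m} = {0<..m}" for m :: nat by auto
  have e': "{Suc 0..m} = {0<..m}" for m :: nat by auto
  have "meets \<A> \<B>"
    unfolding meets_def
  proof (intro ballI)
    fix A B assume "A \<in> \<A>" "B \<in> \<B>"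
    then obtain m where "m \<le> n" "m + t \<le> card (A \<inter> {1..m}) + card (B \<inter> {1..m})"
      using cross_intersecting_compressed[OF comp \<A> \<B> cross] by blast
    then show "\<exists>j\<le>n. 2 * int t \<le> height 0 A j + height 0 B j"
      by (intro exI[of _ m]) (auto simp: height_def e')
  qed
  from meets_bound[OF \<A>[unfolded e] \<B>[unfolded e] this]
  have bound: "real (card \<A>) * real (card \<B>) \<le> S\<^sup>2"
    and eq: "real (card \<A>) * real (card \<B>) = S\<^sup>2 \<longrightarrow> \<A> \<subseteq> core t t \<and> \<B> \<subseteq> core t t" by blast+
  have S: "S\<^sup>2 = real (((n - t) choose K)\<^sup>2)" by (simp add: S_def)
  have prod: "real (card \<A>) * real (card \<B>) = real (card \<A> * card \<B>)" by simp
  have "\<A> = star n (K + t) {1..t} \<and> \<B> = star n (K + t) {1..t}"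
    if eq2: "card \<A> * card \<B> = ((n - t) choose K)\<^sup>2"
  proof -
    have card_star': "card (star n (K + t) {1..t}) = (n - t) choose K"
      using card_star[of "{1..t}" n "K + t"] t_le_n by simp
    have sub: "\<A> \<subseteq> star n (K + t) {1..t}" "\<B> \<subseteq> star n (K + t) {1..t}"
      using eq eq2 unfolding prod S core_eq_star by simp_all
    have fin: "finite (star n (K + t) {1..t})" using finite_core[of t t] core_eq_star by simp
    have le: "card \<A> \<le> (n - t) choose K" "card \<B> \<le> (n - t) choose K"
      using card_mono[OF fin sub(1)] card_mono[OF fin sub(2)] card_star' by simp_all
    have pos: "0 < (n - t) choose K" using S_pos by (simp add: S_def)
    \<comment> \<open>Both families lie in the star, so a product equal to the square of its size
      forces both to fill it.\<close>
    have "card \<A> = (n - t) choose K"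
    proof (rule ccontr)
      assume "card \<A> \<noteq> (n - t) choose K"
      then have "card \<A> < (n - t) choose K" using le by simp
      then have "card \<A> * ((n - t) choose K) < ((n - t) choose K) * ((n - t) choose K)"
        using pos by (rule mult_less_mono1)
      moreover have "card \<A> * card \<B> \<le> card \<A> * ((n - t) choose K)"
        using le by simp
      ultimately show False using eq2 by (simp add: power2_eq_square)
    qed
    moreover from this have "card \<B> = (n - t) choose K"
      using eq2 pos by (simp add: power2_eq_square)
    ultimately show ?thesis using sub card_star' by (simp add: star_eqI)
  qed
  moreover have "card \<A> * card \<B> \<le> ((n - t) choose K)\<^sup>2"
    using bound unfolding prod S by (simp only: of_nat_le_iff)
  ultimately show ?thesis by blast
qed

end

section \<open>Stars as isomorphic copies of the Frankl family\<close>

lemma image_star: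
  assumes "f permutes {1..n}"
  shows "(`) f ` star n k T = star n k (f ` T)"
proof -
  have sub: "(`) g ` star n k U \<subseteq> star n k (g ` U)" if g: "g permutes {1..n}" for g U
  proof clarify
    fix F assume "F \<in> star n k U"
    then have F: "U \<subseteq> F" "F \<subseteq> {1..n}" "finite F" "card F = k" by (auto simp: star_def nsets_def)
    have "g ` F \<subseteq> {1..n}" using F(2) permutes_image[OF g] by blast
    moreover have "card (g ` F) = k" using F(4) permutes_inj_on[OF g] by (simp add: card_image)
    ultimately show "g ` F \<in> star n k (g ` U)" using F by (auto simp: star_def nsets_def)
  qed
  show ?thesis
  proof (intro equalityI sub[OF assms] subsetI)
    fix F assume F: "F \<in> star n k (f ` T)"
    have inv: "inv f permutes {1..n}" using assms by (rule permutes_inv)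
    have "inv f ` f ` T = T" using permutes_inj[OF assms] by (simp add: image_comp)
    then have "inv f ` F \<in> star n k T" using sub[OF inv, of "f ` T"] F by auto
    moreover have "f ` inv f ` F = F" using permutes_surj[OF assms] by (simp add: image_comp surj_iff)
    ultimately show "F \<in> (`) f ` star n k T" by (metis imageI)
  qed
qed

text \<open>For the converse, a permutation carrying \<open>{1..t}\<close> to \<open>T\<close> is
  glued from a bijection of these two sets, one of their complements in \<open>{1..n}\<close>, and
  the identity elsewhere.\<close>

lemma isomorphic_star_iff:
  assumes "t \<le> n"
  shows "isomorphic_families n \<B> (frankl_family 0 t n k) \<longleftrightarrow>
    (\<exists>T\<subseteq>{1..n}. card T = t \<and> \<B> = star n k T)"
proof -
  have frankl: "frankl_family 0 t n k = star n k {1..t}" by (simp add: frankl_family_0 star_def)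
  have sub: "{1..t} \<subseteq> {1..n}" using assms by simp
  show ?thesis
  proof
    assume "isomorphic_families n \<B> (frankl_family 0 t n k)"
    then obtain f where f: "f permutes {1..n}" "\<B> = star n k (f ` {1..t})"
      unfolding isomorphic_families_def frankl by (metis image_star)
    moreover have "f ` {1..t} \<subseteq> {1..n}" using sub permutes_image[OF f(1)] by blast
    moreover have "card (f ` {1..t}) = t" using permutes_inj_on[OF f(1)] by (simp add: card_image)
    ultimately show "\<exists>T\<subseteq>{1..n}. card T = t \<and> \<B> = star n k T" by blast
  next
    assume "\<exists>T\<subseteq>{1..n}. card T = t \<and> \<B> = star n k T"
    then obtain T where T: "T \<subseteq> {1..n}" "card T = t" "\<B> = star n k T" by blast
    have fT: "finite T" using T(1) finite_subset by blast
    obtain g where g: "bij_betw g {1..t} T"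
      using finite_same_card_bij[of "{1..t}" T] fT T(2) by auto
    have "card ({1..n} - {1..t}) = card ({1..n} - T)"
      using T fT sub by (simp add: card_Diff_subset)
    then obtain h where h: "bij_betw h ({1..n} - {1..t}) ({1..n} - T)"
      using finite_same_card_bij[of "{1..n} - {1..t}" "{1..n} - T"] by auto
    define f where "f x = (if x \<in> {1..t} then g x else if x \<in> {1..n} then h x else x)" for x
    have ft: "bij_betw f {1..t} T" using g by (subst bij_betw_cong[of _ _ g]) (auto simp: f_def)
    moreover have "bij_betw f ({1..n} - {1..t}) ({1..n} - T)"
      using h by (subst bij_betw_cong[of _ _ h]) (auto simp: f_def)
    ultimately have "bij_betw f ({1..t} \<union> ({1..n} - {1..t})) (T \<union> ({1..n} - T))"
      by (rule bij_betw_combine) blast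
    moreover have "{1..t} \<union> ({1..n} - {1..t}) = {1..n}" "T \<union> ({1..n} - T) = {1..n}"
      using sub T(1) by blast+
    ultimately have "bij_betw f {1..n} {1..n}" by simp
    then have "f permutes {1..n}" using sub by (intro bij_imp_permutes) (auto simp: f_def)
    moreover have "f ` {1..t} = T" using ft by (rule bij_betw_imp_surj_on)
    ultimately show "isomorphic_families n \<B> (frankl_family 0 t n k)"
      unfolding isomorphic_families_def frankl T(3) using image_star by metis
  qed
qed

theorem theorem1p1:
  fixes k t n :: nat and \<A> \<B> :: "nat set set"
  assumes "14 \<le> t" and "t \<le> k" and "(t + 1) * k \<le> n"
    and "\<A> \<subseteq> nsets {1..n} k" and "\<B> \<subseteq> nsets {1..n} k"
    and "cross_intersecting t \<A> \<B>"
  shows "card \<A> * card \<B> \<le> ((n - t) choose (k - t))\<^sup>2 \<and>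
    (card \<A> * card \<B> = ((n - t) choose (k - t))\<^sup>2 \<longleftrightarrow>
      \<A> = \<B> \<and> isomorphic_families n \<B> (frankl_family 0 t n k))"
proof -
  define K where "K = k - t"
  have k: "k = K + t" using assms(2) by (simp add: K_def)
  interpret large_ground_set K t n
    using assms(1,3) by unfold_locales (simp_all add: k)
  \<comment> \<open>This secures the room that the Kneser graph argument needs for undoing
    compressions.\<close>
  have "3 * K \<le> t * K" using t_ge by simp
  then have "3 * K + t + 1 \<le> n" using tK tt t_ge by linarith
  then have n: "3 * (K + t - t) + t + 1 \<le> n" by simp
  have bound: "card \<A> * card \<B> \<le> ((n - t) choose K)\<^sup>2 \<and>
    (card \<A> * card \<B> = ((n - t) choose K)\<^sup>2 \<longrightarrow>
      (\<exists>T\<subseteq>{1..n}. card T = t \<and> \<A> = star n (K + t) T \<and> \<B> = star n (K + t) T))"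
  proof (rule cross_intersecting_bound_from_compressed)
    fix \<A>' \<B>' :: "nat set set"
    assume "\<A>' \<subseteq> nsets {1..n} (K + t)" "\<B>' \<subseteq> nsets {1..n} (K + t)" "cross_intersecting t \<A>' \<B>'"
      "compressed \<B>'"
    then show "card \<A>' * card \<B>' \<le> ((n - t) choose K)\<^sup>2 \<and>
      (card \<A>' * card \<B>' = ((n - t) choose K)\<^sup>2 \<longrightarrow>
        \<A>' = star n (K + t) {1..t} \<and> \<B>' = star n (K + t) {1..t})"
      by (rule compressed_bound)
  qed (use assms(4-6) n t_ge k in simp_all)
  have "card (star n (K + t) T) = (n - t) choose K" if "T \<subseteq> {1..n}" "card T = t" for T
    using card_star[OF that(1), of "K + t"] that(2) by simp
  then have "card \<A> * card \<B> = ((n - t) choose K)\<^sup>2 \<longleftrightarrow>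
      \<A> = \<B> \<and> isomorphic_families n \<B> (frankl_family 0 t n (K + t))"
    unfolding isomorphic_star_iff[OF t_le_n] using bound by (auto simp: power2_eq_square)
  then show ?thesis using bound by (simp add: k)
qed

end
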